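(* Let $d$ be a fixed odd positive integer. For every $\varepsilon>0$ there is a constant $s_3(\varepsilon)$ with the following property. Let $\mathcal{W}=(\mathcal{V}_1,\dots,\mathcal{V}_n)$ be an $\varepsilon$-separated frameset, let $G=\langle g_1,\dots,g_n\rangle$ be an $s_3(\varepsilon)$-contracting group based on $\mathcal{W}$, and for every $i$ choose a constant $\varepsilon_i>0$ such that for any set $X\subset\mathbb{S}$ one has $B_{N_{\mathcal{V}_i}}(X,\varepsilon_i)\subset B_{N_0}(X,\frac{\varepsilon}{3})$; let $\mathbf{T}$ and $\mathcal{H}^0$ be the sets defined from these data in the context. Then for any $\mathbf{t}\in\mathbf{T}$, the action of the affine deformation $\Gamma:=G(\mathbf{t})$ on the affine space $\mathbb{R}^{d+1,d}$ has fundamental domain $\mathcal{H}^0=\mathcal{H}^0(\mathbf{t})$. More precisely: (i) the images of $\mathcal{H}^0$ under the elements of $\Gamma$ are pairwise disjoint; (ii) the images of its closure cover the whole space: $$\bigcup_{\gamma\in\Gamma}\overline{\gamma(\mathcal{H}^0)}=\mathbb{R}^{d+1,d}.$$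
   Context: $\mathbb{R}^{d+1,d}$ is $\mathbb{R}^{2d+1}$ equipped with a quadratic form $Q$ of signature $(d+1,d)$; $\perp$ refers to $Q$. $O(d+1,d)$ is the group of linear automorphisms preserving $Q$, $SO(d+1,d)$ its subgroup of elements of determinant $1$, $SO^+(d+1,d)$ its identity component. Fix a maximal positive definite subspace $S$, let $T=S^\perp$, let $\pi_S,\pi_T$ be the corresponding orthogonal projections, and let $N_0(x)=Q(\pi_S(x))-Q(\pi_T(x))$, a positive definite form. MTIS means maximal totally isotropic subspace (of dimension $d$). Two MTIS's are transversal if their intersection is $\{0\}$. Fix orientations on all MTIS's $V$ and on all their orthogonals $V^\perp$ such that every $f\in SO^+(d+1,d)$ induces orientation-preserving isomorphisms $V\to f(V)$ and $V^\perp\to f(V^\perp)$ (such a choice exists). The positive wing of $V$ is $V^{\mathsf{L}}=\{v+xe: v\in V,\ x\ge 0\}$, where $e\in V^\perp$ is any vector such that whenever $(e_1,\dots,e_d)$ is a direct basis of $V$, $(e_1,\dots,e_d,e)$ is a direct basis of $V^\perp$. A frame is an ordered pair $\mathcal{V}=(V_<,V_>)$ of transversal MTIS's; $V_= := V_<^\perp\cap V_>^\perp$ (a line). $N_{\mathcal{V}}$ is the positive definite quadratic form making $V_<,V_=,V_>$ pairwise orthogonal and coinciding with $N_0$ on each of them. $\mathbb{S}=(\mathbb{R}^{d+1,d}\setminus\{0\})/\mathbb{R}^{>0}$, with projection $\pi_{\mathbb{S}}:\mathbb{R}^{d+1,d}\setminus\{0\}\to\mathbb{S}$ (for $X\subset\mathbb{R}^{d+1,d}$,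 $\pi_{\mathbb{S}}(X)$ means $\pi_{\mathbb{S}}(X\setminus\{0\})$). For a positive definite form $N$, $\alpha_N(\bar x,\bar y)=\arccos\frac{\langle x,y\rangle_N}{\|x\|_N\|y\|_N}$ is a distance on $\mathbb{S}$; between sets $\alpha_N$ denotes the infimum distance (for subsets of $\mathbb{R}^{d+1,d}$, the distance between their projections); $B_N(X,r)=\{x\in\mathbb{S}:\alpha_N(x,X)<r\}$. A frameset is a family $\mathcal{W}=(\mathcal{V}_1,\dots,\mathcal{V}_n)$ of frames $\mathcal{V}_i=(V_{i,<},V_{i,>})$ whose $2n$ components are pairwise transversal; it is $\varepsilon$-separated if $\alpha_{N_0}(V^{\mathsf{L}},V'^{\mathsf{L}})\ge\varepsilon$ for any two distinct $V,V'$ among these $2n$ MTIS's. For $g\in GL(\mathbb{R}^{d+1,d})$, let $V_<(g),V_=(g),V_>(g)$ be the $g$-invariant subspaces, with direct sum the whole space, on which all eigenvalues of $g$ have modulus $<1,=1,>1$ respectively. $g$ is pseudohyperbolic if $g\in O(d+1,d)$, $\dim V_=(g)=1$ and the eigenvalue of $g$ on $V_=(g)$ is $1$; its frame is $(V_<(g),V_>(g))$, and $s(g)=\max(\|g|_{V_<(g)}\|_{N_0},\|(g|_{V_>(g)})^{-1}\|_{N_0})$. A group based on $\mathcal{W}$ is a group $G$ generated by pseudohyperbolic maps $g_1,\dots,g_n$ with respective frames $\mathcal{V}_1,\dots,\mathcal{V}_n$; for $s>0$, it is $s$-contracting if $s(g_i)\le s$ for all $i$. An affine deformation of a linear group $G\subset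 SO(d+1,d)$ is a group $\Gamma\subset\mathbb{R}^{d+1,d}\rtimes SO(d+1,d)$ such that taking linear parts induces an isomorphism from $\Gamma$ to $G$. For $\mathbf{t}=(t_1,\dots,t_n)\in(\mathbb{R}^{d+1,d})^n$, let $\gamma_i(x)=g_i(x)+t_i$ and let $G(\mathbf{t})$ be the group generated by $\gamma_1,\dots,\gamma_n$; since $G$ is free on $g_1,\dots,g_n$ in the situation considered, it is an affine deformation of $G$. Let $u_i$ be the unique solution of $u_i+g_i(u_i)=t_i$ (unique because $-1$ is not an eigenvalue of $g_i$). Set $\mathcal{H}_{\mathbb{S},i}^-=B_{N_{\mathcal{V}_i}}(\pi_{\mathbb{S}}(V_{i,<}^{\mathsf{L}}),\varepsilon_i)$ and $\mathcal{H}_{\mathbb{S},i}^+=B_{N_{\mathcal{V}_i}}(\pi_{\mathbb{S}}(V_{i,>}^{\mathsf{L}}),\varepsilon_i)$, and for $\sigma=\pm1$ set $\mathcal{H}_i^\sigma(\mathbf{t})=\pi_{\mathbb{S}}^{-1}(\mathcal{H}_{\mathbb{S},i}^\sigma)+\sigma u_i$. $\mathbf{T}$ is the set of all $\mathbf{t}\in(\mathbb{R}^{d+1,d})^n$ such that the $2n$ sets $\overline{\mathcal{H}_i^{\pm}(\mathbf{t})}$ are pairwise disjoint. Finally $\tilde{\mathcal{H}}_i^-(\mathbf{t})=\mathcal{H}_i^-(\mathbf{t})$, $\tilde{\mathcal{H}}_i^+(\mathbf{t})=\gamma_i\big(\mathbb{R}^{d+1,d}\setminus\overline{\mathcal{H}_i^-(\mathbf{t})}\big)$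 and $\mathcal{H}^0(\mathbf{t})=\mathbb{R}^{d+1,d}\setminus\bigcup_{i=1}^n\bigcup_{\sigma=\pm}\overline{\tilde{\mathcal{H}}_i^\sigma(\mathbf{t})}$.
   Formalization: As written the claim fails when the ε_i are tiny compared with s_3(ε). Here s_3 depends on ε and on a positive lower bound δ for all ε_i; it is also proved that some δ depending only on ε is an admissible choice of ε_i for every frame of every ε-separated frameset. *)

theory Defs
  imports
    "HOL-Analysis.Analysis"
    "HOL-Algebra.Bij"
    "HOL-Algebra.Generated_Groups"
begin

text \<open>
  The number \<open>d\<close> is \<open>CARD('d)\<close>, and the ambient space is \<open>real ^ 'n\<close> with an
  arbitrary quadratic form \<open>Q\<close> of signature \<open>(d + 1, d)\<close>. Linear maps are matrices. Ordered
  bases of \<open>d\<close>-dimensional subspaces are families indexed by \<open>'d\<close>, i.e. matrices whose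
  rows are the basis vectors; those of \<open>(d + 1)\<close>-dimensional subspaces are indexed by
  \<open>'d option\<close>, with \<open>None\<close> in the role of the last index. Signs \<open>\<sigma>\<close> are the reals
  \<open>- 1\<close> and \<open>1\<close>.
\<close>

section \<open>Quadratic forms\<close>

definition polar :: "('a::real_vector \<Rightarrow> real) \<Rightarrow> 'a \<Rightarrow> 'a \<Rightarrow> real" where
  "polar Q x y = (Q (x + y) - Q x - Q y) / 2"

definition quadratic_form :: "('a::real_vector \<Rightarrow> real) \<Rightarrow> bool" where
  "quadratic_form Q \<longleftrightarrow> bilinear (polar Q) \<and> (\<forall>x. polar Q x x = Q x)"

definition pos_def_on :: "('a::real_vector \<Rightarrow> real) \<Rightarrow> 'a set \<Rightarrow> bool" where
  "pos_def_on Q V \<longleftrightarrow> (\<forall>x\<in>V. x \<noteq> 0 \<longrightarrow> 0 < Q x)"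

definition orthogonal_wrt :: "('a::real_vector \<Rightarrow> real) \<Rightarrow> 'a set \<Rightarrow> 'a set \<Rightarrow> bool" where
  "orthogonal_wrt Q V W \<longleftrightarrow> (\<forall>x\<in>V. \<forall>y\<in>W. polar Q x y = 0)"

definition perp :: "('a::real_vector \<Rightarrow> real) \<Rightarrow> 'a set \<Rightarrow> 'a set" where
  "perp Q V = {x. \<forall>v\<in>V. polar Q x v = 0}"

definition has_signature :: "(real ^ 'n \<Rightarrow> real) \<Rightarrow> nat \<Rightarrow> nat \<Rightarrow> bool" where
  "has_signature Q p q \<longleftrightarrow>
     (\<exists>P N. subspace P \<and> subspace N \<and> dim P = p \<and> dim N = q \<and>
        bij_betw (\<lambda>(x, y). x + y) (P \<times> N) UNIV \<and> orthogonal_wrt Q P N \<and>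
        pos_def_on Q P \<and> pos_def_on (\<lambda>x. - Q x) N)"

definition max_pos_def_subspace :: "('a::real_vector \<Rightarrow> real) \<Rightarrow> 'a set \<Rightarrow> bool" where
  "max_pos_def_subspace Q S \<longleftrightarrow> subspace S \<and> pos_def_on Q S \<and>
     (\<forall>S'. subspace S' \<and> pos_def_on Q S' \<and> S \<subseteq> S' \<longrightarrow> S' = S)"

definition orth_proj :: "('a::real_vector \<Rightarrow> real) \<Rightarrow> 'a set \<Rightarrow> 'a \<Rightarrow> 'a" where
  "orth_proj Q V x = (THE v. v \<in> V \<and> x - v \<in> perp Q V)"

definition N0 :: "('a::real_vector \<Rightarrow> real) \<Rightarrow> 'a set \<Rightarrow> 'a \<Rightarrow> real" where
  "N0 Q S x = Q (orth_proj Q S x) - Q (orth_proj Q (perp Q S) x)"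

definition O_group :: "(real ^ 'n \<Rightarrow> real) \<Rightarrow> (real ^ 'n ^ 'n) set" where
  "O_group Q = {g. invertible g \<and> (\<forall>x. Q (g *v x) = Q x)}"

definition SO_group :: "(real ^ 'n \<Rightarrow> real) \<Rightarrow> (real ^ 'n ^ 'n) set" where
  "SO_group Q = {g \<in> O_group Q. det g = 1}"

definition SO_plus :: "(real ^ 'n \<Rightarrow> real) \<Rightarrow> (real ^ 'n ^ 'n) set" where
  "SO_plus Q = connected_component_set (SO_group Q) (mat 1)"

section \<open>Maximal totally isotropic subspaces, orientations and wings\<close>

definition totally_isotropic :: "('a::real_vector \<Rightarrow> real) \<Rightarrow> 'a set \<Rightarrow> bool" where
  "totally_isotropic Q V \<longleftrightarrow> subspace V \<and> (\<forall>x\<in>V. Q x = 0)"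

definition MTIS :: "('a::real_vector \<Rightarrow> real) \<Rightarrow> 'a set \<Rightarrow> bool" where
  "MTIS Q V \<longleftrightarrow> totally_isotropic Q V \<and> (\<forall>W. totally_isotropic Q W \<and> V \<subseteq> W \<longrightarrow> W = V)"

definition transversal :: "'a::real_vector set \<Rightarrow> 'a set \<Rightarrow> bool" where
  "transversal V W \<longleftrightarrow> V \<inter> W = {0}"

definition ordered_basis :: "(real ^ 'n) set \<Rightarrow> real ^ 'n ^ 'k \<Rightarrow> bool" where
  "ordered_basis V b \<longleftrightarrow> inj (($) b) \<and> independent (rows b) \<and> span (rows b) = V"

text \<open>
  An orientation is an equivalence class of ordered bases under change of basis with positive
  determinant (the rows of \<open>A ** b\<close> are the combinations of the rows of \<open>b\<close> with
  coefficients \<open>A\<close>); the members of the class are the direct bases.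
\<close>

definition orientation_of :: "(real ^ 'n) set \<Rightarrow> (real ^ 'n ^ 'k) set \<Rightarrow> bool" where
  "orientation_of V D \<longleftrightarrow>
     (\<exists>b. ordered_basis V b \<and> D = {A ** b |A :: real ^ 'k ^ 'k. 0 < det A})"

definition map_basis :: "real ^ 'n ^ 'n \<Rightarrow> real ^ 'n ^ 'k \<Rightarrow> real ^ 'n ^ 'k" where
  "map_basis f b = (\<chi> i. f *v (b $ i))"

text \<open>
  \<open>oV V\<close> is the chosen orientation of \<open>V\<close> and \<open>oP V\<close> that of \<open>perp Q V\<close>.
\<close>

definition compatible_orientations ::
  "(real ^ 'n \<Rightarrow> real) \<Rightarrow> ((real ^ 'n) set \<Rightarrow> (real ^ 'n ^ 'd) set) \<Rightarrow>
   ((real ^ 'n) set \<Rightarrow> (real ^ 'n ^ 'd option) set) \<Rightarrow> bool" where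
  "compatible_orientations Q oV oP \<longleftrightarrow>
     (\<forall>V. MTIS Q V \<longrightarrow> orientation_of V (oV V) \<and> orientation_of (perp Q V) (oP V)) \<and>
     (\<forall>f\<in>SO_plus Q. \<forall>V. MTIS Q V \<longrightarrow>
        (\<forall>b\<in>oV V. map_basis f b \<in> oV ((*v) f ` V)) \<and>
        (\<forall>b\<in>oP V. map_basis f b \<in> oP ((*v) f ` V)))"

definition append_basis :: "real ^ 'n ^ 'd \<Rightarrow> real ^ 'n \<Rightarrow> real ^ 'n ^ 'd option" where
  "append_basis b e = (\<chi> k. case k of None \<Rightarrow> e | Some i \<Rightarrow> b $ i)"

definition wing_vector ::
  "(real ^ 'n \<Rightarrow> real) \<Rightarrow> ((real ^ 'n) set \<Rightarrow> (real ^ 'n ^ 'd) set) \<Rightarrow>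
   ((real ^ 'n) set \<Rightarrow> (real ^ 'n ^ 'd option) set) \<Rightarrow> (real ^ 'n) set \<Rightarrow> real ^ 'n \<Rightarrow> bool" where
  "wing_vector Q oV oP V e \<longleftrightarrow> e \<in> perp Q V \<and> (\<forall>b\<in>oV V. append_basis b e \<in> oP V)"

text \<open>
  The half-space \<open>V + [0, \<infinity>) e\<close> is the same for all wing vectors \<open>e\<close> of \<open>V\<close>, so
  taking the union over \<open>e\<close> is the same as choosing one.
\<close>

definition pos_wing ::
  "(real ^ 'n \<Rightarrow> real) \<Rightarrow> ((real ^ 'n) set \<Rightarrow> (real ^ 'n ^ 'd) set) \<Rightarrow>
   ((real ^ 'n) set \<Rightarrow> (real ^ 'n ^ 'd option) set) \<Rightarrow> (real ^ 'n) set \<Rightarrow> (real ^ 'n) set" where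
  "pos_wing Q oV oP V = {v + x *\<^sub>R e |v x e. v \<in> V \<and> 0 \<le> x \<and> wing_vector Q oV oP V e}"

section \<open>Frames\<close>

type_synonym 'n frame = "(real ^ 'n) set \<times> (real ^ 'n) set"

definition is_frame :: "(real ^ 'n \<Rightarrow> real) \<Rightarrow> 'n frame \<Rightarrow> bool" where
  "is_frame Q F \<longleftrightarrow> MTIS Q (fst F) \<and> MTIS Q (snd F) \<and> transversal (fst F) (snd F)"

definition frame_mid :: "(real ^ 'n \<Rightarrow> real) \<Rightarrow> 'n frame \<Rightarrow> (real ^ 'n) set" where
  "frame_mid Q F = perp Q (fst F) \<inter> perp Q (snd F)"

definition frame_side :: "'n frame \<Rightarrow> real \<Rightarrow> (real ^ 'n) set" where
  "frame_side F \<sigma> = (if \<sigma> < 0 then fst F else snd F)"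

definition frame_form ::
  "(real ^ 'n \<Rightarrow> real) \<Rightarrow> (real ^ 'n) set \<Rightarrow> 'n frame \<Rightarrow> real ^ 'n \<Rightarrow> real" where
  "frame_form Q S F = (THE N. quadratic_form N \<and> pos_def_on N UNIV \<and>
     orthogonal_wrt N (fst F) (frame_mid Q F) \<and>
     orthogonal_wrt N (fst F) (snd F) \<and>
     orthogonal_wrt N (frame_mid Q F) (snd F) \<and>
     (\<forall>x \<in> fst F \<union> frame_mid Q F \<union> snd F. N x = N0 Q S x))"

section \<open>The sphere of rays\<close>

definition ray_rel :: "('a::real_vector \<times> 'a) set" where
  "ray_rel = {(x, y). x \<noteq> 0 \<and> y \<noteq> 0 \<and> (\<exists>c>0. y = c *\<^sub>R x)}"

definition ray_sphere :: "'a::real_vector set set" where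
  "ray_sphere = (UNIV - {0}) // ray_rel"

definition ray :: "'a::real_vector \<Rightarrow> 'a set" where
  "ray x = ray_rel `` {x}"

definition rays :: "'a::real_vector set \<Rightarrow> 'a set set" where
  "rays X = ray ` (X - {0})"

definition angle :: "('a::real_vector \<Rightarrow> real) \<Rightarrow> 'a \<Rightarrow> 'a \<Rightarrow> real" where
  "angle N x y = arccos (polar N x y / (sqrt (N x) * sqrt (N y)))"

text \<open>The angle does not depend on the representatives, so the union is a singleton.\<close>

definition alpha :: "('a::real_vector \<Rightarrow> real) \<Rightarrow> 'a set \<Rightarrow> 'a set \<Rightarrow> real" where
  "alpha N p q = the_elem (\<Union>x\<in>p. \<Union>y\<in>q. {angle N x y})"

text \<open>
  Extended reals give infinite distance to the empty set, so that the neighbourhood of the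
  empty set is empty.
\<close>

definition alpha_dist :: "('a::real_vector \<Rightarrow> real) \<Rightarrow> 'a set set \<Rightarrow> 'a set set \<Rightarrow> ereal" where
  "alpha_dist N X Y = (INF p\<in>X. INF q\<in>Y. ereal (alpha N p q))"

definition ball_S :: "('a::real_vector \<Rightarrow> real) \<Rightarrow> 'a set set \<Rightarrow> real \<Rightarrow> 'a set set" where
  "ball_S N X r = {p \<in> ray_sphere. alpha_dist N {p} X < ereal r}"

section \<open>Framesets\<close>

definition frameset :: "(real ^ 'n \<Rightarrow> real) \<Rightarrow> nat \<Rightarrow> (nat \<Rightarrow> 'n frame) \<Rightarrow> bool" where
  "frameset Q n W \<longleftrightarrow> (\<forall>i\<in>{1..n}. is_frame Q (W i)) \<and>
     (\<forall>i\<in>{1..n}. \<forall>j\<in>{1..n}. \<forall>\<sigma>\<in>{- 1, 1}. \<forall>\<tau>\<in>{- 1, 1}. (i, \<sigma>) \<noteq> (j, \<tau>) \<longrightarrow>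
        transversal (frame_side (W i) \<sigma>) (frame_side (W j) \<tau>))"

definition separated ::
  "(real ^ 'n \<Rightarrow> real) \<Rightarrow> (real ^ 'n) set \<Rightarrow> ((real ^ 'n) set \<Rightarrow> (real ^ 'n ^ 'd) set) \<Rightarrow>
   ((real ^ 'n) set \<Rightarrow> (real ^ 'n ^ 'd option) set) \<Rightarrow>
   real \<Rightarrow> nat \<Rightarrow> (nat \<Rightarrow> 'n frame) \<Rightarrow> bool" where
  "separated Q S oV oP \<epsilon> n W \<longleftrightarrow>
     (\<forall>i\<in>{1..n}. \<forall>j\<in>{1..n}. \<forall>\<sigma>\<in>{- 1, 1}. \<forall>\<tau>\<in>{- 1, 1}. (i, \<sigma>) \<noteq> (j, \<tau>) \<longrightarrow>
        ereal \<epsilon> \<le> alpha_dist (N0 Q S) (rays (pos_wing Q oV oP (frame_side (W i) \<sigma>)))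
                                  (rays (pos_wing Q oV oP (frame_side (W j) \<tau>))))"

text \<open>
  The condition imposed on the constants \<open>\<epsilon>\<^sub>i\<close>, for the frame with index \<open>i\<close>. It bounds
  \<open>\<epsilon>\<^sub>i\<close> only from above. A contraction constant \<open>s\<close> cannot serve for all
  admissible \<open>\<epsilon>\<^sub>i\<close> at once: a map with \<open>s(g) = s\<close> sends the complement of the
  \<open>\<epsilon>\<^sub>i\<close>-neighbourhood of the wing of \<open>V\<^sub><\<close> into the
  \<open>\<epsilon>\<^sub>i\<close>-neighbourhood of the wing of \<open>V\<^sub>>\<close> only if \<open>\<epsilon>\<^sub>i\<close> is not too small
  compared to \<open>s\<close>. So \<open>s\<close> has to be chosen after a lower bound for the
  \<open>\<epsilon>\<^sub>i\<close>; such a bound can be taken to depend on \<open>\<epsilon>\<close> alone.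
\<close>

definition admissible_radius ::
  "(real ^ 'n \<Rightarrow> real) \<Rightarrow> (real ^ 'n) set \<Rightarrow> real \<Rightarrow> 'n frame \<Rightarrow> real \<Rightarrow> bool" where
  "admissible_radius Q S \<epsilon> F r \<longleftrightarrow> 0 < r \<and>
     (\<forall>X \<subseteq> ray_sphere. ball_S (frame_form Q S F) X r \<subseteq> ball_S (N0 Q S) X (\<epsilon> / 3))"

section \<open>Pseudohyperbolic maps\<close>

text \<open>
  \<open>l\<close> is an eigenvalue of the complexified restriction of \<open>g\<close> to the (invariant) subspace
  \<open>V\<close>: the eigenvector \<open>z\<close> lies in the complexification of \<open>V\<close>.
\<close>

definition eigenvalue_on :: "real ^ 'n ^ 'n \<Rightarrow> (real ^ 'n) set \<Rightarrow> complex \<Rightarrow> bool" where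
  "eigenvalue_on g V l \<longleftrightarrow> (\<exists>z :: complex ^ 'n. z \<noteq> 0 \<and>
     (\<chi> i. Re (z $ i)) \<in> V \<and> (\<chi> i. Im (z $ i)) \<in> V \<and>
     (\<chi> i j. complex_of_real (g $ i $ j)) *v z = l *s z)"

text \<open>
  \<open>A\<close>, \<open>B\<close>, \<open>C\<close> are the subspaces \<open>V\<^sub><(g)\<close>, \<open>V\<^sub>=(g)\<close>, \<open>V\<^sub>>(g)\<close>; these
  conditions determine them uniquely.
\<close>

definition dynamical_splitting ::
  "real ^ 'n ^ 'n \<Rightarrow> (real ^ 'n) set \<Rightarrow> (real ^ 'n) set \<Rightarrow> (real ^ 'n) set \<Rightarrow> bool" where
  "dynamical_splitting g A B C \<longleftrightarrow>
     subspace A \<and> subspace B \<and> subspace C \<and>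
     (*v) g ` A \<subseteq> A \<and> (*v) g ` B \<subseteq> B \<and> (*v) g ` C \<subseteq> C \<and>
     bij_betw (\<lambda>(a, b, c). a + b + c) (A \<times> B \<times> C) UNIV \<and>
     (\<forall>l. eigenvalue_on g A l \<longrightarrow> cmod l < 1) \<and>
     (\<forall>l. eigenvalue_on g B l \<longrightarrow> cmod l = 1) \<and>
     (\<forall>l. eigenvalue_on g C l \<longrightarrow> 1 < cmod l)"

text \<open>\<open>g\<close> is pseudohyperbolic with frame \<open>F\<close>.\<close>

definition pseudohyperbolic :: "(real ^ 'n \<Rightarrow> real) \<Rightarrow> real ^ 'n ^ 'n \<Rightarrow> 'n frame \<Rightarrow> bool" where
  "pseudohyperbolic Q g F \<longleftrightarrow> g \<in> O_group Q \<and>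
     (\<exists>B. dynamical_splitting g (fst F) B (snd F) \<and> dim B = 1 \<and> (\<forall>x\<in>B. g *v x = x))"

definition op_norm_on :: "('a::real_vector \<Rightarrow> real) \<Rightarrow> 'a set \<Rightarrow> ('a \<Rightarrow> 'a) \<Rightarrow> real" where
  "op_norm_on N V f = (SUP x\<in>V - {0}. sqrt (N (f x)) / sqrt (N x))"

text \<open>The number \<open>s(g)\<close> of a pseudohyperbolic map \<open>g\<close> with frame \<open>F\<close>.\<close>

definition contraction_strength ::
  "(real ^ 'n \<Rightarrow> real) \<Rightarrow> (real ^ 'n) set \<Rightarrow> real ^ 'n ^ 'n \<Rightarrow> 'n frame \<Rightarrow> real" where
  "contraction_strength Q S g F =
     max (op_norm_on (N0 Q S) (fst F) ((*v) g))
         (op_norm_on (N0 Q S) (snd F) (inv_into (snd F) ((*v) g)))"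

text \<open>The group generated by \<open>g\<^sub>1, \<dots>, g\<^sub>n\<close> is based on \<open>W\<close> and \<open>s\<close>-contracting.\<close>

definition contracting_generators ::
  "(real ^ 'n \<Rightarrow> real) \<Rightarrow> (real ^ 'n) set \<Rightarrow> real \<Rightarrow> nat \<Rightarrow> (nat \<Rightarrow> 'n frame) \<Rightarrow>
   (nat \<Rightarrow> real ^ 'n ^ 'n) \<Rightarrow> bool" where
  "contracting_generators Q S s n W g \<longleftrightarrow>
     (\<forall>i\<in>{1..n}. pseudohyperbolic Q (g i) (W i) \<and> contraction_strength Q S (g i) (W i) \<le> s)"

section \<open>Affine deformations and the domains\<close>

definition affine_map :: "real ^ 'n ^ 'n \<Rightarrow> real ^ 'n \<Rightarrow> real ^ 'n \<Rightarrow> real ^ 'n" where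
  "affine_map g t x = g *v x + t"

definition affine_group ::
  "nat \<Rightarrow> (nat \<Rightarrow> real ^ 'n ^ 'n) \<Rightarrow> (nat \<Rightarrow> real ^ 'n) \<Rightarrow> (real ^ 'n \<Rightarrow> real ^ 'n) set" where
  "affine_group n g t = generate (BijGroup UNIV) ((\<lambda>i. affine_map (g i) (t i)) ` {1..n})"

definition half_translation :: "real ^ 'n ^ 'n \<Rightarrow> real ^ 'n \<Rightarrow> real ^ 'n" where
  "half_translation g t = (THE u. u + g *v u = t)"

text \<open>
  In what follows \<open>F\<close>, \<open>r\<close>, \<open>g\<close>, \<open>t\<close> are the frame, the constant \<open>\<epsilon>\<^sub>i\<close>, the generator and the
  translation part with a given index \<open>i\<close>.
\<close>

definition H_S ::
  "(real ^ 'n \<Rightarrow> real) \<Rightarrow> (real ^ 'n) set \<Rightarrow> ((real ^ 'n) set \<Rightarrow> (real ^ 'n ^ 'd) set) \<Rightarrow>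
   ((real ^ 'n) set \<Rightarrow> (real ^ 'n ^ 'd option) set) \<Rightarrow>
   'n frame \<Rightarrow> real \<Rightarrow> real \<Rightarrow> (real ^ 'n) set set" where
  "H_S Q S oV oP F r \<sigma> =
     ball_S (frame_form Q S F) (rays (pos_wing Q oV oP (frame_side F \<sigma>))) r"

definition H_aff ::
  "(real ^ 'n \<Rightarrow> real) \<Rightarrow> (real ^ 'n) set \<Rightarrow> ((real ^ 'n) set \<Rightarrow> (real ^ 'n ^ 'd) set) \<Rightarrow>
   ((real ^ 'n) set \<Rightarrow> (real ^ 'n ^ 'd option) set) \<Rightarrow>
   'n frame \<Rightarrow> real \<Rightarrow> real ^ 'n ^ 'n \<Rightarrow> real ^ 'n \<Rightarrow> real \<Rightarrow> (real ^ 'n) set" where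
  "H_aff Q S oV oP F r g t \<sigma> =
     (\<lambda>x. x + \<sigma> *\<^sub>R half_translation g t) ` {x. x \<noteq> 0 \<and> ray x \<in> H_S Q S oV oP F r \<sigma>}"

definition H_tilde ::
  "(real ^ 'n \<Rightarrow> real) \<Rightarrow> (real ^ 'n) set \<Rightarrow> ((real ^ 'n) set \<Rightarrow> (real ^ 'n ^ 'd) set) \<Rightarrow>
   ((real ^ 'n) set \<Rightarrow> (real ^ 'n ^ 'd option) set) \<Rightarrow>
   'n frame \<Rightarrow> real \<Rightarrow> real ^ 'n ^ 'n \<Rightarrow> real ^ 'n \<Rightarrow> real \<Rightarrow> (real ^ 'n) set" where
  "H_tilde Q S oV oP F r g t \<sigma> =
     (if \<sigma> < 0 then H_aff Q S oV oP F r g t (- 1)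
      else affine_map g t ` (UNIV - closure (H_aff Q S oV oP F r g t (- 1))))"

definition T_set ::
  "(real ^ 'n \<Rightarrow> real) \<Rightarrow> (real ^ 'n) set \<Rightarrow> ((real ^ 'n) set \<Rightarrow> (real ^ 'n ^ 'd) set) \<Rightarrow>
   ((real ^ 'n) set \<Rightarrow> (real ^ 'n ^ 'd option) set) \<Rightarrow>
   nat \<Rightarrow> (nat \<Rightarrow> 'n frame) \<Rightarrow> (nat \<Rightarrow> real) \<Rightarrow> (nat \<Rightarrow> real ^ 'n ^ 'n) \<Rightarrow> (nat \<Rightarrow> real ^ 'n) set" where
  "T_set Q S oV oP n W r g = {t.
     \<forall>i\<in>{1..n}. \<forall>j\<in>{1..n}. \<forall>\<sigma>\<in>{- 1, 1}. \<forall>\<tau>\<in>{- 1, 1}. (i, \<sigma>) \<noteq> (j, \<tau>) \<longrightarrow>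
       closure (H_aff Q S oV oP (W i) (r i) (g i) (t i) \<sigma>) \<inter>
       closure (H_aff Q S oV oP (W j) (r j) (g j) (t j) \<tau>) = {}}"

definition H_zero ::
  "(real ^ 'n \<Rightarrow> real) \<Rightarrow> (real ^ 'n) set \<Rightarrow> ((real ^ 'n) set \<Rightarrow> (real ^ 'n ^ 'd) set) \<Rightarrow>
   ((real ^ 'n) set \<Rightarrow> (real ^ 'n ^ 'd option) set) \<Rightarrow>
   nat \<Rightarrow> (nat \<Rightarrow> 'n frame) \<Rightarrow> (nat \<Rightarrow> real) \<Rightarrow> (nat \<Rightarrow> real ^ 'n ^ 'n) \<Rightarrow> (nat \<Rightarrow> real ^ 'n) \<Rightarrow>
   (real ^ 'n) set" where
  "H_zero Q S oV oP n W r g t =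
     UNIV - (\<Union>i\<in>{1..n}. \<Union>\<sigma>\<in>{- 1, 1}. closure (H_tilde Q S oV oP (W i) (r i) (g i) (t i) \<sigma>))"

definition fundamental_domain :: "('a::topological_space \<Rightarrow> 'a) set \<Rightarrow> 'a set \<Rightarrow> bool" where
  "fundamental_domain \<Gamma> H \<longleftrightarrow>
     (\<forall>\<gamma>\<in>\<Gamma>. \<forall>\<gamma>'\<in>\<Gamma>. \<gamma> \<noteq> \<gamma>' \<longrightarrow> \<gamma> ` H \<inter> \<gamma>' ` H = {}) \<and>
     (\<Union>\<gamma>\<in>\<Gamma>. closure (\<gamma> ` H)) = UNIV"

end

theory Submission
  imports Defs
begin

text \<open>
  The two wings of a frame are separated, so they lie over opposite half-lines of the middle line.
  Hence a strongly contracting generator maps the complement of a cone around its repelling wing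
  into a cone around its attracting wing, and the generators play ping-pong with the closures of the
  sets \<open>H_tilde\<close>. This makes the images of \<open>H_zero\<close> disjoint.

  A point \<open>x\<close> that is not covered follows an infinite reduced word: it lies in a nested sequence of
  images of the closures of the \<open>H_tilde\<close>. Cut the word at length \<open>K\<close>, and let \<open>U\<close> be the image under the
  first \<open>K\<close> linear parts of the isotropic subspace attached to the next letter. Every inverse step
  contracts \<open>U\<close> and preserves \<open>Q\<close> on \<open>perp U / U\<close>, a line, so on \<open>perp U\<close> the inverses of the partial products
  are bounded uniformly in \<open>K\<close>. For dimension reasons \<open>perp U\<close> contains a direction making an angle of
  at least \<open>pi / 2\<close> with the first wing. The half-line from \<open>x\<close> in this direction leaves the first region
  within a length independent of \<open>K\<close>, but it crosses \<open>K\<close> gaps of width bounded below, which is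
  impossible for large \<open>K\<close>.
\<close>

section \<open>Quadratic forms\<close>

text \<open>The obstacle in the covering argument is that the inverse partial products expand most
  directions exponentially. Measured along a generic half-line, the image of a gap of fixed width
  under a long product may be arbitrarily thin, and crossing many such gaps contradicts nothing.
  Hence the half-line is aimed into \<open>perp U\<close>. The inverse steps halve \<open>U\<close>,
  and modulo \<open>U\<close> the form \<open>Q\<close> measures the vector, so the length \<nu> of
  the transported direction obeys \<nu>' \<le> (\<nu> + 1) / 2 + \<open>B\<close>, where
  \<open>B\<close> bounds the finitely many generators and their inverses. A suitable direction
  exists because \<open>d + d < 2 * d + 1\<close>; its sign is chosen afterwards. The contraction
  constant serves two purposes: \<open>s < (sin \<theta>)\<^sup>2\<close> makes the cones play
  ping-pong, and \<open>12 * \<kappa> \<epsilon> * s\<^sup>2 \<le> (sin \<theta>)\<^sup>2\<close>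
  yields the halving in the common form \<open>N\<close>, after the passage from the frame forms to
  \<open>N\<close> and back has cost the factor \<open>3 * \<kappa> \<epsilon>\<close>.\<close>

lemma polar_commute: "polar Q x y = polar Q y x"
  by (simp add: polar_def add.commute)

text \<open>Forms that are given by an explicit symmetric bilinear map enter through this rule,
  which identifies \<open>polar\<close> at the same time.\<close>

lemma quadratic_formI:
  assumes "bilinear b" and "\<And>x y. b x y = b y x" and "\<And>x. Q x = b x x"
  shows "quadratic_form Q" and "polar Q = b"
proof -
  show "polar Q = b"
    using assms by (auto simp: polar_def fun_eq_iff bilinear_ladd bilinear_radd)
  then show "quadratic_form Q"
    using assms by (simp add: quadratic_form_def)
qed

locale quad_form =
  fixes Q :: "'a::real_vector \<Rightarrow> real"
  assumes quadratic: "quadratic_form Q"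
begin

lemma bilinear_polar: "bilinear (polar Q)"
  using quadratic by (simp add: quadratic_form_def)

lemma polar_self [simp]: "polar Q x x = Q x"
  using quadratic by (simp add: quadratic_form_def)

lemmas polar_simps =
  bilinear_ladd[OF bilinear_polar] bilinear_radd[OF bilinear_polar]
  bilinear_lmul[OF bilinear_polar] bilinear_rmul[OF bilinear_polar]
  bilinear_lneg[OF bilinear_polar] bilinear_rneg[OF bilinear_polar]
  bilinear_lsub[OF bilinear_polar] bilinear_rsub[OF bilinear_polar]

lemma polar_zero [simp]: "polar Q 0 x = 0" "polar Q x 0 = 0"
  by (simp_all add: bilinear_lzero[OF bilinear_polar] bilinear_rzero[OF bilinear_polar])

lemma form_add: "Q (x + y) = Q x + 2 * polar Q x y + Q y"
  by (simp add: polar_def field_simps)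

lemma form_scale: "Q (c *\<^sub>R x) = c\<^sup>2 * Q x"
proof -
  have "Q (c *\<^sub>R x) = polar Q (c *\<^sub>R x) (c *\<^sub>R x)"
    by (simp only: polar_self)
  also have "\<dots> = c\<^sup>2 * polar Q x x"
    unfolding polar_simps by (simp add: power2_eq_square)
  finally show ?thesis
    by simp
qed

lemma form_zero [simp]: "Q 0 = 0"
  using form_scale[of 0] by simp

lemma form_minus [simp]: "Q (- x) = Q x"
  using form_scale[of "- 1" x] by simp

lemma form_diff: "Q (x - y) = Q x - 2 * polar Q x y + Q y"
  using form_add[of x "- y"] by (simp add: polar_simps)

lemma subspace_perp: "subspace (perp Q V)"
  by (auto simp: subspace_def perp_def polar_simps)

lemma isotropic_polar:
  assumes "totally_isotropic Q V" and "x \<in> V" and "y \<in> V"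
  shows "polar Q x y = 0"
proof -
  have "x + y \<in> V"
    using assms by (auto simp: totally_isotropic_def intro: subspace_add)
  then have "Q (x + y) = 0" "Q x = 0" "Q y = 0"
    using assms by (auto simp: totally_isotropic_def)
  then show ?thesis
    by (simp add: polar_def)
qed

lemma isotropic_le_perp: "totally_isotropic Q V \<Longrightarrow> V \<subseteq> perp Q V"
  using isotropic_polar by (auto simp: perp_def)

text \<open>Adjoining \<open>x\<close> to \<open>V\<close> leaves the subspace totally isotropic, so
  maximality absorbs \<open>x\<close>.\<close>

lemma MTIS_contains_isotropic:
  assumes "MTIS Q V" and "x \<in> perp Q V" and "Q x = 0"
  shows "x \<in> V"
proof -
  have V: "subspace V" "totally_isotropic Q V"
    using assms(1) by (auto simp: MTIS_def totally_isotropic_def)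
  let ?W = "{v + c *\<^sub>R x |v c. v \<in> V}"
  have "subspace ?W"
    unfolding subspace_def
  proof (intro conjI ballI allI)
    show "0 \<in> ?W"
      using subspace_0[OF V(1)] by force
  next
    fix y z
    assume "y \<in> ?W" and "z \<in> ?W"
    then obtain v c v' c' where "y = v + c *\<^sub>R x" "z = v' + c' *\<^sub>R x" "v \<in> V" "v' \<in> V"
      by blast
    then have "y + z = (v + v') + (c + c') *\<^sub>R x" "v + v' \<in> V"
      using subspace_add[OF V(1)] by (auto simp: algebra_simps)
    then show "y + z \<in> ?W"
      by blast
  next
    fix y and k :: real
    assume "y \<in> ?W"
    then obtain v c where "y = v + c *\<^sub>R x" "v \<in> V"
      by blast
    then have "k *\<^sub>R y = k *\<^sub>R v + (k * c) *\<^sub>R x" "k *\<^sub>R v \<in> V"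
      using subspace_scale[OF V(1)] by (auto simp: algebra_simps)
    then show "k *\<^sub>R y \<in> ?W"
      by blast
  qed
  moreover have "Q y = 0" if "y \<in> ?W" for y
  proof -
    from that obtain v c where y: "y = v + c *\<^sub>R x" "v \<in> V"
      by blast
    then have "Q v = 0" "polar Q v x = 0"
      using V(2) assms(2) by (auto simp: totally_isotropic_def perp_def polar_commute[of Q v])
    then show ?thesis
      using assms(3) y by (simp add: form_add polar_simps form_scale)
  qed
  moreover have "V \<subseteq> ?W"
  proof
    fix v
    assume "v \<in> V"
    then have "v = v + 0 *\<^sub>R x \<and> v \<in> V"
      by simp
    then show "v \<in> ?W"
      by blast
  qed
  ultimately have "?W = V"
    using assms(1) by (simp add: MTIS_def totally_isotropic_def)
  moreover have "0 + 1 *\<^sub>R x \<in> ?W"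
    using subspace_0[OF V(1)] by blast
  ultimately show ?thesis
    by simp
qed

end

section \<open>Dimension counts for annihilators of bilinear forms\<close>

lemma bilinear_as_inner:
  fixes b :: "'a::euclidean_space \<Rightarrow> 'a \<Rightarrow> real"
  assumes "bilinear b"
  obtains M where "linear M" and "\<And>x y. b x y = x \<bullet> M y"
proof
  let ?M = "\<lambda>y. \<Sum>i\<in>Basis. b i y *\<^sub>R i"
  show "linear ?M"
    by (rule linearI)
       (simp_all add: bilinear_radd[OF assms] bilinear_rmul[OF assms] scaleR_left_distrib
          sum.distrib scaleR_sum_right)
  fix x y
  interpret linear "\<lambda>x. b x y"
    using assms by (simp add: bilinear_def)
  have "b x y = b (\<Sum>i\<in>Basis. (x \<bullet> i) *\<^sub>R i) y"
    by (simp add: euclidean_representation)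
  also have "\<dots> = x \<bullet> ?M y"
    by (simp add: sum scale inner_sum_right mult.commute)
  finally show "b x y = x \<bullet> ?M y" .
qed

lemma dim_common_kernel_ge:
  fixes b :: "'a::euclidean_space \<Rightarrow> 'a \<Rightarrow> real"
  assumes "bilinear b"
  shows "DIM('a) \<le> dim {x. \<forall>y\<in>X. b x y = 0} + dim X"
proof -
  obtain M where M: "linear M" "\<And>x y. b x y = x \<bullet> M y"
    using bilinear_as_inner[OF assms] by blast
  have "dim {y \<in> UNIV. \<forall>x \<in> span (M ` X). orthogonal x y} + dim (span (M ` X)) = dim (UNIV :: 'a set)"
    by (rule dim_subspace_orthogonal_to_vectors) auto
  moreover have "(\<forall>z \<in> span (M ` X). orthogonal z x) \<longleftrightarrow> (\<forall>y\<in>X. b x y = 0)" for x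
  proof
    assume "\<forall>z \<in> span (M ` X). orthogonal z x"
    then have "orthogonal (M y) x" if "y \<in> X" for y
      using that by (simp add: span_base)
    then show "\<forall>y\<in>X. b x y = 0"
      by (simp add: M(2) orthogonal_def inner_commute)
  next
    assume x: "\<forall>y\<in>X. b x y = 0"
    have "subspace {z. orthogonal z x}"
      using subspace_orthogonal_to_vector[of x] by (simp add: orthogonal_commute)
    moreover have "M ` X \<subseteq> {z. orthogonal z x}"
      using x by (auto simp: M(2) orthogonal_def inner_commute)
    ultimately show "\<forall>z \<in> span (M ` X). orthogonal z x"
      using span_minimal by blast
  qed
  moreover have "dim (span (M ` X)) \<le> dim X"
    using dim_image_le[OF M(1), of X] by simp
  ultimately show ?thesis
    by simp
qed

text \<open>The two annihilators have codimension at most \<open>dim X\<close> and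
  \<open>dim Y\<close>, so they cannot meet only in 0. Applied to \<open>Q\<close> and
  \<open>N\<close>, this produces the direction of the half-line in the covering argument.\<close>

lemma exists_orthogonal_to_two:
  fixes b b' :: "'a::euclidean_space \<Rightarrow> 'a \<Rightarrow> real"
  assumes "bilinear b" and "bilinear b'" and "dim X + dim Y < DIM('a)"
  obtains z where "z \<noteq> 0" and "\<And>x. x \<in> X \<Longrightarrow> b z x = 0" and "\<And>y. y \<in> Y \<Longrightarrow> b' z y = 0"
proof -
  let ?A = "{z. \<forall>x\<in>X. b z x = 0}" and ?B = "{z. \<forall>y\<in>Y. b' z y = 0}"
  have sub: "subspace ?A" "subspace ?B"
    by (auto simp: subspace_def bilinear_ladd[OF assms(1)] bilinear_ladd[OF assms(2)]
        bilinear_lmul[OF assms(1)] bilinear_lmul[OF assms(2)] bilinear_lzero[OF assms(1)]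
        bilinear_lzero[OF assms(2)])
  have "dim {x + y |x y. x \<in> ?A \<and> y \<in> ?B} \<le> DIM('a)"
    by (rule dim_subset_UNIV)
  then have "dim (?A \<inter> ?B) \<noteq> 0"
    using dim_sums_Int[OF sub] dim_common_kernel_ge[OF assms(1), of X]
      dim_common_kernel_ge[OF assms(2), of Y] assms(3) by linarith
  then obtain z where "z \<in> ?A \<inter> ?B" "z \<noteq> 0"
    by (auto simp: dim_eq_0)
  with that show thesis
    by blast
qed


text \<open>The dimensions of \<open>X\<close> and \<open>perp Q X\<close> add up to at least that
  of the space, and a trivial intersection then makes the sum everything.\<close>

lemma perp_complement:
  fixes Q :: "'a::euclidean_space \<Rightarrow> real"
  assumes Q: "quadratic_form Q" and X: "subspace X" and "X \<inter> perp Q X \<subseteq> {0}"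
  obtains u v where "u \<in> X" and "v \<in> perp Q X" and "x = u + v"
proof -
  interpret quad_form Q
    by (rule quad_form.intro[OF Q])
  have sub: "subspace (perp Q X)"
    by (rule subspace_perp)
  let ?T = "{u + v |u v. u \<in> X \<and> v \<in> perp Q X}"
  have "dim (X \<inter> perp Q X) = 0"
    using assms(3) by (simp add: dim_eq_0)
  then have "DIM('a) \<le> dim ?T"
    using dim_sums_Int[OF X sub] dim_common_kernel_ge[OF bilinear_polar, of X]
    unfolding perp_def by linarith
  then have "dim ?T = DIM('a)"
    using dim_subset_UNIV[of ?T] by linarith
  then have "span ?T = UNIV"
    by (simp only: dim_eq_full)
  moreover have "span ?T = ?T"
    by (rule span_eq_iff[THEN iffD2], rule subspace_sums[OF X sub])
  ultimately have "?T = UNIV"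
    by (simp only:)
  then have "x \<in> ?T"
    by simp
  then show thesis
    using that by blast
qed

section \<open>Positive definite forms and angles\<close>

locale pos_form = quad_form N for N :: "'a::real_vector \<Rightarrow> real" +
  assumes pos_def: "pos_def_on N UNIV"
begin

lemma form_pos: "x \<noteq> 0 \<Longrightarrow> 0 < N x"
  using pos_def by (simp add: pos_def_on_def)

lemma form_nonneg [simp]: "0 \<le> N x"
  using form_pos[of x] by (cases "x = 0") auto

lemma form_eq_0 [simp]: "N x = 0 \<longleftrightarrow> x = 0"
  using form_pos[of x] by (cases "x = 0") auto

lemma sqrt_form_scale: "sqrt (N (c *\<^sub>R x)) = \<bar>c\<bar> * sqrt (N x)"
  by (simp add: form_scale real_sqrt_mult)

lemma Cauchy_Schwarz: "\<bar>polar N x y\<bar> \<le> sqrt (N x) * sqrt (N y)"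
proof (cases "y = 0")
  case False
  define t where "t = polar N x y / N y"
  have "0 \<le> N (x - t *\<^sub>R y)"
    by simp
  also have "\<dots> = N x - (polar N x y)\<^sup>2 / N y"
    using False by (simp add: form_diff polar_simps form_scale t_def power2_eq_square)
  finally have "(polar N x y)\<^sup>2 \<le> N x * N y"
    using form_pos[OF False] by (simp add: field_simps)
  then have "sqrt ((polar N x y)\<^sup>2) \<le> sqrt (N x * N y)"
    by (rule real_sqrt_le_mono)
  then show ?thesis
    by (simp add: real_sqrt_mult)
qed simp

lemma form_triangle: "sqrt (N (x + y)) \<le> sqrt (N x) + sqrt (N y)"
proof (rule real_le_lsqrt)
  have "N (x + y) \<le> N x + 2 * (sqrt (N x) * sqrt (N y)) + N y"
    using Cauchy_Schwarz[of x y] by (simp add: form_add)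
  also have "\<dots> = (sqrt (N x) + sqrt (N y))\<^sup>2"
    by (simp add: power2_sum)
  finally show "N (x + y) \<le> (sqrt (N x) + sqrt (N y))\<^sup>2" .
qed simp

lemma form_triangle_diff: "sqrt (N (x - y)) \<le> sqrt (N x) + sqrt (N y)"
  using form_triangle[of x "- y"] by simp

text \<open>If a vector vanishes, the quotient is 0. The bounds therefore hold for all vectors, and
  so do \<open>cos_angle\<close> and the range of \<open>angle\<close>.\<close>

lemma cosine_bounds:
  shows "- 1 \<le> polar N x y / (sqrt (N x) * sqrt (N y))"
    and "polar N x y / (sqrt (N x) * sqrt (N y)) \<le> 1"
proof -
  have "\<bar>polar N x y\<bar> / (sqrt (N x) * sqrt (N y)) \<le> 1"
    using Cauchy_Schwarz[of x y] by (cases "x = 0 \<or> y = 0") (auto simp: form_pos)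
  then have "\<bar>polar N x y / (sqrt (N x) * sqrt (N y))\<bar> \<le> 1"
    by (simp add: abs_mult)
  then show "- 1 \<le> polar N x y / (sqrt (N x) * sqrt (N y))"
    and "polar N x y / (sqrt (N x) * sqrt (N y)) \<le> 1"
    by linarith+
qed

lemma cos_angle: "cos (angle N x y) = polar N x y / (sqrt (N x) * sqrt (N y))"
  unfolding angle_def by (rule cos_arccos) (rule cosine_bounds)+

lemma angle_nonneg [simp]: "0 \<le> angle N x y"
  unfolding angle_def by (rule arccos_lbound) (rule cosine_bounds)+

lemma angle_le_pi [simp]: "angle N x y \<le> pi"
  unfolding angle_def by (rule arccos_ubound) (rule cosine_bounds)+

lemma angle_self: "x \<noteq> 0 \<Longrightarrow> angle N x x = 0"
  by (simp add: angle_def)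

lemma angle_commute: "angle N x y = angle N y x"
  by (simp add: angle_def polar_commute mult.commute)

lemma angle_scale_left: "0 < c \<Longrightarrow> angle N (c *\<^sub>R x) y = angle N x y"
  by (simp add: angle_def sqrt_form_scale polar_simps)

lemma angle_scale_right: "0 < c \<Longrightarrow> angle N x (c *\<^sub>R y) = angle N x y"
  by (simp add: angle_def sqrt_form_scale polar_simps)

lemma angle_less_iff:
  assumes "x \<noteq> 0" and "y \<noteq> 0" and "0 \<le> \<theta>" and "\<theta> \<le> pi"
  shows "angle N x y < \<theta> \<longleftrightarrow> cos \<theta> * (sqrt (N x) * sqrt (N y)) < polar N x y"
proof -
  have "angle N x y < \<theta> \<longleftrightarrow> cos \<theta> < cos (angle N x y)"
    using assms cos_mono_less_eq[of \<theta> "angle N x y"] by simp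
  then show ?thesis
    using assms(1,2) by (simp add: cos_angle pos_less_divide_eq form_pos)
qed

text \<open>By Pythagoras the cosine of the angle between \<open>p + q\<close> and \<open>p\<close>
  is the square root of \<open>N p / N (p + q)\<close>. Since \<theta> is at most a right angle, its
  cosine is nonnegative and squaring is an equivalence.\<close>

lemma angle_less_orthogonal_iff:
  assumes "p \<noteq> 0" and "polar N p q = 0" and "0 \<le> \<theta>" and "\<theta> \<le> pi / 2"
  shows "angle N (p + q) p < \<theta> \<longleftrightarrow> (cos \<theta>)\<^sup>2 * N (p + q) < N p"
proof -
  have "N (p + q) = N p + N q"
    by (simp add: form_add assms(2))
  then have "p + q \<noteq> 0"
    using form_pos[OF assms(1)] form_nonneg[of q] by (metis add_pos_nonneg form_zero less_irrefl)
  have "cos \<theta> \<ge> 0"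
    using assms by (intro cos_ge_zero) auto
  have "angle N (p + q) p < \<theta> \<longleftrightarrow> cos \<theta> * sqrt (N (p + q)) * sqrt (N p) < sqrt (N p) * sqrt (N p)"
    using assms \<open>p + q \<noteq> 0\<close>
    by (subst angle_less_iff) (auto simp: polar_simps polar_commute[of N q] mult.assoc)
  also have "\<dots> \<longleftrightarrow> cos \<theta> * sqrt (N (p + q)) < sqrt (N p)"
    using form_pos[OF assms(1)] by (simp only: mult_less_cancel_right) auto
  also have "\<dots> \<longleftrightarrow> (cos \<theta> * sqrt (N (p + q)))\<^sup>2 < (sqrt (N p))\<^sup>2"
    using \<open>cos \<theta> \<ge> 0\<close> power_mono_iff[of "sqrt (N p)" "cos \<theta> * sqrt (N (p + q))" 2]
    by (simp add: not_le[symmetric] del: real_sqrt_pow2)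
  finally show ?thesis
    by (simp add: power_mult_distrib)
qed

text \<open>After normalization, the components of \<open>x\<close> and \<open>z\<close> orthogonal
  to \<open>y\<close> have lengths \<open>sin a\<close> and \<open>sin b\<close>. The Cauchy-Schwarz
  inequality for these components is the addition theorem for \<open>cos (a + b)\<close> turned into
  a bound.\<close>

lemma angle_triangle:
  assumes "x \<noteq> 0" and "y \<noteq> 0" and "z \<noteq> 0"
  shows "angle N x z \<le> angle N x y + angle N y z"
proof (cases "angle N x y + angle N y z \<le> pi")
  case True
  define a b where "a = angle N x y" and "b = angle N y z"
  define x' y' z' where "x' = (1 / sqrt (N x)) *\<^sub>R x"
    and "y' = (1 / sqrt (N y)) *\<^sub>R y" and "z' = (1 / sqrt (N z)) *\<^sub>R z"
  have unit: "N x' = 1" "N y' = 1" "N z' = 1"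
    using assms by (simp_all add: x'_def y'_def z'_def form_scale power_one_over)
  have cosines: "polar N x' y' = cos a" "polar N y' z' = cos b" "polar N x' z' = cos (angle N x z)"
    by (simp_all add: x'_def y'_def z'_def polar_simps cos_angle a_def b_def)
  define p q where "p = x' - cos a *\<^sub>R y'" and "q = z' - cos b *\<^sub>R y'"
  have "N p = (sin a)\<^sup>2" "N q = (sin b)\<^sup>2"
    unfolding p_def q_def sin_squared_eq
    by (simp_all add: form_diff form_scale polar_simps unit cosines polar_commute[of N z'] power2_eq_square)
  moreover have "0 \<le> sin a" "0 \<le> sin b"
    by (simp_all add: a_def b_def sin_ge_zero)
  ultimately have "\<bar>polar N p q\<bar> \<le> sin a * sin b"
    using Cauchy_Schwarz[of p q] by simp
  moreover have "polar N p q = cos (angle N x z) - cos a * cos b"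
    unfolding p_def q_def
    by (simp add: polar_simps unit cosines polar_commute[of N z'] polar_commute[of N y' z'] algebra_simps)
  ultimately have "cos (a + b) \<le> cos (angle N x z)"
    by (simp add: cos_add)
  then show ?thesis
    using True cos_mono_le_eq[of "a + b" "angle N x z"] by (simp add: a_def b_def)
next
  case False
  then show ?thesis
    using angle_le_pi[of x z] by linarith
qed

end

locale euclidean_pos_form = pos_form N for N :: "'a::euclidean_space \<Rightarrow> real"
begin

lemma continuous_on_form: "continuous_on A N"
proof -
  have "continuous_on A (\<lambda>x. polar N x x)"
    using bilinear_polar unfolding bilinear_conv_bounded_bilinear
    by (intro bounded_bilinear.continuous_on[of "polar N"] continuous_on_id)
  then show ?thesis
    by simp
qed

text \<open>The constants are the extrema of the square root of the form on the compact unit sphere.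
  They carry estimates from the form to the topology of the space and back.\<close>

lemma norm_equivalence:
  obtains m M where "0 < m" and "0 < M"
    and "\<And>x. m * norm x \<le> sqrt (N x)" and "\<And>x. sqrt (N x) \<le> M * norm x"
proof -
  have cont: "continuous_on (sphere 0 1) (\<lambda>x. sqrt (N x))"
    by (intro continuous_intros continuous_on_form)
  have ne: "sphere (0::'a) 1 \<noteq> {}"
    by simp
  obtain a where a: "a \<in> sphere 0 1" "\<And>y. y \<in> sphere 0 1 \<Longrightarrow> sqrt (N a) \<le> sqrt (N y)"
    using continuous_attains_inf[OF compact_sphere ne cont] by blast
  obtain b where b: "b \<in> sphere 0 1" "\<And>y. y \<in> sphere 0 1 \<Longrightarrow> sqrt (N y) \<le> sqrt (N b)"
    using continuous_attains_sup[OF compact_sphere ne cont] by blast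
  have "a \<noteq> 0" "b \<noteq> 0"
    using a b by auto
  have unit: "(1 / norm x) *\<^sub>R x \<in> sphere 0 1" and
    eq: "sqrt (N ((1 / norm x) *\<^sub>R x)) = sqrt (N x) / norm x" if "x \<noteq> 0" for x
    using that by (simp_all add: sqrt_form_scale)
  show thesis
  proof (rule that[of "sqrt (N a)" "sqrt (N b)"])
    show "0 < sqrt (N a)" "0 < sqrt (N b)"
      using \<open>a \<noteq> 0\<close> \<open>b \<noteq> 0\<close> form_pos by simp_all
    show "sqrt (N a) * norm x \<le> sqrt (N x)" for x
      using a(2)[OF unit[of x]] eq[of x] by (cases "x = 0") (auto simp: field_simps)
    show "sqrt (N x) \<le> sqrt (N b) * norm x" for x
      using b(2)[OF unit[of x]] eq[of x] by (cases "x = 0") (auto simp: field_simps)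
  qed
qed

end

section \<open>The sphere of rays\<close>

lemma mem_ray_iff: "y \<in> ray x \<longleftrightarrow> x \<noteq> 0 \<and> (\<exists>c>0. y = c *\<^sub>R x)"
  by (auto simp: ray_def ray_rel_def)

lemma ray_in_sphere: "x \<noteq> 0 \<Longrightarrow> ray x \<in> ray_sphere"
  by (auto simp: ray_sphere_def ray_def quotient_def)

lemma (in pos_form) alpha_ray:
  assumes "x \<noteq> 0" and "y \<noteq> 0"
  shows "alpha N (ray x) (ray y) = angle N x y"
proof -
  have "(\<Union>x'\<in>ray x. \<Union>y'\<in>ray y. {angle N x' y'}) = {angle N x y}"
  proof (intro equalityI subsetI)
    fix a
    assume "a \<in> (\<Union>x'\<in>ray x. \<Union>y'\<in>ray y. {angle N x' y'})"
    then show "a \<in> {angle N x y}"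
      by (auto simp: mem_ray_iff angle_scale_left angle_scale_right)
  next
    fix a
    assume "a \<in> {angle N x y}"
    moreover have "x \<in> ray x" "y \<in> ray y"
      using assms by (auto simp: mem_ray_iff intro!: exI[of _ 1])
    ultimately show "a \<in> (\<Union>x'\<in>ray x. \<Union>y'\<in>ray y. {angle N x' y'})"
      by blast
  qed
  then show ?thesis
    by (simp add: alpha_def)
qed

lemma (in pos_form) ray_in_ball_S:
  assumes "x \<noteq> 0" and "X \<subseteq> ray_sphere"
  shows "ray x \<in> ball_S N X r \<longleftrightarrow> (\<exists>y. y \<noteq> 0 \<and> ray y \<in> X \<and> angle N x y < r)"
proof -
  have "\<exists>y. y \<noteq> 0 \<and> q = ray y" if "q \<in> X" for q
    using that assms(2) by (auto simp: ray_sphere_def quotient_def ray_def)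
  then show ?thesis
    using assms(1) by (auto simp: ball_S_def ray_in_sphere alpha_dist_def INF_less_iff)
      (metis alpha_ray)+
qed

lemma (in pos_form) ray_in_ball_S_iff:
  assumes "x \<noteq> 0"
  shows "ray x \<in> ball_S N (rays Y) r \<longleftrightarrow> (\<exists>y\<in>Y - {0}. angle N x y < r)"
  using assms
  by (auto simp: ball_S_def ray_in_sphere alpha_dist_def INF_less_iff rays_def alpha_ray)

lemma (in pos_form) alpha_dist_rays_ge:
  assumes "ereal r \<le> alpha_dist N (rays X) (rays Y)" and "x \<in> X - {0}" and "y \<in> Y - {0}"
  shows "r \<le> angle N x y"
proof -
  have "alpha_dist N (rays X) (rays Y) \<le> ereal (alpha N (ray x) (ray y))"
    unfolding alpha_dist_def
    by (rule INF_lower2[of "ray x"], use assms in \<open>simp add: rays_def\<close>,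
        rule INF_lower, use assms in \<open>simp add: rays_def\<close>)
  then have "ereal r \<le> ereal (alpha N (ray x) (ray y))"
    using assms(1) by (rule order_trans[rotated])
  then show ?thesis
    using assms by (simp add: alpha_ray)
qed

section \<open>The form \<open>N\<^sub>0\<close>\<close>

locale signature_form = quad_form Q
  for Q :: "real ^ 'n \<Rightarrow> real" and S :: "(real ^ 'n) set" and d :: nat +
  assumes dim_space: "CARD('n) = 2 * d + 1"
    and signature: "has_signature Q (d + 1) d"
    and max_pos: "max_pos_def_subspace Q S"
begin

abbreviation T :: "(real ^ 'n) set" where
  "T \<equiv> perp Q S"

text \<open>Testing \<open>x = p + n\<close> against \<open>p\<close> and \<open>n\<close>
  separately gives \<open>Q p = 0\<close> and \<open>Q n = 0\<close>, and \<open>Q\<close> is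
  definite on each summand.\<close>

lemma nondegenerate:
  assumes "\<And>y. polar Q x y = 0"
  shows "x = 0"
proof -
  obtain P N where PN: "bij_betw (\<lambda>(x, y). x + y) (P \<times> N) UNIV" "orthogonal_wrt Q P N"
    "pos_def_on Q P" "pos_def_on (\<lambda>x. - Q x) N"
    using signature by (auto simp: has_signature_def)
  have "x \<in> (\<lambda>(x, y). x + y) ` (P \<times> N)"
    using PN(1) by (simp add: bij_betw_def)
  then obtain p n where pn: "p \<in> P" "n \<in> N" "x = p + n"
    by auto
  have "polar Q p n = 0"
    using PN(2) pn by (simp add: orthogonal_wrt_def)
  then have "Q p = 0" "Q n = 0"
    using assms[of p] assms[of n] pn(3) by (simp_all add: polar_simps polar_commute[of Q n])
  then have "p = 0" "n = 0"
    using PN(3,4) pn unfolding pos_def_on_def by force+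
  then show ?thesis
    using pn by simp
qed

lemma S_subspace: "subspace S" and S_pos: "x \<in> S \<Longrightarrow> x \<noteq> 0 \<Longrightarrow> 0 < Q x"
  using max_pos by (auto simp: max_pos_def_subspace_def pos_def_on_def)

lemma S_nonneg: "x \<in> S \<Longrightarrow> 0 \<le> Q x"
  using S_pos[of x] by (cases "x = 0") auto

lemma T_polar: "x \<in> T \<Longrightarrow> y \<in> S \<Longrightarrow> polar Q x y = 0"
  by (simp add: perp_def)

lemma S_inter_T: "x \<in> S \<Longrightarrow> x \<in> T \<Longrightarrow> x = 0"
  using T_polar[of x x] S_pos[of x] by fastforce

lemma S_T_decomposition:
  obtains u v where "u \<in> S" and "v \<in> T" and "x = u + v"
  using perp_complement[OF quadratic S_subspace] S_inter_T by blast

text \<open>A vector of \<open>T\<close> on which \<open>Q\<close> is positive could be adjoined to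
  \<open>S\<close>, against maximality.\<close>

lemma T_nonpos:
  assumes "x \<in> T"
  shows "Q x \<le> 0"
proof (rule ccontr)
  assume "\<not> Q x \<le> 0"
  let ?S' = "{u + c *\<^sub>R x |u c. u \<in> S}"
  have eq: "?S' = {u + v |u v. u \<in> S \<and> v \<in> span {x}}"
    by (auto simp: span_singleton)
  have "subspace ?S'"
    unfolding eq by (rule subspace_sums[OF S_subspace subspace_span])
  moreover have "pos_def_on Q ?S'"
    unfolding pos_def_on_def
  proof (intro ballI impI)
    fix y
    assume "y \<in> ?S'" and "y \<noteq> 0"
    then obtain u c where y: "y = u + c *\<^sub>R x" "u \<in> S"
      by blast
    then have Qy: "Q y = Q u + c\<^sup>2 * Q x"
      using T_polar[OF assms, of u] by (simp add: form_add polar_simps form_scale polar_commute[of Q u])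
    show "0 < Q y"
    proof (cases "u = 0")
      case True
      then have "c \<noteq> 0"
        using y \<open>y \<noteq> 0\<close> by auto
      then show ?thesis
        using Qy True \<open>\<not> Q x \<le> 0\<close> by simp
    next
      case False
      then show ?thesis
        using Qy S_pos[OF y(2)] \<open>\<not> Q x \<le> 0\<close> by (simp add: add_pos_nonneg)
    qed
  qed
  moreover have "S \<subseteq> ?S'"
    unfolding eq using span_0[of "{x}"] by force
  ultimately have "?S' = S"
    using max_pos by (simp add: max_pos_def_subspace_def)
  moreover have "0 + 1 *\<^sub>R x \<in> ?S'"
    using subspace_0[OF S_subspace] by blast
  ultimately have "x \<in> S"
    by simp
  then have "x = 0"
    using assms S_inter_T by blast
  then show False
    using \<open>\<not> Q x \<le> 0\<close> by simp
qed

text \<open>A null vector of \<open>T\<close> is orthogonal to \<open>T\<close>, because a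
  semidefinite form vanishes against its null vectors, and to \<open>S\<close> by definition. So it
  lies in the radical of \<open>Q\<close>.\<close>

lemma T_neg:
  assumes "x \<in> T" and "x \<noteq> 0"
  shows "Q x < 0"
proof (rule ccontr)
  assume "\<not> Q x < 0"
  then have Qx: "Q x = 0"
    using T_nonpos[OF assms(1)] by simp
  have polar_T: "polar Q x y = 0" if "y \<in> T" for y
  proof (rule ccontr)
    assume ne: "polar Q x y \<noteq> 0"
    \<comment> \<open>The coefficient is chosen to give
      \<open>Q (t *\<^sub>R x + y) = 1\<close>.\<close>
    define t where "t = (1 - Q y) / (2 * polar Q x y)"
    have "t *\<^sub>R x + y \<in> T"
      using assms(1) that subspace_perp by (simp add: subspace_add subspace_scale)
    then have "Q (t *\<^sub>R x + y) \<le> 0"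
      by (rule T_nonpos)
    moreover have "Q (t *\<^sub>R x + y) = 2 * t * polar Q x y + Q y"
      by (simp add: form_add form_scale polar_simps Qx)
    moreover have "2 * t * polar Q x y = 1 - Q y"
      using ne by (simp add: t_def)
    ultimately show False
      by simp
  qed
  have "polar Q x y = 0" for y
  proof -
    obtain u v where "u \<in> S" "v \<in> T" "y = u + v"
      by (rule S_T_decomposition)
    then show ?thesis
      using polar_T T_polar[OF assms(1)] by (simp add: polar_simps)
  qed
  then show False
    using nondegenerate assms(2) by blast
qed

text \<open>\<open>T\<close> meets a positive definite subspace of dimension \<open>d + 1\<close>
  only in 0.\<close>

lemma dim_T_le: "dim T \<le> d"
proof -
  obtain P where P: "subspace P" "dim P = d + 1" "pos_def_on Q P"
    using signature by (auto simp: has_signature_def)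
  have "T \<inter> P \<subseteq> {0}"
    using T_nonpos P(3) by (fastforce simp: pos_def_on_def)
  then have "dim (T \<inter> P) = 0"
    by (simp add: dim_eq_0)
  moreover have "dim {x + y |x y. x \<in> T \<and> y \<in> P} \<le> 2 * d + 1"
    using dim_subset_UNIV[of "{x + y |x y. x \<in> T \<and> y \<in> P}"] dim_space by simp
  ultimately show ?thesis
    using dim_sums_Int[OF subspace_perp[of S] P(1)] P(2) by linarith
qed

definition proj_S :: "real ^ 'n \<Rightarrow> real ^ 'n" where
  "proj_S x = orth_proj Q S x"

definition proj_T :: "real ^ 'n \<Rightarrow> real ^ 'n" where
  "proj_T x = orth_proj Q T x"

text \<open>This evaluates the definite descriptions in \<open>orth_proj\<close>. Uniqueness rests
  on definiteness: positive on \<open>S\<close> for the first projection, negative on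
  \<open>T\<close> for the second.\<close>

lemma proj_eq:
  assumes "u \<in> S" and "v \<in> T"
  shows "proj_S (u + v) = u" and "proj_T (u + v) = v"
proof -
  show "proj_S (u + v) = u"
    unfolding proj_S_def orth_proj_def
  proof (rule the_equality)
    show "u \<in> S \<and> u + v - u \<in> T"
      using assms by simp
    fix w
    assume w: "w \<in> S \<and> u + v - w \<in> T"
    have "(u + v - w) - v \<in> T"
      using w assms by (metis subspace_diff subspace_perp)
    then have "u - w \<in> T"
      by (simp add: algebra_simps)
    moreover have "u - w \<in> S"
      using w assms by (metis subspace_diff S_subspace)
    ultimately show "w = u"
      using S_inter_T[of "u - w"] by simp
  qed
  have S_perp: "x \<in> perp Q T" if "x \<in> S" for x
    using that T_polar by (auto simp: perp_def polar_commute[of Q x])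
  show "proj_T (u + v) = v"
    unfolding proj_T_def orth_proj_def
  proof (rule the_equality)
    show "v \<in> T \<and> u + v - v \<in> perp Q T"
      using assms S_perp by simp
    fix w
    assume w: "w \<in> T \<and> u + v - w \<in> perp Q T"
    have "v - w \<in> T"
      using w assms by (metis subspace_diff subspace_perp)
    moreover have "(u + v - w) - u \<in> perp Q T"
      using w S_perp[OF assms(1)] by (metis subspace_diff subspace_perp)
    then have "v - w \<in> perp Q T"
      by (simp add: algebra_simps)
    ultimately have "Q (v - w) = 0"
      using polar_self[of "v - w"] by (auto simp: perp_def simp del: polar_self)
    then show "w = v"
      using T_neg[OF \<open>v - w \<in> T\<close>] by fastforce
  qed
qed

lemma proj_S_in: "proj_S x \<in> S" and proj_T_in: "proj_T x \<in> T" and proj_sum: "proj_S x + proj_T x = x"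
proof -
  obtain u v where "u \<in> S" "v \<in> T" "x = u + v"
    by (rule S_T_decomposition)
  then show "proj_S x \<in> S" "proj_T x \<in> T" "proj_S x + proj_T x = x"
    by (simp_all add: proj_eq)
qed

lemma linear_proj_S: "linear proj_S" and linear_proj_T: "linear proj_T"
proof -
  have add: "proj_S (x + y) = proj_S x + proj_S y \<and> proj_T (x + y) = proj_T x + proj_T y" for x y
  proof -
    have "x + y = (proj_S x + proj_T x) + (proj_S y + proj_T y)"
      by (simp only: proj_sum)
    then have "x + y = (proj_S x + proj_S y) + (proj_T x + proj_T y)"
      by (simp only: ac_simps)
    moreover have "proj_S x + proj_S y \<in> S" "proj_T x + proj_T y \<in> T"
      by (intro subspace_add S_subspace subspace_perp proj_S_in proj_T_in)+
    ultimately show ?thesis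
      using proj_eq by metis
  qed
  have scale: "proj_S (c *\<^sub>R x) = c *\<^sub>R proj_S x \<and> proj_T (c *\<^sub>R x) = c *\<^sub>R proj_T x" for c x
  proof -
    have "c *\<^sub>R x = c *\<^sub>R (proj_S x + proj_T x)"
      by (simp only: proj_sum)
    then have "c *\<^sub>R x = c *\<^sub>R proj_S x + c *\<^sub>R proj_T x"
      by (simp only: scaleR_right_distrib)
    moreover have "c *\<^sub>R proj_S x \<in> S" "c *\<^sub>R proj_T x \<in> T"
      by (intro subspace_scale S_subspace subspace_perp proj_S_in proj_T_in)+
    ultimately show ?thesis
      using proj_eq by metis
  qed
  show "linear proj_S" "linear proj_T"
    using add scale by (auto intro: linearI)
qed

abbreviation N :: "real ^ 'n \<Rightarrow> real" where
  "N \<equiv> N0 Q S"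

lemma N_eq: "N x = Q (proj_S x) - Q (proj_T x)"
  by (simp add: N0_def proj_S_def proj_T_def)

lemma Q_eq: "Q x = Q (proj_S x) + Q (proj_T x)"
proof -
  have "Q x = Q (proj_S x + proj_T x)"
    by (simp add: proj_sum)
  also have "polar Q (proj_S x) (proj_T x) = 0"
    using T_polar[OF proj_T_in proj_S_in] by (simp add: polar_commute)
  then have "Q (proj_S x + proj_T x) = Q (proj_S x) + Q (proj_T x)"
    by (simp add: form_add)
  finally show ?thesis .
qed

lemma N_quadratic: "quadratic_form N"
proof (rule quadratic_formI)
  let ?b = "\<lambda>x y. polar Q (proj_S x) (proj_S y) - polar Q (proj_T x) (proj_T y)"
  show "bilinear ?b"
    unfolding bilinear_def
    using linear_proj_S linear_proj_T
    by (auto intro!: linearI simp: linear_add linear_scale polar_simps algebra_simps)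
  show "?b x y = ?b y x" for x y
    by (simp add: polar_commute)
  show "N x = ?b x x" for x
    by (simp add: N_eq)
qed

lemma N_pos_def: "pos_def_on N UNIV"
  unfolding pos_def_on_def
proof (intro ballI impI)
  fix x :: "real ^ 'n"
  assume "x \<noteq> 0"
  then have "proj_S x \<noteq> 0 \<or> proj_T x \<noteq> 0"
    using proj_sum[of x] by auto
  then show "0 < N x"
    unfolding N_eq
    using S_pos[OF proj_S_in, of x] S_nonneg[OF proj_S_in, of x]
      T_neg[OF proj_T_in, of x] T_nonpos[OF proj_T_in, of x]
    by linarith
qed

sublocale N: euclidean_pos_form N
  by unfold_locales (rule N_quadratic N_pos_def)+

lemma N_S: "x \<in> S \<Longrightarrow> N x = Q x"
  using proj_eq[of x 0] by (simp add: N_eq subspace_0 subspace_perp)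

lemma N_isotropic: "Q x = 0 \<Longrightarrow> N x = - 2 * Q (proj_T x)"
  using Q_eq[of x] by (simp add: N_eq)

lemma abs_Q_le_N: "\<bar>Q x\<bar> \<le> N x"
  using S_nonneg[OF proj_S_in, of x] T_nonpos[OF proj_T_in, of x] unfolding N_eq Q_eq[of x] by linarith

text \<open>For unit vectors, polarization of \<bar>\<open>Q\<close>\<bar> \<le> \<open>N\<close>
  and the parallelogram law for \<open>N\<close> bound \<open>4 * polar Q x y\<close> in absolute
  value by 4.\<close>

lemma polar_Q_le: "\<bar>polar Q x y\<bar> \<le> sqrt (N x) * sqrt (N y)"
proof (cases "x = 0 \<or> y = 0")
  case False
  define x' y' where "x' = (1 / sqrt (N x)) *\<^sub>R x" and "y' = (1 / sqrt (N y)) *\<^sub>R y"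
  have unit: "N x' = 1" "N y' = 1"
    using False by (simp_all add: x'_def y'_def N.form_scale power_one_over)
  have "4 * \<bar>polar Q x' y'\<bar> = \<bar>Q (x' + y') - Q (x' - y')\<bar>"
    by (simp add: form_add form_diff)
  also have "\<dots> \<le> N (x' + y') + N (x' - y')"
    using abs_Q_le_N[of "x' + y'"] abs_Q_le_N[of "x' - y'"] by linarith
  also have "\<dots> = 4"
    by (simp add: N.form_diff N.form_add unit)
  finally have "\<bar>polar Q x' y'\<bar> \<le> 1"
    by simp
  moreover have "polar Q x' y' = polar Q x y / (sqrt (N x) * sqrt (N y))"
    by (simp add: x'_def y'_def polar_simps)
  ultimately show ?thesis
    using False by (simp add: abs_mult pos_divide_le_eq N.form_pos)
qed auto

text \<open>
  The projection to \<open>T\<close> is injective on a totally isotropic subspace, hence onto when the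
  dimension is \<open>d\<close>.
\<close>

lemma isotropic_graph:
  assumes "totally_isotropic Q V" and "dim V = d"
  obtains v where "v \<in> V" and "x - v \<in> S"
proof -
  have V: "subspace V"
    using assms(1) by (simp add: totally_isotropic_def)
  have "inj_on proj_T V"
    unfolding linear_injective_on_subspace_0[OF linear_proj_T V]
  proof (intro ballI impI)
    fix v
    assume "v \<in> V" and "proj_T v = 0"
    then have "N v = 0"
      using assms(1) N_isotropic[of v] by (simp add: totally_isotropic_def)
    then show "v = 0"
      by simp
  qed
  then have "dim (proj_T ` V) = d"
    using dim_image_eq[OF linear_proj_T] assms(2) V by (metis span_eq_iff)
  moreover have "proj_T ` V \<subseteq> T"
    using proj_T_in by blast
  ultimately have "proj_T ` V = T"
    using dim_T_le subspace_dim_equal[of "proj_T ` V" T] linear_subspace_image[OF linear_proj_T V] subspace_perp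
    by metis
  then obtain v where v: "v \<in> V" "proj_T v = proj_T x"
    using proj_T_in[of x] by (metis imageE)
  have "x - v = proj_S x - proj_S v"
    using proj_sum[of x] proj_sum[of v] v(2) by (metis add_diff_cancel_right)
  then have "x - v \<in> S"
    using proj_S_in subspace_diff[OF S_subspace] by simp
  with v(1) show thesis
    by (rule that)
qed

text \<open>Subtract the vector of \<open>V\<close> with the same projection to \<open>T\<close>.
  The remainder lies in \<open>S\<close>, where \<open>N\<close> and \<open>Q\<close> agree, and
  subtracting an element of \<open>V\<close> does not change \<open>Q\<close> on
  \<open>perp Q V\<close>. So modulo \<open>V\<close> the size of \<open>z\<close> is controlled by
  \<open>Q z\<close> alone, a quantity that isometries preserve.\<close>

lemma perp_isotropic_decomposition:
  assumes "totally_isotropic Q V" and "dim V = d" and "z \<in> perp Q V"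
  obtains v b where "v \<in> V" and "z = v + b" and "N b = Q z"
proof -
  obtain v where v: "v \<in> V" "z - v \<in> S"
    using isotropic_graph[OF assms(1,2)] by blast
  have "polar Q z v = 0" "Q v = 0"
    using assms v by (auto simp: perp_def totally_isotropic_def)
  then have "N (z - v) = Q z"
    using N_S[OF v(2)] by (simp add: form_diff)
  then show thesis
    using that[OF v(1), of "z - v"] by simp
qed

text \<open>
  Transversality of isotropic subspaces is quantified by the pairing \<open>Q\<close>: if \<open>v \<in> V\<close> has the same
  projection to \<open>T\<close> as \<open>a\<close>, then \<open>N v = N a\<close> and \<open>- 2 * polar Q a v = Q (a - v) = N (a - v)\<close>.
\<close>

lemma isotropic_pairing:
  assumes "totally_isotropic Q V" and "dim V = d" and "Q a = 0" and "a \<noteq> 0"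
    and "0 \<le> \<epsilon>" and "\<epsilon> \<le> pi" and "\<And>v. v \<in> V \<Longrightarrow> v \<noteq> 0 \<Longrightarrow> \<epsilon> \<le> angle N a v"
  obtains v where "v \<in> V" and "v \<noteq> 0" and "(1 - cos \<epsilon>) * (sqrt (N a) * sqrt (N v)) \<le> \<bar>polar Q a v\<bar>"
proof -
  obtain v where v: "v \<in> V" "a - v \<in> S"
    using isotropic_graph[OF assms(1,2)] by blast
  have "Q v = 0"
    using v assms(1) by (simp add: totally_isotropic_def)
  have "proj_T (a - v) = 0"
    using proj_eq(2)[OF v(2), of 0] by (simp add: subspace_0 subspace_perp)
  then have "proj_T a = proj_T v"
    by (simp add: linear_diff[OF linear_proj_T])
  then have Nv: "N v = N a"
    using N_isotropic[OF \<open>Q v = 0\<close>] N_isotropic[OF assms(3)] by simp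
  then have "v \<noteq> 0"
    using assms(4) by auto
  have "- 2 * polar Q a v = Q (a - v)"
    by (simp add: form_diff assms(3) \<open>Q v = 0\<close>)
  also have "\<dots> = N (a - v)"
    by (simp add: N_S[OF v(2)])
  also have "\<dots> = 2 * N a - 2 * polar N a v"
    by (simp add: N.form_diff Nv)
  finally have eq: "- polar Q a v = N a - polar N a v"
    by simp
  have "\<not> angle N a v < \<epsilon>"
    using assms(7)[OF v(1) \<open>v \<noteq> 0\<close>] by simp
  then have "polar N a v \<le> cos \<epsilon> * (sqrt (N a) * sqrt (N v))"
    using N.angle_less_iff[OF assms(4) \<open>v \<noteq> 0\<close> assms(5,6)] by simp
  then have "(1 - cos \<epsilon>) * (sqrt (N a) * sqrt (N v)) \<le> - polar Q a v"
    unfolding eq Nv by (simp add: algebra_simps)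
  then show thesis
    using that[OF v(1) \<open>v \<noteq> 0\<close>] by linarith
qed

end

section \<open>Orientations and wings\<close>

lemma rows_eq_range: "rows b = range (($) b)"
  by (auto simp: rows_def row_def)

lemma matrix_mult_row: "(A ** b) $ i = (\<Sum>j\<in>UNIV. A $ i $ j *\<^sub>R b $ j)"
  by (simp add: vec_eq_iff matrix_matrix_mult_def)

lemma ordered_basis_dim:
  fixes b :: "real ^ 'n ^ 'k"
  assumes "ordered_basis V b"
  shows "subspace V" and "dim V = CARD('k)"
proof -
  have b: "inj (($) b)" "independent (rows b)" "span (rows b) = V"
    using assms by (auto simp: ordered_basis_def)
  show "subspace V"
    using b(3) subspace_span by blast
  have "dim V = card (rows b)"
    using b dim_span_eq_card_independent by blast
  then show "dim V = CARD('k)"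
    using b(1) by (simp add: rows_eq_range card_image)
qed

lemma ordered_basis_coefficients:
  fixes b :: "real ^ 'n ^ 'k"
  assumes "ordered_basis V b" and "x \<in> V"
  obtains a :: "real ^ 'k" where "x = (\<Sum>j\<in>UNIV. a $ j *\<^sub>R b $ j)"
proof -
  have b: "inj (($) b)" "span (range (($) b)) = V"
    using assms by (auto simp: ordered_basis_def rows_eq_range)
  obtain u where "x = (\<Sum>v\<in>range (($) b). u v *\<^sub>R v)"
    using assms(2) b(2) span_finite[of "range (($) b)"] by auto
  also have "\<dots> = (\<Sum>j\<in>UNIV. u (b $ j) *\<^sub>R b $ j)"
    by (simp add: sum.reindex[OF b(1)])
  finally show thesis
    using that[of "\<chi> j. u (b $ j)"] by simp
qed

lemma ordered_basis_independent:
  fixes b :: "real ^ 'n ^ 'k"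
  assumes "ordered_basis V b" and "(\<Sum>j\<in>UNIV. a $ j *\<^sub>R b $ j) = 0"
  shows "a = (0 :: real ^ 'k)"
proof -
  have b: "inj (($) b)" "independent (range (($) b))"
    using assms by (auto simp: ordered_basis_def rows_eq_range)
  define u where "u v = a $ (inv_into UNIV (($) b) v)" for v
  have u: "u (b $ j) = a $ j" for j
    using b(1) by (simp add: u_def)
  have "(\<Sum>v\<in>range (($) b). u v *\<^sub>R v) = 0"
    using assms(2) by (simp add: sum.reindex[OF b(1)] u)
  then have "u (b $ j) = 0" for j
    using independentD[OF b(2) _ subset_refl, of u "b $ j"] by simp
  then show ?thesis
    by (simp add: vec_eq_iff u)
qed

lemma ordered_basis_mult_cancel:
  fixes b :: "real ^ 'n ^ 'k" and A B :: "real ^ 'k ^ 'l"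
  assumes "ordered_basis V b" and "A ** b = B ** b"
  shows "A = B"
proof -
  have "A $ i - B $ i = 0" for i
  proof (rule ordered_basis_independent[OF assms(1)])
    have "(A ** b) $ i - (B ** b) $ i = 0"
      by (simp add: assms(2))
    then show "(\<Sum>j\<in>UNIV. (A $ i - B $ i) $ j *\<^sub>R b $ j) = 0"
      by (simp add: matrix_mult_row scaleR_left_diff_distrib sum_subtractf)
  qed
  then show ?thesis
    by (simp add: vec_eq_iff)
qed

text \<open>Each basis is expressed in the other; by uniqueness of coefficients the two matrices are
  inverse to each other, whence the nonzero determinant.\<close>

lemma ordered_basis_change:
  fixes b c :: "real ^ 'n ^ 'k"
  assumes "ordered_basis V b" and "ordered_basis V c"
  obtains M where "b = M ** c" and "det M \<noteq> 0"
proof -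
  have express: "\<exists>M. b = M ** c" if b: "ordered_basis V b" and c: "ordered_basis V c"
    for b c :: "real ^ 'n ^ 'k"
  proof -
    have "b $ i \<in> V" for i
      using b span_base[of "b $ i" "rows b"] by (auto simp: ordered_basis_def rows_eq_range)
    then have "\<exists>a :: real ^ 'k. b $ i = (\<Sum>j\<in>UNIV. a $ j *\<^sub>R c $ j)" for i
      using ordered_basis_coefficients[OF c] by metis
    then obtain f :: "'k \<Rightarrow> real ^ 'k" where "\<And>i. b $ i = (\<Sum>j\<in>UNIV. f i $ j *\<^sub>R c $ j)"
      by metis
    then have "b = (\<chi> i. f i) ** c"
      by (simp add: vec_eq_iff[of b] matrix_mult_row)
    then show ?thesis
      by blast
  qed
  obtain M where M: "b = M ** c"
    using express[OF assms] by blast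
  obtain M' where M': "c = M' ** b"
    using express[OF assms(2,1)] by blast
  have "(M' ** M) ** c = mat 1 ** c"
    using M M' by (simp add: matrix_mul_assoc[symmetric])
  then have "M' ** M = mat 1"
    by (rule ordered_basis_mult_cancel[OF assms(2)])
  then have "det M' * det M = 1"
    by (simp add: det_mul[symmetric])
  then have "det M \<noteq> 0"
    by auto
  with M show thesis
    by (rule that)
qed

section \<open>Determinants of block matrices and appended basis vectors\<close>

lemma sum_UNIV_option:
  fixes f :: "'d::finite option \<Rightarrow> 'a::comm_monoid_add"
  shows "(\<Sum>k\<in>UNIV. f k) = f None + (\<Sum>i\<in>UNIV. f (Some i))"
  by (simp add: UNIV_option_conv sum.reindex)

lemma prod_UNIV_option:
  fixes f :: "'d::finite option \<Rightarrow> 'a::comm_monoid_mult"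
  shows "(\<Prod>k\<in>UNIV. f k) = f None * (\<Prod>i\<in>UNIV. f (Some i))"
  by (simp add: UNIV_option_conv prod.reindex)

text \<open>The block matrix diag(\<open>A\<close>, 1). It describes a change of basis of
  \<open>V\<close> that keeps the appended vector.\<close>

definition border :: "real ^ 'd ^ 'd \<Rightarrow> real ^ 'd option ^ 'd option" where
  "border A = (\<chi> k l. case k of
      None \<Rightarrow> of_bool (l = None)
    | Some i \<Rightarrow> (case l of None \<Rightarrow> 0 | Some j \<Rightarrow> A $ i $ j))"

lemma border_nth [simp]:
  "border A $ None $ None = 1" "border A $ None $ Some j = 0"
  "border A $ Some i $ None = 0" "border A $ Some i $ Some j = A $ i $ j"
  by (simp_all add: border_def)

lemma option_matrix_eqI:
  fixes A B :: "'a ^ ('d::finite option) ^ ('d option)"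
  assumes "A $ None $ None = B $ None $ None" and "\<And>j. A $ None $ Some j = B $ None $ Some j"
    and "\<And>i. A $ Some i $ None = B $ Some i $ None" and "\<And>i j. A $ Some i $ Some j = B $ Some i $ Some j"
  shows "A = B"
proof -
  have "A $ k $ l = B $ k $ l" for k l
    using assms by (cases k; cases l) auto
  then show ?thesis
    by (simp add: vec_eq_iff)
qed

lemma border_mult: "border (A ** B) = border A ** border B"
  by (rule option_matrix_eqI) (simp_all add: matrix_matrix_mult_def sum_UNIV_option)

lemma det_swap_matrix:
  assumes "m \<noteq> n"
  shows "det (\<chi> i j. (mat 1 :: real ^ 'k ^ 'k) $ i $ Transposition.transpose m n j) = - 1"
proof -
  have "Transposition.transpose m n permutes UNIV"
    by (rule permutes_swap_id) auto
  then show ?thesis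
    using assms by (simp add: det_permute_columns sign_swap_id)
qed

lemma det_shear_matrix:
  assumes "m \<noteq> n"
  shows "det (\<chi> i j. if i = m \<and> j = n then c else of_bool (i = j) :: real ^ 'k ^ 'k) = 1"
proof -
  have "(\<chi> i j. if i = m \<and> j = n then c else of_bool (i = j) :: real ^ 'k ^ 'k) =
    (\<chi> k. if k = m then row m (mat 1) + c *s row n (mat 1) else row k (mat 1))"
    using assms by (auto simp: vec_eq_iff row_def mat_def)
  then show ?thesis
    using assms by (simp add: det_row_operation)
qed

text \<open>Both sides are multiplicative, so it suffices to compare them on matrices with a zero
  row, diagonal matrices, transpositions and shears; \<open>border\<close> turns each of these into
  a matrix of the same kind.\<close>

lemma det_border: "det (border A) = det A"
proof (induct A rule: induct_matrix_elementary)
  case (1 A B)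
  then show ?case
    by (simp add: border_mult det_mul)
next
  case (2 A i)
  have "row (Some i) (border A) $ l = 0" for l
    using 2 by (cases l) (auto simp: row_def vec_eq_iff)
  then have "row (Some i) (border A) = 0"
    by (simp add: vec_eq_iff)
  then show ?case
    using 2 by (simp add: det_zero_row)
next
  case (3 A)
  have "border A $ k $ l = 0" if "k \<noteq> l" for k l
    using that 3 by (cases k; cases l) auto
  then show ?case
    using 3 by (simp add: det_diagonal prod_UNIV_option)
next
  case (4 m n)
  have "border (\<chi> i j. mat 1 $ i $ Transposition.transpose m n j) =
      (\<chi> i j. mat 1 $ i $ Transposition.transpose (Some m) (Some n) j)"
    by (rule option_matrix_eqI) (auto simp: mat_def Transposition.transpose_def)
  then show ?case
    using 4 by (simp add: det_swap_matrix)
next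
  case (5 m n c)
  have "border (\<chi> i j. if i = m \<and> j = n then c else of_bool (i = j)) =
      (\<chi> i j. if i = Some m \<and> j = Some n then c else of_bool (i = j))"
    by (rule option_matrix_eqI) auto
  then show ?case
    using 5 by (simp add: det_shear_matrix)
qed

lemma append_basis_nth [simp]:
  "append_basis b e $ None = e" "append_basis b e $ Some i = b $ i"
  by (simp_all add: append_basis_def)

lemma append_basis_mult: "append_basis (A ** b) e = border A ** append_basis b e"
proof -
  have "append_basis (A ** b) e $ k = (border A ** append_basis b e) $ k" for k
    by (cases k) (simp_all add: matrix_mult_row sum_UNIV_option)
  then show ?thesis
    by (simp add: vec_eq_iff)
qed

text \<open>The identity matrix with its last row replaced by (\<open>a\<close>, \<open>x\<close>).
  It describes the replacement of the appended vector \<open>e\<close> by a combination of the basis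
  plus \<open>x *\<^sub>R e\<close>.\<close>

definition last_row :: "real ^ 'd \<Rightarrow> real \<Rightarrow> real ^ 'd option ^ 'd option" where
  "last_row a x = (\<chi> k l. case k of
      None \<Rightarrow> (case l of None \<Rightarrow> x | Some j \<Rightarrow> a $ j)
    | Some i \<Rightarrow> of_bool (l = Some i))"

lemma last_row_nth [simp]:
  "last_row a x $ None $ None = x" "last_row a x $ None $ Some j = a $ j"
  "last_row a x $ Some i $ None = 0" "last_row a x $ Some i $ Some j = of_bool (i = j)"
  by (auto simp: last_row_def)

text \<open>Adding a combination of the other rows to the row \<open>None\<close> reduces
  \<open>a\<close> to 0, and the matrix becomes diagonal.\<close>

lemma det_last_row:
  fixes a :: "real ^ 'd"
  shows "det (last_row a x) = x"
proof -
  let ?D = "last_row (0 :: real ^ 'd) x" and ?w = "\<Sum>j\<in>UNIV. a $ j *\<^sub>R axis (Some j) 1 :: real ^ 'd option"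
  have row_D: "row (Some j) ?D = axis (Some j) 1" for j
  proof -
    have "row (Some j) ?D $ l = axis (Some j) 1 $ l" for l
      by (cases l) (auto simp: row_def axis_def)
    then show ?thesis
      by (simp add: vec_eq_iff)
  qed
  have "?w \<in> span {row l ?D |l. l \<noteq> None}"
    by (intro span_sum span_scale span_base) (metis (mono_tags, lifting) row_D mem_Collect_eq option.distinct(1))
  then have "det (\<chi> k. if k = None then row None ?D + ?w else row k ?D) = det ?D"
    using det_row_span[of ?w ?D None] by (simp add: span_vec_eq)
  moreover have "(\<chi> k. if k = None then row None ?D + ?w else row k ?D) = last_row a x"
    by (rule option_matrix_eqI) (simp_all add: row_def axis_def if_distrib cong: if_cong)
  moreover have "?D $ k $ l = 0" if "k \<noteq> l" for k l
    using that by (cases k; cases l) auto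
  then have "det ?D = x"
    by (simp add: det_diagonal prod_UNIV_option)
  ultimately show ?thesis
    by simp
qed

lemma append_basis_last_row:
  "append_basis b ((\<Sum>j\<in>UNIV. a $ j *\<^sub>R b $ j) + x *\<^sub>R e) = last_row a x ** append_basis b e"
proof -
  have "append_basis b ((\<Sum>j\<in>UNIV. a $ j *\<^sub>R b $ j) + x *\<^sub>R e) $ k = (last_row a x ** append_basis b e) $ k" for k
    by (cases k) (simp_all add: matrix_mult_row sum_UNIV_option if_distrib[of "\<lambda>c. c *\<^sub>R _"] of_bool_def cong: if_cong)
  then show ?thesis
    by (simp add: vec_eq_iff)
qed

lemma ordered_basis_append:
  fixes b :: "real ^ 'n ^ 'd"
  assumes "ordered_basis V b" and "subspace U" and "V \<subseteq> U" and "dim U = CARD('d) + 1"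
    and "e \<in> U" and "e \<notin> V"
  shows "ordered_basis U (append_basis b e)"
proof -
  have b: "inj (($) b)" "independent (rows b)" "span (rows b) = V"
    using assms by (auto simp: ordered_basis_def)
  have rows: "rows (append_basis b e) = insert e (rows b)"
    by (simp add: rows_eq_range UNIV_option_conv image_image)
  have "e \<notin> rows b"
    using assms(6) b(3) span_base by blast
  then have "inj (($) (append_basis b e))"
    using b(1) by (auto simp: inj_def rows_eq_range split_option_all)
  moreover have ind: "independent (insert e (rows b))"
    using b assms(6) by (simp add: independent_insert)
  moreover have "span (insert e (rows b)) = U"
  proof (rule subspace_dim_equal)
    show "span (insert e (rows b)) \<subseteq> U"
      using assms b(3) span_superset[of "rows b"] by (intro span_minimal) auto
    have "card (rows b) = CARD('d)"
      using b(1) by (simp add: rows_eq_range card_image)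
    then have "card (insert e (rows b)) = CARD('d) + 1"
      using \<open>e \<notin> rows b\<close> by (simp add: rows_eq_range)
    then show "dim U \<le> dim (span (insert e (rows b)))"
      using ind dim_eq_card_independent assms(4) by (metis dim_span order_refl)
  qed (use assms in auto)
  ultimately show ?thesis
    by (simp add: ordered_basis_def rows)
qed

text \<open>Any vector of \<open>perp Q V\<close> outside \<open>V\<close> becomes a wing vector
  after a change of sign. Every other wing vector is \<open>v + x *\<^sub>R e\<close> with
  \<open>v\<close> in \<open>V\<close>, and the determinant of \<open>last_row\<close>, which is
  \<open>x\<close>, has to be positive. So all wing vectors span the same half-space over
  \<open>V\<close>.\<close>

lemma pos_wing_halfspace:
  fixes oV :: "(real ^ 'n) set \<Rightarrow> (real ^ 'n ^ 'd) set"
  assumes "orientation_of V (oV V)" and "orientation_of (perp Q V) (oP V)" and "V \<subseteq> perp Q V"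
  obtains e where "e \<in> perp Q V" and "e \<notin> V"
    and "pos_wing Q oV oP V = {v + x *\<^sub>R e |v x. v \<in> V \<and> 0 \<le> x}"
    and "perp Q V = {v + x *\<^sub>R e |v x. v \<in> V}"
proof -
  let ?U = "perp Q V"
  obtain b where b: "ordered_basis V b" "oV V = {A ** b |A. 0 < det A}"
    using assms(1) by (auto simp: orientation_of_def)
  obtain c where c: "ordered_basis ?U c" "oP V = {A ** c |A. 0 < det A}"
    using assms(2) by (auto simp: orientation_of_def)
  have V: "subspace V" "dim V = CARD('d)"
    using ordered_basis_dim[OF b(1)] by auto
  have U: "subspace ?U" "dim ?U = CARD('d) + 1"
    using ordered_basis_dim[OF c(1)] by auto
  obtain e0 where e0: "e0 \<in> ?U" "e0 \<notin> V"
    using V(2) U(2) dim_subset[of ?U V] by auto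
  obtain M where M: "append_basis b e0 = M ** c" "det M \<noteq> 0"
    using ordered_basis_change[OF ordered_basis_append[OF b(1) U(1) assms(3) U(2) e0] c(1)] by blast
  \<comment> \<open>The sign of \<open>det M\<close> tells whether \<open>e0\<close> completes the
    basis \<open>b\<close> of \<open>V\<close> to a direct basis of \<open>perp Q V\<close>;
    multiplying by it corrects the orientation.\<close>
  define e where "e = sgn (det M) *\<^sub>R e0"
  have e: "e \<in> ?U" "e \<notin> V"
  proof -
    show "e \<in> ?U"
      using e0 U(1) by (simp add: e_def subspace_scale)
    have "e0 = sgn (det M) *\<^sub>R e"
      using M(2) by (simp add: e_def sgn_if)
    then show "e \<notin> V"
      using e0(2) V(1) subspace_scale by metis
  qed
  have ebasis: "ordered_basis ?U (append_basis b e)"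
    by (rule ordered_basis_append[OF b(1) U(1) assms(3) U(2) e])
  define M' where "M' = last_row 0 (sgn (det M)) ** M"
  have M': "append_basis b e = M' ** c"
    using append_basis_last_row[of b 0 "sgn (det M)" e0] M(1)
    by (simp add: M'_def e_def matrix_mul_assoc)
  have "det M' = \<bar>det M\<bar>"
    by (simp add: M'_def det_mul det_last_row sgn_mult_abs mult.commute abs_sgn)
  then have det_M': "0 < det M'"
    using M(2) by simp
  have wing: "wing_vector Q oV oP V e"
    unfolding wing_vector_def
  proof (intro conjI ballI)
    fix b'
    assume "b' \<in> oV V"
    then obtain A where "b' = A ** b" "0 < det A"
      using b(2) by blast
    then have "append_basis b' e = (border A ** M') ** c" "0 < det (border A ** M')"
      using det_M' by (simp_all add: append_basis_mult M' matrix_mul_assoc det_mul det_border)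
    then show "append_basis b' e \<in> oP V"
      using c(2) by blast
  qed (rule e(1))
  have decomp: "\<exists>a x. e' = (\<Sum>j\<in>UNIV. a $ j *\<^sub>R b $ j) + x *\<^sub>R e" if U: "e' \<in> ?U" for e'
  proof -
    obtain a where "e' = (\<Sum>k\<in>UNIV. a $ k *\<^sub>R append_basis b e $ k)"
      using ordered_basis_coefficients[OF ebasis U] by blast
    then have "e' = (\<Sum>j\<in>UNIV. (\<chi> j. a $ Some j) $ j *\<^sub>R b $ j) + (a $ None) *\<^sub>R e"
      by (simp add: sum_UNIV_option)
    then show ?thesis
      by blast
  qed
  have comb: "(\<Sum>j\<in>UNIV. a $ j *\<^sub>R b $ j) \<in> V" for a
  proof -
    have "b $ j \<in> V" for j
      using b(1) span_base[of "b $ j" "rows b"] by (auto simp: ordered_basis_def rows_eq_range)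
    then show ?thesis
      by (intro subspace_sum subspace_scale V(1))
  qed
  have pos: "\<exists>v x. v \<in> V \<and> 0 < x \<and> e' = v + x *\<^sub>R e" if w: "wing_vector Q oV oP V e'" for e'
  proof -
    obtain a x where e': "e' = (\<Sum>j\<in>UNIV. a $ j *\<^sub>R b $ j) + x *\<^sub>R e"
      using w decomp[of e'] unfolding wing_vector_def by blast
    have "mat 1 ** b \<in> oV V"
      unfolding b(2) by (rule CollectI, rule exI[of _ "mat 1"]) simp
    then have "append_basis b e' \<in> oP V"
      using w by (simp add: wing_vector_def)
    then obtain A where A: "append_basis b e' = A ** c" "0 < det A"
      using c(2) by blast
    have "A ** c = (last_row a x ** M') ** c"
      using A(1) append_basis_last_row[of b a x e] M' e' by (simp add: matrix_mul_assoc)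
    then have "A = last_row a x ** M'"
      by (rule ordered_basis_mult_cancel[OF c(1)])
    then have "det A = x * det M'"
      by (simp add: det_mul det_last_row)
    then have "0 < x"
      using A(2) det_M' zero_less_mult_pos2 by metis
    then show ?thesis
      using e' comb by blast
  qed
  show thesis
  proof (rule that[OF e])
    show "pos_wing Q oV oP V = {v + x *\<^sub>R e |v x. v \<in> V \<and> 0 \<le> x}"
    proof (intro equalityI subsetI)
      fix y
      assume "y \<in> pos_wing Q oV oP V"
      then obtain v x e' where y: "y = v + x *\<^sub>R e'" "v \<in> V" "0 \<le> x" "wing_vector Q oV oP V e'"
        by (auto simp: pos_wing_def)
      then obtain v' x' where "v' \<in> V" "0 < x'" "e' = v' + x' *\<^sub>R e"
        using pos by blast
      then have "y = (v + x *\<^sub>R v') + (x * x') *\<^sub>R e" "v + x *\<^sub>R v' \<in> V" "0 \<le> x * x'"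
        using y V(1) by (simp_all add: algebra_simps subspace_add subspace_scale)
      then show "y \<in> {v + x *\<^sub>R e |v x. v \<in> V \<and> 0 \<le> x}"
        by blast
    next
      fix y
      assume "y \<in> {v + x *\<^sub>R e |v x. v \<in> V \<and> 0 \<le> x}"
      then show "y \<in> pos_wing Q oV oP V"
        using wing unfolding pos_wing_def by blast
    qed
    show "?U = {v + x *\<^sub>R e |v x. v \<in> V}"
    proof (intro equalityI subsetI)
      fix y
      assume "y \<in> ?U"
      then show "y \<in> {v + x *\<^sub>R e |v x. v \<in> V}"
        using decomp comb by blast
    next
      fix y
      assume "y \<in> {v + x *\<^sub>R e |v x. v \<in> V}"
      then show "y \<in> ?U"
        using e(1) assms(3) U(1) by (auto intro!: subspace_add subspace_scale)
    qed
  qed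
qed

section \<open>Frames\<close>

locale splitting =
  fixes A B C :: "'a::real_vector set"
  assumes subspaces: "subspace A" "subspace B" "subspace C"
    and exists_parts: "\<And>x. \<exists>a\<in>A. \<exists>b\<in>B. \<exists>c\<in>C. x = a + b + c"
    and direct: "\<And>a b c. a \<in> A \<Longrightarrow> b \<in> B \<Longrightarrow> c \<in> C \<Longrightarrow> a + b + c = 0 \<Longrightarrow> a = 0 \<and> b = 0 \<and> c = 0"
begin

lemma exists_parts_reverse: "\<exists>c\<in>C. \<exists>b\<in>B. \<exists>a\<in>A. x = c + b + a"
proof -
  obtain a b c where "a \<in> A" "b \<in> B" "c \<in> C" "x = a + b + c"
    using exists_parts by blast
  moreover from this have "x = c + b + a"
    by (simp add: ac_simps)
  ultimately show ?thesis
    by blast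
qed

definition parts :: "'a \<Rightarrow> 'a \<times> 'a \<times> 'a" where
  "parts x = (SOME (a, b, c). a \<in> A \<and> b \<in> B \<and> c \<in> C \<and> x = a + b + c)"

definition part_A :: "'a \<Rightarrow> 'a" where "part_A x = fst (parts x)"
definition part_B :: "'a \<Rightarrow> 'a" where "part_B x = fst (snd (parts x))"
definition part_C :: "'a \<Rightarrow> 'a" where "part_C x = snd (snd (parts x))"

lemma parts_unique:
  assumes "a \<in> A" "b \<in> B" "c \<in> C" and "a' \<in> A" "b' \<in> B" "c' \<in> C"
    and "a + b + c = a' + b' + c'"
  shows "a = a'" and "b = b'" and "c = c'"
proof -
  have "(a - a') + (b - b') + (c - c') = 0"
    using assms(7) by (simp add: algebra_simps)
  then have "a - a' = 0 \<and> b - b' = 0 \<and> c - c' = 0"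
    using assms by (intro direct subspace_diff subspaces)
  then show "a = a'" "b = b'" "c = c'"
    by simp_all
qed

lemma part_in: "part_A x \<in> A" "part_B x \<in> B" "part_C x \<in> C"
  and part_sum: "part_A x + part_B x + part_C x = x"
proof -
  have "\<exists>p. case p of (a, b, c) \<Rightarrow> a \<in> A \<and> b \<in> B \<and> c \<in> C \<and> x = a + b + c"
    using exists_parts[of x] by auto
  then have "case parts x of (a, b, c) \<Rightarrow> a \<in> A \<and> b \<in> B \<and> c \<in> C \<and> x = a + b + c"
    unfolding parts_def by (rule someI_ex)
  then show "part_A x \<in> A" "part_B x \<in> B" "part_C x \<in> C" "part_A x + part_B x + part_C x = x"
    by (auto simp: part_A_def part_B_def part_C_def split: prod.splits)
qed

lemma part_eq:
  assumes "a \<in> A" "b \<in> B" "c \<in> C"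
  shows "part_A (a + b + c) = a" and "part_B (a + b + c) = b" and "part_C (a + b + c) = c"
  using parts_unique[OF part_in assms part_sum] by simp_all

lemma part_on:
  shows "a \<in> A \<Longrightarrow> part_A a = a \<and> part_B a = 0 \<and> part_C a = 0"
    and "b \<in> B \<Longrightarrow> part_A b = 0 \<and> part_B b = b \<and> part_C b = 0"
    and "c \<in> C \<Longrightarrow> part_A c = 0 \<and> part_B c = 0 \<and> part_C c = c"
  using part_eq[of a 0 0] part_eq[of 0 b 0] part_eq[of 0 0 c] subspaces
  by (simp_all add: subspace_0)

lemma linear_parts: "linear part_A" "linear part_B" "linear part_C"
proof -
  have add: "part_A (x + y) = part_A x + part_A y \<and> part_B (x + y) = part_B x + part_B y \<and>
      part_C (x + y) = part_C x + part_C y" for x y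
  proof -
    have "part_A (x + y) + part_B (x + y) + part_C (x + y) =
        (part_A x + part_B x + part_C x) + (part_A y + part_B y + part_C y)"
      by (simp only: part_sum)
    also have "\<dots> = (part_A x + part_A y) + (part_B x + part_B y) + (part_C x + part_C y)"
      by (simp only: ac_simps)
    finally have eq: "part_A (x + y) + part_B (x + y) + part_C (x + y) =
        (part_A x + part_A y) + (part_B x + part_B y) + (part_C x + part_C y)" .
    have mem: "part_A x + part_A y \<in> A" "part_B x + part_B y \<in> B" "part_C x + part_C y \<in> C"
      by (intro subspace_add subspaces part_in)+
    show ?thesis
      using parts_unique[OF part_in mem eq] by blast
  qed
  have scale: "part_A (k *\<^sub>R x) = k *\<^sub>R part_A x \<and> part_B (k *\<^sub>R x) = k *\<^sub>R part_B x \<and>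
      part_C (k *\<^sub>R x) = k *\<^sub>R part_C x" for k x
  proof -
    have "part_A (k *\<^sub>R x) + part_B (k *\<^sub>R x) + part_C (k *\<^sub>R x) =
        k *\<^sub>R (part_A x + part_B x + part_C x)"
      by (simp only: part_sum)
    then have eq: "part_A (k *\<^sub>R x) + part_B (k *\<^sub>R x) + part_C (k *\<^sub>R x) =
        k *\<^sub>R part_A x + k *\<^sub>R part_B x + k *\<^sub>R part_C x"
      by (simp only: scaleR_right_distrib)
    have mem: "k *\<^sub>R part_A x \<in> A" "k *\<^sub>R part_B x \<in> B" "k *\<^sub>R part_C x \<in> C"
      by (intro subspace_scale subspaces part_in)+
    show ?thesis
      using parts_unique[OF part_in mem eq] by blast
  qed
  show "linear part_A" "linear part_B" "linear part_C"
    using add scale by (auto intro: linearI)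
qed

text \<open>For the splitting given by a frame, this explicit formula is the frame form.\<close>

definition split_form :: "('a \<Rightarrow> real) \<Rightarrow> 'a \<Rightarrow> real" where
  "split_form N x = N (part_A x) + N (part_B x) + N (part_C x)"

end

locale pos_splitting = splitting A B C + N: pos_form N
  for A B C :: "'a::real_vector set" and N :: "'a \<Rightarrow> real"
begin

abbreviation M :: "'a \<Rightarrow> real" where
  "M \<equiv> split_form N"

lemma M_quadratic: "quadratic_form M" and polar_M: "polar M = (\<lambda>x y.
    polar N (part_A x) (part_A y) + polar N (part_B x) (part_B y) + polar N (part_C x) (part_C y))"
proof -
  let ?b = "\<lambda>x y. polar N (part_A x) (part_A y) + polar N (part_B x) (part_B y) + polar N (part_C x) (part_C y)"
  have "bilinear ?b"
    unfolding bilinear_def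
    by (auto intro!: linearI
        simp: linear_add[OF linear_parts(1)] linear_add[OF linear_parts(2)] linear_add[OF linear_parts(3)]
          linear_scale[OF linear_parts(1)] linear_scale[OF linear_parts(2)] linear_scale[OF linear_parts(3)]
          N.polar_simps algebra_simps)
  moreover have "?b x y = ?b y x" for x y
    by (simp add: polar_commute)
  moreover have "M x = ?b x x" for x
    by (simp add: split_form_def)
  ultimately show "quadratic_form M" "polar M = ?b"
    by (rule quadratic_formI)+
qed

sublocale M: pos_form M
proof
  show "quadratic_form M"
    by (rule M_quadratic)
  show "pos_def_on M UNIV"
    unfolding pos_def_on_def
  proof (intro ballI impI)
    fix x :: 'a
    assume "x \<noteq> 0"
    then have "part_A x \<noteq> 0 \<or> part_B x \<noteq> 0 \<or> part_C x \<noteq> 0"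
      using part_sum[of x] by auto
    then have "N (part_A x) \<noteq> 0 \<or> N (part_B x) \<noteq> 0 \<or> N (part_C x) \<noteq> 0"
      by simp
    then show "0 < M x"
      unfolding split_form_def
      using N.form_nonneg[of "part_A x"] N.form_nonneg[of "part_B x"] N.form_nonneg[of "part_C x"]
      by linarith
  qed
qed

lemma M_on: "x \<in> A \<union> B \<union> C \<Longrightarrow> M x = N x"
  using part_on[of x] by (auto simp: split_form_def)

lemma M_orthogonal:
  "orthogonal_wrt M A B" "orthogonal_wrt M A C" "orthogonal_wrt M B C"
  using part_on by (auto simp: orthogonal_wrt_def polar_M)

text \<open>Orthogonality reduces \<open>M'\<close> to its values on the three parts. Together with
  \<open>M_orthogonal\<close> and \<open>M_on\<close> this evaluates the definite description in
  \<open>frame_form\<close>.\<close>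

lemma M_unique:
  assumes "quadratic_form M'" "orthogonal_wrt M' A B" "orthogonal_wrt M' A C" "orthogonal_wrt M' B C"
    and "\<And>x. x \<in> A \<union> B \<union> C \<Longrightarrow> M' x = N x"
  shows "M' = M"
proof
  fix x
  interpret M': quad_form M'
    by (rule quad_form.intro) fact
  have "M' x = M' (part_A x + part_B x + part_C x)"
    by (simp only: part_sum)
  also have "\<dots> = M' (part_A x) + M' (part_B x) + M' (part_C x)"
    using assms(2-4) part_in by (simp add: M'.form_add M'.polar_simps orthogonal_wrt_def)
  also have "\<dots> = M x"
    using assms(5) part_in by (simp add: split_form_def)
  finally show "M' x = M x" .
qed

text \<open>The factor 3 is the number of parts, from the Cauchy-Schwarz inequality for the sum of
  their lengths.\<close>

lemma N_le_3_M: "N x \<le> 3 * M x"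
proof -
  let ?a = "sqrt (N (part_A x))" and ?b = "sqrt (N (part_B x))" and ?c = "sqrt (N (part_C x))"
  have "sqrt (N x) = sqrt (N (part_A x + part_B x + part_C x))"
    by (simp only: part_sum)
  also have "\<dots> \<le> ?a + ?b + ?c"
    using N.form_triangle[of "part_A x + part_B x" "part_C x"] N.form_triangle[of "part_A x" "part_B x"]
    by linarith
  finally have "(sqrt (N x))\<^sup>2 \<le> (?a + ?b + ?c)\<^sup>2"
    by (rule power_mono) simp
  also have "\<dots> \<le> 3 * (?a\<^sup>2 + ?b\<^sup>2 + ?c\<^sup>2)"
    using zero_le_power2[of "?a - ?b"] zero_le_power2[of "?a - ?c"] zero_le_power2[of "?b - ?c"]
    by (simp add: power2_eq_square algebra_simps)
  finally show ?thesis
    by (simp add: split_form_def)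
qed

text \<open>Bounds on the two outer components suffice, since the middle one is what remains of
  \<open>x\<close>. The first term of the constant comes from the outer components, the second from
  the middle one.\<close>

lemma M_le_N:
  assumes "0 < \<mu>" and "\<mu> * sqrt (N (part_A x)) \<le> sqrt (N x)" and "\<mu> * sqrt (N (part_C x)) \<le> sqrt (N x)"
  shows "M x \<le> (2 / \<mu>\<^sup>2 + (1 + 2 / \<mu>)\<^sup>2) * N x"
proof -
  let ?n = "sqrt (N x)"
  have a: "sqrt (N (part_A x)) \<le> ?n / \<mu>" and c: "sqrt (N (part_C x)) \<le> ?n / \<mu>"
    using assms by (simp_all add: pos_le_divide_eq mult.commute)
  have "part_B x = x - (part_A x + part_C x)"
    using part_sum[of x] by (metis add.commute add.assoc add_diff_cancel_left')
  then have "sqrt (N (part_B x)) \<le> ?n + (sqrt (N (part_A x)) + sqrt (N (part_C x)))"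
    using N.form_triangle_diff[of x "part_A x + part_C x"] N.form_triangle[of "part_A x" "part_C x"]
    by simp
  also have "\<dots> \<le> ?n + (?n / \<mu> + ?n / \<mu>)"
    using a c by linarith
  also have "\<dots> = (1 + 2 / \<mu>) * ?n"
    by (simp add: field_simps)
  finally have "(sqrt (N (part_B x)))\<^sup>2 \<le> ((1 + 2 / \<mu>) * ?n)\<^sup>2"
    by (rule power_mono) simp
  then have "N (part_B x) \<le> (1 + 2 / \<mu>)\<^sup>2 * N x"
    by (simp only: power_mult_distrib real_sqrt_pow2 N.form_nonneg)
  moreover have "(sqrt (N (part_A x)))\<^sup>2 \<le> (?n / \<mu>)\<^sup>2" "(sqrt (N (part_C x)))\<^sup>2 \<le> (?n / \<mu>)\<^sup>2"
    by (rule power_mono[OF a] power_mono[OF c], simp)+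
  then have "N (part_A x) \<le> 1 / \<mu>\<^sup>2 * N x" "N (part_C x) \<le> 1 / \<mu>\<^sup>2 * N x"
    by (simp_all add: power_divide)
  ultimately have "M x \<le> 1 / \<mu>\<^sup>2 * N x + (1 + 2 / \<mu>)\<^sup>2 * N x + 1 / \<mu>\<^sup>2 * N x"
    unfolding split_form_def by linarith
  then show ?thesis
    by (simp add: distrib_right)
qed

end

text \<open>Between \<open>M\<close>-unit vectors an angle below \<delta> means a chord of squared
  length below \<open>2 * (1 - cos \<delta>)\<close>. The chord grows by at most the factor 3 in
  \<open>N\<close>, while the vectors have \<open>N\<close>-value at least
  \<open>1 / \<kappa>\<close>. Turning the chord back into an angle gives the condition on
  \<eta>.\<close>

lemma angle_comparison:
  assumes "pos_form N" and "pos_form M" and "\<And>x. N x \<le> 3 * M x" and "\<And>x. M x \<le> \<kappa> * N x"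
    and "0 < \<kappa>" and "0 \<le> \<delta>" and "\<delta> \<le> pi" and "0 \<le> \<eta>" and "\<eta> \<le> pi"
    and "3 * \<kappa> * (1 - cos \<delta>) \<le> 1 - cos \<eta>"
    and "x \<noteq> 0" and "y \<noteq> 0" and "angle M x y < \<delta>"
  shows "angle N x y < \<eta>"
proof -
  interpret N: pos_form N by fact
  interpret M: pos_form M by fact
  define x' y' where "x' = (1 / sqrt (M x)) *\<^sub>R x" and "y' = (1 / sqrt (M y)) *\<^sub>R y"
  have pos: "0 < 1 / sqrt (M x)" "0 < 1 / sqrt (M y)"
    using assms(11,12) by (simp_all add: M.form_pos)
  have ne: "x' \<noteq> 0" "y' \<noteq> 0"
    using pos assms(11,12) by (auto simp: x'_def y'_def)
  have unit: "M x' = 1" "M y' = 1"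
    using assms(11,12) by (simp_all add: x'_def y'_def M.form_scale power_one_over)
  have "angle M x' y' < \<delta>"
    using assms(13) pos by (simp add: x'_def y'_def M.angle_scale_left M.angle_scale_right)
  then have "cos \<delta> < polar M x' y'"
    using M.angle_less_iff[OF ne assms(6,7)] unit by simp
  then have "M (x' - y') < 2 * (1 - cos \<delta>)"
    by (simp add: M.form_diff unit)
  then have diff: "N (x' - y') < 6 * (1 - cos \<delta>)"
    using assms(3)[of "x' - y'"] by linarith
  let ?p = "sqrt (N x') * sqrt (N y')"
  have "1 \<le> \<kappa> * N x'" "1 \<le> \<kappa> * N y'"
    using assms(4)[of x'] assms(4)[of y'] by (simp_all add: unit)
  then have "1 * 1 \<le> (\<kappa> * N x') * (\<kappa> * N y')"
    by (intro mult_mono) auto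
  then have "1\<^sup>2 \<le> (\<kappa> * ?p)\<^sup>2"
    by (simp add: power_mult_distrib) (simp add: power2_eq_square mult.commute mult.left_commute)
  then have "1 \<le> \<kappa> * ?p"
    using assms(5) by (intro power2_le_imp_le[of 1]) auto
  have "2 * polar N x' y' = N x' + N y' - N (x' - y')"
    by (simp add: N.form_diff)
  also have "N x' + N y' \<ge> 2 * ?p"
    using zero_le_power2[of "sqrt (N x') - sqrt (N y')"] by (simp add: power2_diff)
  then have "N x' + N y' - N (x' - y') > 2 * ?p - 6 * (1 - cos \<delta>)"
    using diff by linarith
  finally have "polar N x' y' > ?p - 3 * (1 - cos \<delta>)"
    by simp
  moreover have "3 * (1 - cos \<delta>) * 1 \<le> 3 * (1 - cos \<delta>) * (\<kappa> * ?p)"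
    using \<open>1 \<le> \<kappa> * ?p\<close> by (intro mult_left_mono) auto
  moreover have "(3 * \<kappa> * (1 - cos \<delta>)) * ?p \<le> (1 - cos \<eta>) * ?p"
    using assms(10) by (intro mult_right_mono) auto
  ultimately have "cos \<eta> * ?p < polar N x' y'"
    by (simp add: algebra_simps)
  then have "angle N x' y' < \<eta>"
    using N.angle_less_iff[OF ne assms(8,9)] by simp
  then show ?thesis
    using pos by (simp add: x'_def y'_def N.angle_scale_left N.angle_scale_right)
qed

section \<open>Contraction of cones\<close>

text \<open>One step of the dynamics: \<open>g\<close> contracts \<open>A\<close>, fixes the line
  \<open>B\<close> and expands \<open>C\<close>. A generator is an instance, and so is its inverse,
  with \<open>A\<close> and \<open>C\<close> exchanged and \<open>e\<close> replaced by
  \<open>- e\<close>.\<close>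

locale cone_contraction = pos_form M
  for M :: "'a::real_vector \<Rightarrow> real" +
  fixes A B C :: "'a set" and e :: 'a and g :: "'a \<Rightarrow> 'a" and s \<theta> :: real
  assumes parts: "\<And>x. \<exists>a\<in>A. \<exists>b\<in>B. \<exists>c\<in>C. x = a + b + c"
    and minus_mem: "\<And>a. a \<in> A \<Longrightarrow> - a \<in> A"
    and orthogonal: "orthogonal_wrt M A B" "orthogonal_wrt M A C" "orthogonal_wrt M B C"
    and middle: "\<And>b. b \<in> B \<Longrightarrow> \<exists>\<beta>. b = \<beta> *\<^sub>R e"
    and linear: "linear g"
    and g_A: "\<And>a. a \<in> A \<Longrightarrow> g a \<in> A \<and> M (g a) \<le> s\<^sup>2 * M a"
    and g_B: "\<And>b. b \<in> B \<Longrightarrow> g b = b"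
    and g_C: "\<And>c. c \<in> C \<Longrightarrow> g c \<in> C \<and> M c \<le> s\<^sup>2 * M (g c)"
    and s_pos: "0 < s" and s_small: "s < (sin \<theta>)\<^sup>2"
    and \<theta>: "0 < \<theta>" "\<theta> \<le> pi / 2"
begin

definition repelling_wing :: "'a set" where
  "repelling_wing = {a + x *\<^sub>R e |a x. a \<in> A \<and> 0 \<le> x}"

definition attracting_wing :: "'a set" where
  "attracting_wing = {c + x *\<^sub>R (- e) |c x. c \<in> C \<and> 0 \<le> x}"

lemma s_less_1: "s < 1"
  using s_small sin_le_one[of \<theta>] sin_ge_minus_one[of \<theta>] abs_square_le_1[of "sin \<theta>"] by linarith

text \<open>An angle of at least \<theta> with \<open>p\<close> leaves \<open>p\<close> at most the
  share \<open>(cos \<theta>)\<^sup>2\<close> of \<open>M x\<close>; the rest belongs to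
  \<open>q\<close>.\<close>

lemma far_from_orthogonal_part:
  assumes "x = p + q" and "polar M p q = 0" and "p \<noteq> 0 \<Longrightarrow> \<theta> \<le> angle M x p"
  shows "(sin \<theta>)\<^sup>2 * M x \<le> M q"
proof -
  have sum: "M x = M p + M q"
    by (simp add: assms form_add)
  have "M p \<le> (cos \<theta>)\<^sup>2 * M x"
    using angle_less_orthogonal_iff[of p q \<theta>] assms \<theta> by (cases "p = 0") auto
  then show ?thesis
    using sum by (simp add: sin_squared_eq algebra_simps)
qed

text \<open>The number \<open>X\<close> is an auxiliary scale between \<open>M q\<close> and
  \<open>M p\<close>. The hypothesis \<open>s < (sin \<theta>)\<^sup>2\<close> is spent twice, once
  on each side of it, and yields \<open>M q < (sin \<theta>)\<^sup>2 * M p\<close>.\<close>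

lemma near_orthogonal_part:
  assumes "x = p + q" and "polar M p q = 0" and "0 < X" and "(sin \<theta>)\<^sup>2 * X \<le> s * M p" and "M q \<le> s * X"
  shows "p \<noteq> 0 \<and> angle M x p < \<theta>"
proof -
  have sin2: "0 < (sin \<theta>)\<^sup>2"
    using \<theta> sin_gt_zero[of \<theta>] by simp
  have "0 < s * M p"
    using assms(3,4) sin2 by (meson less_le_trans mult_pos_pos)
  then have "0 < M p"
    using s_pos by (simp add: zero_less_mult_iff)
  then have "p \<noteq> 0"
    by auto
  have "M q \<le> s * X"
    by fact
  also have "\<dots> < (sin \<theta>)\<^sup>2 * X"
    using s_small assms(3) by simp
  also have "\<dots> \<le> s * M p"
    by fact
  also have "\<dots> < (sin \<theta>)\<^sup>2 * M p"
    using s_small \<open>0 < M p\<close> by simp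
  finally have "M q < (sin \<theta>)\<^sup>2 * M p" .
  moreover have "0 \<le> (sin \<theta>)\<^sup>2 * M q"
    by simp
  moreover have "(cos \<theta>)\<^sup>2 * M (p + q) = M p + M q - (sin \<theta>)\<^sup>2 * M p - (sin \<theta>)\<^sup>2 * M q"
    by (simp add: form_add assms(2) cos_squared_eq algebra_simps)
  ultimately have "(cos \<theta>)\<^sup>2 * M (p + q) < M p"
    by linarith
  then show ?thesis
    using \<open>p \<noteq> 0\<close> angle_less_orthogonal_iff[OF \<open>p \<noteq> 0\<close> assms(2)] \<theta> assms(1) by simp
qed

lemma expanding_part:
  assumes "\<And>y. y \<in> repelling_wing \<Longrightarrow> y \<noteq> 0 \<Longrightarrow> \<theta> \<le> angle M x y"
    and "x = a + b + c" "a \<in> A" "b \<in> B" "c \<in> C" "b = \<beta> *\<^sub>R e" "0 \<le> \<beta>"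
  shows "(sin \<theta>)\<^sup>2 * M x \<le> M c"
proof (rule far_from_orthogonal_part)
  show "x = (a + b) + c"
    by (simp add: assms)
  have "polar M a c = 0" "polar M b c = 0"
    using orthogonal assms(3-5) by (auto simp: orthogonal_wrt_def)
  then show "polar M (a + b) c = 0"
    by (simp add: polar_simps)
  show "\<theta> \<le> angle M x (a + b)" if "a + b \<noteq> 0"
    using assms that by (auto simp: repelling_wing_def)
qed

text \<open>
  The two cases are those of a middle component on the repelling side, when \<open>x\<close> has a substantial
  expanding component, and on the attracting side, when it is enough that \<open>g\<close> shrinks the
  contracting one.
\<close>

lemma maps_to_attracting_cone:
  assumes "x \<noteq> 0" and far: "\<And>y. y \<in> repelling_wing \<Longrightarrow> y \<noteq> 0 \<Longrightarrow> \<theta> \<le> angle M x y"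
  shows "\<exists>y\<in>attracting_wing - {0}. angle M (g x) y < \<theta>"
proof -
  obtain a b c where x: "x = a + b + c" "a \<in> A" "b \<in> B" "c \<in> C"
    using parts by blast
  obtain \<beta> where \<beta>: "b = \<beta> *\<^sub>R e"
    using middle x(3) by blast
  have gx: "g x = g a + b + g c"
    using x g_B by (simp add: linear_add[OF linear])
  have mem: "g a \<in> A" "g c \<in> C" and bounds: "M (g a) \<le> s\<^sup>2 * M a" "M c \<le> s\<^sup>2 * M (g c)"
    using g_A g_C x by auto
  have orth: "polar M a b = 0" "polar M a c = 0" "polar M b c = 0"
    "polar M (g a) b = 0" "polar M (g a) (g c) = 0" "polar M b (g c) = 0"
    using orthogonal mem x by (auto simp: orthogonal_wrt_def)
  have Mx: "M x = M a + M b + M c"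
    using x(1) orth by (simp add: form_add polar_simps)
  have "0 < M x"
    using assms(1) by (simp add: form_pos)
  have s2: "s\<^sup>2 \<le> s" "s\<^sup>2 \<le> 1"
    using s_pos s_less_1 by (simp_all add: power2_eq_square mult_le_cancel_left1 mult_le_one)
  have Mga: "M (g a) \<le> s * M a"
    using bounds(1) s2(1) mult_right_mono[of "s\<^sup>2" s "M a"] by simp
  show ?thesis
  proof (cases "0 \<le> \<beta>")
    case True
    have "(sin \<theta>)\<^sup>2 * M x \<le> M c"
      using expanding_part[OF far x \<beta> True] by blast
    also have "\<dots> \<le> s * (s * M (g c))"
      using bounds(2) by (simp add: power2_eq_square)
    finally have "s * ((sin \<theta>)\<^sup>2 * (M x / s)) \<le> s * (s * M (g c))"
      using s_pos by simp
    then have "(sin \<theta>)\<^sup>2 * (M x / s) \<le> s * M (g c)"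
      using s_pos by (simp only: mult_le_cancel_left_pos)
    moreover have "M (g a + b) \<le> s * (M x / s)"
    proof -
      have "M (g a + b) = M (g a) + M b" "s * (M x / s) = M x" "s * M a \<le> M a"
        using orth s_pos s_less_1 mult_right_mono[of s 1 "M a"] by (simp_all add: form_add)
      then show ?thesis
        using Mx Mga form_nonneg[of c] by linarith
    qed
    \<comment> \<open>The rest is at most \<open>M x\<close>, while the expanding component is at
      least \<open>(sin \<theta>)\<^sup>2 * M x / s\<^sup>2\<close>; the scale
      \<open>M x / s\<close> lies in the geometric middle.\<close>
    ultimately have "g c \<noteq> 0 \<and> angle M (g x) (g c) < \<theta>"
      using gx orth \<open>0 < M x\<close> s_pos
      by (intro near_orthogonal_part[where q = "g a + b" and X = "M x / s"])
         (simp_all add: polar_simps polar_commute[of M "g c"] algebra_simps)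
    moreover have "g c \<in> attracting_wing"
      using mem(2) unfolding attracting_wing_def by (intro CollectI exI[of _ "g c"] exI[of _ 0]) simp
    ultimately show ?thesis
      by blast
  next
    case False
    have "(sin \<theta>)\<^sup>2 * M x \<le> M (b + c)"
    proof (rule far_from_orthogonal_part)
      show "x = a + (b + c)" "polar M a (b + c) = 0"
        using x orth by (simp_all add: polar_simps)
      have "a \<in> repelling_wing"
        using x(2) unfolding repelling_wing_def by (intro CollectI exI[of _ a] exI[of _ 0]) simp
      then show "\<theta> \<le> angle M x a" if "a \<noteq> 0"
        using far that by blast
    qed
    also have "\<dots> \<le> M (b + g c)"
      using orth bounds(2) s2(2) mult_right_mono[of "s\<^sup>2" 1 "M (g c)"] by (simp add: form_add)
    finally have main: "(sin \<theta>)\<^sup>2 * M x \<le> M (b + g c)" .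
    have "M (g a) \<le> s * (s * M x)"
      using bounds(1) Mx mult_left_mono[of "M a" "M x" "s\<^sup>2"] by (simp add: power2_eq_square mult.assoc)
    moreover have "(sin \<theta>)\<^sup>2 * (s * M x) \<le> s * M (b + g c)"
      using mult_left_mono[OF main, of s] s_pos by (simp add: mult.left_commute)
    \<comment> \<open>Here the contracted component is at most \<open>s\<^sup>2 * M x\<close> and
      the rest at least \<open>(sin \<theta>)\<^sup>2 * M x\<close>, which makes
      \<open>s * M x\<close> the scale.\<close>
    ultimately have "b + g c \<noteq> 0 \<and> angle M (g x) (b + g c) < \<theta>"
      using gx orth \<open>0 < M x\<close> s_pos
      by (intro near_orthogonal_part[where q = "g a" and X = "s * M x"])
         (simp_all add: polar_simps polar_commute[of M _ "g a"] algebra_simps)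
    moreover have "b + g c \<in> attracting_wing"
      using mem(2) \<beta> False unfolding attracting_wing_def
      by (intro CollectI exI[of _ "g c"] exI[of _ "- \<beta>"]) simp
    ultimately show ?thesis
      by blast
  qed
qed

text \<open>One of \<open>x\<close> and \<open>- x\<close> has its middle component on the repelling
  side. As both are far from the repelling wing, the expanding component always has a substantial
  share, and \<open>g\<close> enlarges it.\<close>

lemma expands_away_from_repelling_cone:
  assumes "\<And>y. y \<in> repelling_wing \<Longrightarrow> y \<noteq> 0 \<Longrightarrow> \<theta> \<le> angle M x y"
    and "\<And>y. y \<in> repelling_wing \<Longrightarrow> y \<noteq> 0 \<Longrightarrow> \<theta> \<le> angle M (- x) y"
  shows "(sin \<theta>)\<^sup>2 * M x \<le> s\<^sup>2 * M (g x)"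
proof -
  obtain a b c where x: "x = a + b + c" "a \<in> A" "b \<in> B" "c \<in> C"
    using parts by blast
  obtain \<beta> where \<beta>: "b = \<beta> *\<^sub>R e"
    using middle x(3) by blast
  have "(sin \<theta>)\<^sup>2 * M x \<le> M c"
  proof (cases "0 \<le> \<beta>")
    case True
    then show ?thesis
      using expanding_part[OF assms(1) x \<beta>] by blast
  next
    case False
    show ?thesis
    proof (rule far_from_orthogonal_part)
      show "x = (a + b) + c"
        by (rule x)
      have "polar M a c = 0" "polar M b c = 0"
        using orthogonal x by (auto simp: orthogonal_wrt_def)
      then show "polar M (a + b) c = 0"
        by (simp add: polar_simps)
      have "- (a + b) \<in> repelling_wing"
        using minus_mem[OF x(2)] \<beta> False unfolding repelling_wing_def
        by (intro CollectI exI[of _ "- a"] exI[of _ "- \<beta>"]) simp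
      moreover have "angle M (- x) (- y) = angle M x y" for y
        by (simp add: angle_def polar_simps)
      ultimately show "\<theta> \<le> angle M x (a + b)" if "a + b \<noteq> 0"
        using assms(2) that by (metis neg_equal_0_iff_equal)
    qed
  qed
  also have "\<dots> \<le> s\<^sup>2 * M (g c)"
    using g_C x by blast
  also have "\<dots> \<le> s\<^sup>2 * M (g x)"
  proof (rule mult_left_mono)
    have "g x = g a + b + g c"
      using x g_B by (simp add: linear_add[OF linear])
    moreover have "polar M (g a) b = 0" "polar M (g a) (g c) = 0" "polar M b (g c) = 0"
      using orthogonal g_A g_C x by (auto simp: orthogonal_wrt_def)
    ultimately show "M (g c) \<le> M (g x)"
      by (simp add: form_add polar_simps)
  qed simp
  finally show ?thesis .
qed

end

section \<open>Frames and wings\<close>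

text \<open>The direction of a half-space over \<open>V\<close> matters only modulo \<open>V\<close>
  and up to a positive factor.\<close>

lemma half_space_change_direction:
  assumes "subspace V" and "a \<in> V" and "0 < c"
  shows "{v + x *\<^sub>R (a + c *\<^sub>R e) |v x. v \<in> V \<and> 0 \<le> x} = {v + x *\<^sub>R e |v x. v \<in> V \<and> 0 \<le> x}"
proof (intro equalityI subsetI; clarify)
  fix v and x :: real
  assume "v \<in> V" "0 \<le> x"
  then show "\<exists>w y. v + x *\<^sub>R (a + c *\<^sub>R e) = w + y *\<^sub>R e \<and> w \<in> V \<and> 0 \<le> y"
    using assms by (intro exI[of _ "v + x *\<^sub>R a"] exI[of _ "x * c"])
      (simp add: algebra_simps subspace_add subspace_scale)
  show "\<exists>w y. v + x *\<^sub>R e = w + y *\<^sub>R (a + c *\<^sub>R e) \<and> w \<in> V \<and> 0 \<le> y"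
    using assms \<open>v \<in> V\<close> \<open>0 \<le> x\<close> by (intro exI[of _ "v - (x / c) *\<^sub>R a"] exI[of _ "x / c"])
      (simp add: algebra_simps subspace_diff subspace_scale)
qed

section \<open>Wings, frame forms and admissible radii in the signature setting\<close>

locale wing_geometry = signature_form Q S "CARD('d::finite)"
  for Q :: "real ^ 'n \<Rightarrow> real" and S :: "(real ^ 'n) set" +
  fixes oV :: "(real ^ 'n) set \<Rightarrow> (real ^ 'n ^ 'd) set"
    and oP :: "(real ^ 'n) set \<Rightarrow> (real ^ 'n ^ 'd option) set"
  assumes orientations: "compatible_orientations Q oV oP"
begin

abbreviation wing :: "(real ^ 'n) set \<Rightarrow> (real ^ 'n) set" where
  "wing \<equiv> pos_wing Q oV oP"

lemma MTIS_isotropic: "MTIS Q V \<Longrightarrow> totally_isotropic Q V"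
  and MTIS_subspace: "MTIS Q V \<Longrightarrow> subspace V"
  by (auto simp: MTIS_def totally_isotropic_def)

text \<open>The dimension is read off from the orientation, whose direct bases are indexed by
  \<open>'d\<close>.\<close>

lemma MTIS_dim:
  assumes "MTIS Q V"
  shows "dim V = CARD('d)"
proof -
  have "orientation_of V (oV V)"
    using orientations assms by (simp add: compatible_orientations_def)
  then show ?thesis
    using ordered_basis_dim(2) by (auto simp: orientation_of_def)
qed

lemma wing_halfspace:
  assumes "MTIS Q V"
  obtains e where "e \<in> perp Q V" and "e \<notin> V"
    and "wing V = {v + x *\<^sub>R e |v x. v \<in> V \<and> 0 \<le> x}"
    and "perp Q V = {v + x *\<^sub>R e |v x. v \<in> V}"
proof (rule pos_wing_halfspace)
  show "orientation_of V (oV V)" "orientation_of (perp Q V) (oP V)"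
    using orientations assms by (simp_all add: compatible_orientations_def)
  show "V \<subseteq> perp Q V"
    by (rule isotropic_le_perp[OF MTIS_isotropic[OF assms]])
qed

lemma MTIS_le_wing:
  assumes "MTIS Q V"
  shows "V \<subseteq> wing V"
proof -
  obtain e where e: "wing V = {v + x *\<^sub>R e |v x. v \<in> V \<and> 0 \<le> x}"
    by (rule wing_halfspace[OF assms])
  show ?thesis
  proof
    fix v
    assume "v \<in> V"
    then have "v = v + 0 *\<^sub>R e \<and> v \<in> V \<and> 0 \<le> (0::real)"
      by simp
    then show "v \<in> wing V"
      unfolding e by blast
  qed
qed

lemma MTIS_nontrivial:
  assumes "MTIS Q V"
  obtains v where "v \<in> V" and "v \<noteq> 0"
proof -
  have "dim V \<noteq> 0"
    using MTIS_dim[OF assms] by simp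
  then show thesis
    using that by (auto simp: dim_eq_0)
qed

text \<open>The middle line is the orthogonal complement of the sum of the two sides. If
  \<open>a + c\<close> lies in both, then \<open>c\<close> is an isotropic vector orthogonal to
  \<open>fst F\<close>, hence in it by maximality, and transversality gives 0; likewise for
  \<open>a\<close>. So \<open>Q\<close> is nondegenerate on the sum and the complement splits
  off.\<close>

lemma frame_splitting:
  assumes "is_frame Q F"
  shows "splitting (fst F) (frame_mid Q F) (snd F)"
proof
  let ?A = "fst F" and ?B = "frame_mid Q F" and ?C = "snd F"
  have AC: "MTIS Q ?A" "MTIS Q ?C" "?A \<inter> ?C = {0}"
    using assms by (auto simp: is_frame_def transversal_def)
  show sub: "subspace ?A" "subspace ?C"
    using AC MTIS_subspace by auto
  show subB: "subspace ?B"
    unfolding frame_mid_def by (intro subspace_inter subspace_perp)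
  let ?X = "{a + c |a c. a \<in> ?A \<and> c \<in> ?C}"
  have inX: "?A \<subseteq> ?X" "?C \<subseteq> ?X"
    using subspace_0[OF sub(1)] subspace_0[OF sub(2)] by force+
  have perpX: "perp Q ?X = ?B"
  proof (intro equalityI subsetI)
    fix x
    assume "x \<in> perp Q ?X"
    then have "\<And>v. v \<in> ?X \<Longrightarrow> polar Q x v = 0"
      unfolding perp_def by blast
    then show "x \<in> ?B"
      using inX unfolding perp_def frame_mid_def by blast
  next
    fix x
    assume "x \<in> ?B"
    then show "x \<in> perp Q ?X"
      by (auto simp: perp_def frame_mid_def polar_simps)
  qed
  have trivial: "a = 0 \<and> c = 0" if "a \<in> ?A" "c \<in> ?C" "a + c \<in> ?B" for a c
  proof -
    have "a \<in> perp Q ?A" "c \<in> perp Q ?C"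
      using that isotropic_le_perp[OF MTIS_isotropic] AC(1,2) by auto
    moreover have "a + c \<in> perp Q ?A" "a + c \<in> perp Q ?C"
      using that(3) by (simp_all add: frame_mid_def)
    ultimately have "(a + c) - a \<in> perp Q ?A" "(a + c) - c \<in> perp Q ?C"
      by (simp_all only: subspace_diff[OF subspace_perp])
    moreover have "Q a = 0" "Q c = 0"
      using that AC MTIS_isotropic by (auto simp: totally_isotropic_def)
    ultimately have "c \<in> ?A" "a \<in> ?C"
      using MTIS_contains_isotropic AC(1,2) by simp_all
    then show ?thesis
      using that AC(3) by blast
  qed
  show "\<exists>a\<in>?A. \<exists>b\<in>?B. \<exists>c\<in>?C. x = a + b + c" for x
  proof -
    have "subspace ?X"
      by (rule subspace_sums[OF sub])
    moreover have "?X \<inter> perp Q ?X \<subseteq> {0}"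
      unfolding perpX using trivial by force
    ultimately obtain u b where "u \<in> ?X" "b \<in> perp Q ?X" "x = u + b"
      by (rule perp_complement[OF quadratic])
    then obtain a c where "a \<in> ?A" "c \<in> ?C" "b \<in> ?B" "x = (a + c) + b"
      unfolding perpX by blast
    moreover from this have "x = a + b + c"
      by (simp add: ac_simps)
    ultimately show ?thesis
      by blast
  qed
  show "a = 0 \<and> b = 0 \<and> c = 0" if "a \<in> ?A" "b \<in> ?B" "c \<in> ?C" "a + b + c = 0" for a b c
  proof -
    have "a + c = - b"
      using that(4) by (simp add: algebra_simps eq_neg_iff_add_eq_0)
    then have "a + c \<in> ?B"
      using that(2) subspace_neg[OF subB] by simp
    then show ?thesis
      using trivial[OF that(1,3)] that(4) by simp
  qed
qed

lemma frame_pos_splitting: "is_frame Q F \<Longrightarrow> pos_splitting (fst F) (frame_mid Q F) (snd F) N"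
  by (intro pos_splitting.intro frame_splitting N.pos_form_axioms)

lemma frame_form_eq:
  assumes "is_frame Q F"
  shows "frame_form Q S F = splitting.split_form (fst F) (frame_mid Q F) (snd F) N"
proof -
  interpret pos_splitting "fst F" "frame_mid Q F" "snd F" N
    by (rule frame_pos_splitting[OF assms])
  show ?thesis
    unfolding frame_form_def
  proof (rule the_equality)
    show "quadratic_form M \<and> pos_def_on M UNIV \<and> orthogonal_wrt M (fst F) (frame_mid Q F) \<and>
        orthogonal_wrt M (fst F) (snd F) \<and> orthogonal_wrt M (frame_mid Q F) (snd F) \<and>
        (\<forall>x \<in> fst F \<union> frame_mid Q F \<union> snd F. M x = N0 Q S x)"
      using M_quadratic M.pos_def M_orthogonal M_on by simp
  qed (use M_unique in blast)
qed

lemma polar_frame_parts: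
  assumes "is_frame Q F" and "a \<in> fst F" "b \<in> frame_mid Q F" "c \<in> snd F"
  shows "v \<in> snd F \<Longrightarrow> polar Q (a + b + c) v = polar Q a v"
    and "v \<in> fst F \<Longrightarrow> polar Q (a + b + c) v = polar Q c v"
proof -
  have iso: "totally_isotropic Q (fst F)" "totally_isotropic Q (snd F)"
    using assms(1) MTIS_isotropic by (auto simp: is_frame_def)
  show "v \<in> snd F \<Longrightarrow> polar Q (a + b + c) v = polar Q a v"
    using assms(3) isotropic_polar[OF iso(2) assms(4)] by (simp add: polar_simps frame_mid_def perp_def)
  show "v \<in> fst F \<Longrightarrow> polar Q (a + b + c) v = polar Q c v"
    using assms(3) isotropic_polar[OF iso(1) assms(2)] by (simp add: polar_simps frame_mid_def perp_def)
qed

text \<open>Against vectors of \<open>V\<close> the form \<open>Q\<close> sees only the component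
  \<open>a\<close> of \<open>x\<close>. By \<open>isotropic_pairing\<close> some vector of
  \<open>V\<close> detects a definite fraction of \<open>a\<close>, and \<open>polar_Q_le\<close>
  turns this into a lower bound for \<open>N x\<close>.\<close>

lemma isotropic_component_bound:
  assumes "MTIS Q V" and "Q a = 0" and "0 \<le> \<epsilon>" "\<epsilon> \<le> pi"
    and "\<And>v. v \<in> V \<Longrightarrow> v \<noteq> 0 \<Longrightarrow> a \<noteq> 0 \<Longrightarrow> \<epsilon> \<le> angle N a v"
    and "\<And>v. v \<in> V \<Longrightarrow> polar Q x v = polar Q a v"
  shows "(1 - cos \<epsilon>) * sqrt (N a) \<le> sqrt (N x)"
proof (cases "a = 0")
  case False
  obtain v where v: "v \<in> V" "v \<noteq> 0" "(1 - cos \<epsilon>) * (sqrt (N a) * sqrt (N v)) \<le> \<bar>polar Q a v\<bar>"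
    by (rule isotropic_pairing[OF MTIS_isotropic[OF assms(1)] MTIS_dim[OF assms(1)] assms(2) False assms(3,4)])
      (use assms(5) False in blast)
  have "\<bar>polar Q a v\<bar> \<le> sqrt (N x) * sqrt (N v)"
    using polar_Q_le[of x v] assms(6)[OF v(1)] by simp
  with v(3) have "((1 - cos \<epsilon>) * sqrt (N a)) * sqrt (N v) \<le> sqrt (N x) * sqrt (N v)"
    by (simp add: mult.assoc[symmetric])
  then show ?thesis
    using N.form_pos[OF v(2)] by (subst (asm) mult_le_cancel_right_pos) simp_all
qed simp

text \<open>The constant of \<open>M_le_N\<close> for \<mu> = 1 - cos \<epsilon>. It depends on the
  separation only, not on the frame.\<close>

definition \<kappa> :: "real \<Rightarrow> real" where
  "\<kappa> \<epsilon> = 2 / (1 - cos \<epsilon>)\<^sup>2 + (1 + 2 / (1 - cos \<epsilon>))\<^sup>2"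

lemma cos_less_1: "0 < \<epsilon> \<Longrightarrow> \<epsilon> \<le> pi \<Longrightarrow> cos \<epsilon> < 1"
  using cos_monotone_0_pi[of 0 \<epsilon>] by simp

lemma \<kappa>_pos:
  assumes "0 < \<epsilon>" "\<epsilon> \<le> pi"
  shows "0 < \<kappa> \<epsilon>"
  using cos_less_1[OF assms] unfolding \<kappa>_def by (intro add_pos_nonneg) simp_all

text \<open>For the second bound, the component in each side of the frame is tested against the
  opposite side.\<close>

lemma frame_form_comparison:
  assumes F: "is_frame Q F" and \<epsilon>: "0 < \<epsilon>" "\<epsilon> \<le> pi"
    and sep: "\<And>x y. x \<in> fst F \<Longrightarrow> y \<in> snd F \<Longrightarrow> x \<noteq> 0 \<Longrightarrow> y \<noteq> 0 \<Longrightarrow> \<epsilon> \<le> angle N x y"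
  shows "N x \<le> 3 * frame_form Q S F x" and "frame_form Q S F x \<le> \<kappa> \<epsilon> * N x"
proof -
  interpret pos_splitting "fst F" "frame_mid Q F" "snd F" N
    by (rule frame_pos_splitting[OF F])
  have MT: "MTIS Q (fst F)" "MTIS Q (snd F)"
    using F by (auto simp: is_frame_def)
  have Q0: "Q (part_A x) = 0" "Q (part_C x) = 0"
    using part_in MTIS_isotropic[OF MT(1)] MTIS_isotropic[OF MT(2)] by (auto simp: totally_isotropic_def)
  show "N x \<le> 3 * frame_form Q S F x"
    using N_le_3_M by (simp add: frame_form_eq[OF F])
  have "(1 - cos \<epsilon>) * sqrt (N (part_A x)) \<le> sqrt (N x)"
  proof (rule isotropic_component_bound[OF MT(2) Q0(1)])
    show "polar Q x v = polar Q (part_A x) v" if "v \<in> snd F" for v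
      using polar_frame_parts(1)[OF F part_in that, of x x x] by (simp add: part_sum)
  qed (use \<epsilon> sep part_in in auto)
  moreover have "(1 - cos \<epsilon>) * sqrt (N (part_C x)) \<le> sqrt (N x)"
  proof (rule isotropic_component_bound[OF MT(1) Q0(2)])
    show "polar Q x v = polar Q (part_C x) v" if "v \<in> fst F" for v
      using polar_frame_parts(2)[OF F part_in that, of x x x] by (simp add: part_sum)
    show "\<epsilon> \<le> angle N (part_C x) v" if "v \<in> fst F" "v \<noteq> 0" "part_C x \<noteq> 0" for v
      using sep[OF that(1) part_in(3) that(2,3)] by (simp add: N.angle_commute)
  qed (use \<epsilon> in auto)
  ultimately show "frame_form Q S F x \<le> \<kappa> \<epsilon> * N x"
    using M_le_N[of "1 - cos \<epsilon>"] cos_less_1[OF \<epsilon>] by (simp add: frame_form_eq[OF F] \<kappa>_def)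
qed

lemma frame_form_pos: "is_frame Q F \<Longrightarrow> pos_form (frame_form Q S F)"
proof -
  assume F: "is_frame Q F"
  interpret pos_splitting "fst F" "frame_mid Q F" "snd F" N
    by (rule frame_pos_splitting[OF F])
  show ?thesis
    unfolding frame_form_eq[OF F] by (rule M.pos_form_axioms)
qed

text \<open>The inclusion of balls around arbitrary sets is applied to a single ray, where it
  compares two angles.\<close>

lemma admissible_radius_angle:
  assumes F: "is_frame Q F" and "admissible_radius Q S \<epsilon> F r"
    and "x \<noteq> 0" "y \<noteq> 0" "angle (frame_form Q S F) x y < r"
  shows "angle N x y < \<epsilon> / 3"
proof -
  interpret M: pos_form "frame_form Q S F"
    by (rule frame_form_pos[OF F])
  have sub: "{ray y} \<subseteq> ray_sphere"
    using assms(4) by (simp add: ray_in_sphere)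
  have "ray x \<in> ball_S (frame_form Q S F) {ray y} r"
    using assms(3-5) by (auto simp: M.ray_in_ball_S[OF _ sub])
  then have "ray x \<in> ball_S N {ray y} (\<epsilon> / 3)"
    using assms(2) sub unfolding admissible_radius_def by blast
  then obtain y' where y': "ray y' = ray y" "y' \<noteq> 0" "angle N x y' < \<epsilon> / 3"
    using assms(3) by (auto simp: N.ray_in_ball_S[OF _ sub])
  have "y' \<in> ray y'"
    using y'(2) by (auto simp: mem_ray_iff intro!: exI[of _ 1])
  then obtain c where "0 < c" "y' = c *\<^sub>R y"
    unfolding y'(1) by (auto simp: mem_ray_iff)
  then show ?thesis
    using y'(3) by (simp add: N.angle_scale_right)
qed

text \<open>All frame forms of \<epsilon>-separated frames are comparable to \<open>N\<close> with
  the same constants 3 and \<open>\<kappa> \<epsilon>\<close>, so one radius serves for all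
  frames.\<close>

lemma uniform_admissible_radius:
  assumes \<epsilon>: "0 < \<epsilon>" "\<epsilon> \<le> pi"
  obtains \<delta> where "0 < \<delta>" and "\<And>F. is_frame Q F \<Longrightarrow>
    (\<And>x y. x \<in> fst F \<Longrightarrow> y \<in> snd F \<Longrightarrow> x \<noteq> 0 \<Longrightarrow> y \<noteq> 0 \<Longrightarrow> \<epsilon> \<le> angle N x y) \<Longrightarrow>
    admissible_radius Q S \<epsilon> F \<delta>"
proof -
  have cos: "cos (\<epsilon> / 3) < 1"
    using \<epsilon> by (intro cos_less_1) auto
  \<comment> \<open>The number \<tau> is \<open>1 - cos \<delta>\<close>. The second argument of
    \<open>min\<close> is the requirement of \<open>angle_comparison\<close> with \<eta> =
    \<epsilon> / 3; the first keeps \<open>1 - \<tau>\<close> in the domain of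
    \<open>arccos\<close>.\<close>
  define \<tau> where "\<tau> = min 1 ((1 - cos (\<epsilon> / 3)) / (3 * \<kappa> \<epsilon>))"
  have \<tau>: "0 < \<tau>" "\<tau> \<le> 1" "3 * \<kappa> \<epsilon> * \<tau> \<le> 1 - cos (\<epsilon> / 3)"
  proof -
    show "0 < \<tau>" "\<tau> \<le> 1"
      using cos \<kappa>_pos[OF \<epsilon>] by (simp_all add: \<tau>_def)
    have "\<tau> \<le> (1 - cos (\<epsilon> / 3)) / (3 * \<kappa> \<epsilon>)"
      by (simp add: \<tau>_def)
    then show "3 * \<kappa> \<epsilon> * \<tau> \<le> 1 - cos (\<epsilon> / 3)"
      using \<kappa>_pos[OF \<epsilon>] by (simp add: pos_le_divide_eq mult.commute)
  qed
  define \<delta> where "\<delta> = arccos (1 - \<tau>)"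
  have \<delta>: "cos \<delta> = 1 - \<tau>" "0 \<le> \<delta>" "\<delta> \<le> pi"
    using \<tau> by (simp_all add: \<delta>_def cos_arccos arccos_lbound arccos_ubound)
  have "\<delta> \<noteq> 0"
    using \<delta>(1) \<tau>(1) by auto
  show thesis
  proof (rule that)
    show "0 < \<delta>"
      using \<open>\<delta> \<noteq> 0\<close> \<delta>(2) by simp
    fix F
    assume F: "is_frame Q F"
      and sep: "\<And>x y. x \<in> fst F \<Longrightarrow> y \<in> snd F \<Longrightarrow> x \<noteq> 0 \<Longrightarrow> y \<noteq> 0 \<Longrightarrow> \<epsilon> \<le> angle N x y"
    interpret M: pos_form "frame_form Q S F"
      by (rule frame_form_pos[OF F])
    show "admissible_radius Q S \<epsilon> F \<delta>"
      unfolding admissible_radius_def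
    proof (intro conjI allI impI subsetI)
      show "0 < \<delta>"
        using \<open>\<delta> \<noteq> 0\<close> \<delta>(2) by simp
      fix X p
      assume X: "X \<subseteq> (ray_sphere :: (real ^ 'n) set set)" and p: "p \<in> ball_S (frame_form Q S F) X \<delta>"
      then have "p \<in> ray_sphere"
        by (simp add: ball_S_def)
      then obtain x where x: "x \<noteq> 0" "p = ray x"
        by (auto simp: ray_sphere_def quotient_def ray_def)
      then obtain y where y: "y \<noteq> 0" "ray y \<in> X" "angle (frame_form Q S F) x y < \<delta>"
        using p M.ray_in_ball_S[OF x(1) X] by auto
      have "angle N x y < \<epsilon> / 3"
      proof (rule angle_comparison[OF N.pos_form_axioms M.pos_form_axioms _ _ \<kappa>_pos[OF \<epsilon>]])
        show "N x \<le> 3 * frame_form Q S F x" "frame_form Q S F x \<le> \<kappa> \<epsilon> * N x" for x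
          using frame_form_comparison[OF F \<epsilon>] sep by blast+
      qed (use \<delta> \<tau> \<epsilon> x y in auto)
      then show "p \<in> ball_S N X (\<epsilon> / 3)"
        using x y by (auto simp: N.ray_in_ball_S[OF _ X])
    qed
  qed
qed

text \<open>A wing vector can be replaced by its component in the middle line, so both wings are
  half-spaces over directions in the same line. If these directions agreed, the wings would share a
  ray.\<close>

lemma opposite_wings:
  assumes F: "is_frame Q F" and "0 < \<epsilon>"
    and sep: "\<And>x y. x \<in> wing (fst F) \<Longrightarrow> y \<in> wing (snd F) \<Longrightarrow> x \<noteq> 0 \<Longrightarrow> y \<noteq> 0 \<Longrightarrow> \<epsilon> \<le> angle N x y"
  obtains e where "\<forall>b\<in>frame_mid Q F. \<exists>\<beta>. b = \<beta> *\<^sub>R e"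
    and "wing (fst F) = {a + x *\<^sub>R e |a x. a \<in> fst F \<and> 0 \<le> x}"
    and "wing (snd F) = {c + x *\<^sub>R (- e) |c x. c \<in> snd F \<and> 0 \<le> x}"
proof -
  interpret splitting "fst F" "frame_mid Q F" "snd F"
    by (rule frame_splitting[OF F])
  have MT: "MTIS Q (fst F)" "MTIS Q (snd F)"
    using F by (auto simp: is_frame_def)
  have half_line: "\<exists>e\<in>frame_mid Q F. e \<noteq> 0 \<and> wing V = {a + x *\<^sub>R e |a x. a \<in> V \<and> 0 \<le> x} \<and>
      (\<forall>b\<in>frame_mid Q F. \<exists>\<beta>. b = \<beta> *\<^sub>R e)"
    if V: "MTIS Q V" "MTIS Q V'" and mid: "frame_mid Q F = perp Q V \<inter> perp Q V'"
      and dec: "\<And>x. \<exists>a\<in>V. \<exists>b\<in>frame_mid Q F. \<exists>c\<in>V'. x = a + b + c"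
      and triv: "V \<inter> V' = {0}" "V \<inter> frame_mid Q F = {0}" for V V'
  proof -
    obtain e' where e': "e' \<in> perp Q V" "e' \<notin> V"
      "wing V = {v + x *\<^sub>R e' |v x. v \<in> V \<and> 0 \<le> x}" "perp Q V = {v + x *\<^sub>R e' |v x. v \<in> V}"
      by (rule wing_halfspace[OF V(1)])
    obtain a b c where abc: "a \<in> V" "b \<in> frame_mid Q F" "c \<in> V'" "e' = a + b + c"
      using dec by blast
    have "a \<in> perp Q V" "b \<in> perp Q V"
      using abc isotropic_le_perp[OF MTIS_isotropic[OF V(1)]] mid by auto
    then have "e' - (a + b) \<in> perp Q V"
      using e'(1) by (simp only: subspace_diff[OF subspace_perp] subspace_add[OF subspace_perp])
    \<comment> \<open>The component in the opposite side is isotropic and orthogonal to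
      \<open>V\<close>, so it lies in \<open>V\<close> and vanishes.\<close>
    then have "c \<in> perp Q V"
      using abc(4) by simp
    moreover have "Q c = 0"
      using abc(3) MTIS_isotropic[OF V(2)] by (simp add: totally_isotropic_def)
    ultimately have "c \<in> V"
      by (rule MTIS_contains_isotropic[OF V(1)])
    then have "c = 0"
      using abc(3) triv(1) by blast
    then have e'_eq: "e' = a + b"
      using abc(4) by simp
    have "b \<noteq> 0"
      using e'(2) e'_eq abc(1) by auto
    moreover have "wing V = {a + x *\<^sub>R b |a x. a \<in> V \<and> 0 \<le> x}"
      using half_space_change_direction[OF MTIS_subspace[OF V(1)] abc(1), of 1 b]
      unfolding e'(3) e'_eq by simp
    moreover have "\<exists>\<beta>. b' = \<beta> *\<^sub>R b" if b': "b' \<in> frame_mid Q F" for b'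
    proof -
      have "b' \<in> perp Q V"
        using b' mid by simp
      then obtain v x where vx: "b' = v + x *\<^sub>R e'" "v \<in> V"
        using e'(4) by blast
      then have eq: "b' - x *\<^sub>R b = v + x *\<^sub>R a"
        by (simp add: e'_eq algebra_simps)
      have "v + x *\<^sub>R a \<in> V"
        using vx(2) abc(1) MTIS_subspace[OF V(1)] by (simp add: subspace_add subspace_scale)
      moreover have "b' - x *\<^sub>R b \<in> frame_mid Q F"
        using b' abc(2) subspaces(2) by (simp add: subspace_diff subspace_scale)
      ultimately have "b' - x *\<^sub>R b = 0"
        using triv(2) eq by auto
      then show ?thesis
        by auto
    qed
    ultimately show ?thesis
      using abc(2) by blast
  qed
  have zero: "0 \<in> fst F" "0 \<in> frame_mid Q F" "0 \<in> snd F"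
    using subspaces by (simp_all add: subspace_0)
  have triv: "fst F \<inter> snd F = {0}" "fst F \<inter> frame_mid Q F = {0}" "snd F \<inter> frame_mid Q F = {0}"
  proof -
    show "fst F \<inter> snd F = {0}"
      using F by (simp add: is_frame_def transversal_def)
    show "fst F \<inter> frame_mid Q F = {0}"
    proof (intro equalityI subsetI)
      fix x
      assume "x \<in> fst F \<inter> frame_mid Q F"
      then show "x \<in> {0}"
        using direct[of x "- x" 0] zero subspace_neg[OF subspaces(2), of x] by simp
    qed (use zero in simp)
    show "snd F \<inter> frame_mid Q F = {0}"
    proof (intro equalityI subsetI)
      fix x
      assume "x \<in> snd F \<inter> frame_mid Q F"
      then show "x \<in> {0}"
        using direct[of 0 "- x" x] zero subspace_neg[OF subspaces(2), of x] by simp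
    qed (use zero in simp)
  qed
  obtain e where e: "e \<in> frame_mid Q F" "e \<noteq> 0"
    "wing (fst F) = {a + x *\<^sub>R e |a x. a \<in> fst F \<and> 0 \<le> x}"
    "\<And>b. b \<in> frame_mid Q F \<Longrightarrow> \<exists>\<beta>. b = \<beta> *\<^sub>R e"
    using half_line[OF MT _ exists_parts triv(1,2)] by (auto simp: frame_mid_def)
  obtain e' where e': "e' \<in> frame_mid Q F" "e' \<noteq> 0"
    "wing (snd F) = {a + x *\<^sub>R e' |a x. a \<in> snd F \<and> 0 \<le> x}"
    using half_line[OF MT(2,1) _ exists_parts_reverse _ triv(3)] triv(1) by (auto simp: frame_mid_def Int_commute)
  obtain \<beta> where \<beta>: "e' = \<beta> *\<^sub>R e"
    using e(4)[OF e'(1)] by blast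
  have "\<not> 0 < \<beta>"
  proof
    assume "0 < \<beta>"
    have "e' \<in> wing (snd F)"
      unfolding e'(3) using zero(3) by (intro CollectI exI[of _ 0] exI[of _ 1]) simp
    moreover have "e' \<in> wing (fst F)"
      unfolding e(3) \<beta> using zero(1) \<open>0 < \<beta>\<close> by (intro CollectI exI[of _ 0] exI[of _ \<beta>]) simp
    ultimately have "\<epsilon> \<le> angle N e' e'"
      using sep e'(2) by blast
    then show False
      using \<open>0 < \<epsilon>\<close> e'(2) by (simp add: N.angle_self)
  qed
  then have "\<beta> < 0"
    using e'(2) \<beta> by (cases "\<beta> = 0") auto
  then have wing_snd: "wing (snd F) = {c + x *\<^sub>R (- e) |c x. c \<in> snd F \<and> 0 \<le> x}"
    using half_space_change_direction[OF subspaces(3) zero(3), of "- \<beta>" "- e"]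
    unfolding e'(3) \<beta> by simp
  show thesis
    by (rule that[OF _ e(3) wing_snd]) (use e(4) in blast)
qed

end

section \<open>Pseudohyperbolic maps\<close>

lemma linear_inj_on_subspace_image:
  fixes f :: "'a::euclidean_space \<Rightarrow> 'a"
  assumes "linear f" and "subspace V" and "f ` V \<subseteq> V" and "inj_on f V"
  shows "f ` V = V"
proof (rule subspace_dim_equal)
  show "subspace (f ` V)"
    by (rule linear_subspace_image) fact+
  show "dim V \<le> dim (f ` V)"
    using dim_image_eq[OF assms(1), of V] assms(2,4) by (simp add: span_eq_iff[THEN iffD2])
qed fact+

text \<open>The supremum bounds its members only if they are bounded above. A linear map
  \<open>h\<close> that agrees with \<open>f\<close> on \<open>V\<close> guarantees this;
  \<open>f\<close> itself may be an \<open>inv_into\<close>, which is unspecified off the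
  image.\<close>

lemma (in euclidean_pos_form) op_norm_on_bound:
  assumes "linear h" and "\<And>x. x \<in> V \<Longrightarrow> f x = h x" and "op_norm_on N V f \<le> s" and "0 \<le> s" and "x \<in> V"
  shows "N (f x) \<le> s\<^sup>2 * N x"
proof (cases "x = 0")
  case True
  then show ?thesis
    using assms(2)[OF assms(5)] linear_0[OF assms(1)] by simp
next
  case False
  obtain m M where mM: "0 < m" "0 < M" "\<And>x. m * norm x \<le> sqrt (N x)" "\<And>x. sqrt (N x) \<le> M * norm x"
    by (rule norm_equivalence) blast
  obtain K where K: "0 < K" "\<And>x. norm (h x) \<le> K * norm x"
    using linear_bounded_pos[OF assms(1)] by blast
  have "sqrt (N (f y)) / sqrt (N y) \<le> M * K / m" if "y \<in> V - {0}" for y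
  proof -
    have "sqrt (N (f y)) \<le> M * norm (h y)"
      using mM(4)[of "h y"] assms(2) that by simp
    also have "\<dots> \<le> M * (K * norm y)"
      using K(2)[of y] mM(2) by (intro mult_left_mono) auto
    also have "norm y \<le> sqrt (N y) / m"
      using mM(1) mM(3)[of y] by (simp add: pos_le_divide_eq mult.commute)
    then have "M * (K * norm y) \<le> M * (K * (sqrt (N y) / m))"
      using mM(2) K(1) by (intro mult_left_mono) auto
    finally show ?thesis
      using that form_pos[of y] by (simp add: pos_divide_le_eq)
  qed
  then have "bdd_above ((\<lambda>x. sqrt (N (f x)) / sqrt (N x)) ` (V - {0}))"
    by (auto simp: bdd_above_def)
  then have "sqrt (N (f x)) / sqrt (N x) \<le> op_norm_on N V f"
    unfolding op_norm_on_def using False assms(5) by (intro cSUP_upper) auto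
  then have "sqrt (N (f x)) \<le> s * sqrt (N x)"
    using assms(3) form_pos[OF False] by (simp add: pos_divide_le_eq order_trans)
  then have "(sqrt (N (f x)))\<^sup>2 \<le> (s * sqrt (N x))\<^sup>2"
    by (rule power_mono) simp
  then show ?thesis
    by (simp add: power_mult_distrib)
qed

section \<open>Linear dynamics of a generator and its inverse\<close>

lemma O_group_polar:
  assumes "g \<in> O_group Q"
  shows "polar Q (g *v x) (g *v y) = polar Q x y"
proof -
  have "Q (g *v x + g *v y) = Q (x + y)"
    using assms by (simp add: O_group_def matrix_vector_right_distrib[symmetric])
  then show ?thesis
    using assms by (simp add: O_group_def polar_def)
qed

definition signed_power :: "real ^ 'n ^ 'n \<Rightarrow> real \<Rightarrow> real ^ 'n ^ 'n" where
  "signed_power g \<sigma> = (if \<sigma> < 0 then matrix_inv g else g)"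

lemma matrix_inv_mult_vector:
  fixes g :: "real ^ 'n ^ 'n"
  assumes "invertible g"
  shows "matrix_inv g *v (g *v x) = x" and "g *v (matrix_inv g *v x) = x"
proof -
  have "g ** matrix_inv g = mat 1 \<and> matrix_inv g ** g = mat 1"
    using assms unfolding matrix_inv_def invertible_def by (rule someI_ex)
  then show "matrix_inv g *v (g *v x) = x" "g *v (matrix_inv g *v x) = x"
    by (simp_all add: matrix_vector_mul_assoc)
qed

lemma signed_power_inverse:
  fixes g :: "real ^ 'n ^ 'n"
  assumes "invertible g" and "\<sigma> \<in> {- 1, 1}"
  shows "signed_power g \<sigma> *v (signed_power g (- \<sigma>) *v x) = x"
  using assms by (auto simp: signed_power_def matrix_inv_mult_vector)

lemma O_group_signed_power_polar:
  assumes "g \<in> O_group Q"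
  shows "polar Q (signed_power g \<sigma> *v x) (signed_power g \<sigma> *v y) = polar Q x y"
proof -
  have "invertible g"
    using assms by (simp add: O_group_def)
  then show ?thesis
    using O_group_polar[OF assms] O_group_polar[OF assms, of "matrix_inv g *v x" "matrix_inv g *v y"]
    by (simp add: signed_power_def matrix_inv_mult_vector)
qed

context wing_geometry
begin

text \<open>The last claim needs an argument: \<open>pseudohyperbolic\<close> provides some fixed
  line \<open>B\<close>, whereas \<open>frame_mid\<close> is defined by orthogonality. The two are
  matched by showing that \<open>B\<close> is orthogonal to both sides of the frame.\<close>

lemma pseudohyperbolic_contraction:
  assumes F: "is_frame Q F" and g: "pseudohyperbolic Q g F"
    and "contraction_strength Q S g F \<le> s" and s: "0 < s" "s < 1"
  shows "invertible g"
    and "a \<in> fst F \<Longrightarrow> g *v a \<in> fst F \<and> N (g *v a) \<le> s\<^sup>2 * N a"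
    and "c \<in> snd F \<Longrightarrow> g *v c \<in> snd F \<and> N c \<le> s\<^sup>2 * N (g *v c)"
    and "(*v) g ` fst F = fst F" and "(*v) g ` snd F = snd F"
    and "b \<in> frame_mid Q F \<Longrightarrow> g *v b = b"
proof -
  obtain B where B: "dynamical_splitting g (fst F) B (snd F)" and B_fixed: "\<And>x. x \<in> B \<Longrightarrow> g *v x = x"
    and O: "g \<in> O_group Q"
    using g by (auto simp: pseudohyperbolic_def)
  show inv: "invertible g"
    using O by (simp add: O_group_def)
  have lin: "linear ((*v) g)" "linear ((*v) (matrix_inv g))"
    by (rule matrix_vector_mul_linear)+
  have inj: "inj_on ((*v) g) V" for V
    by (rule inj_on_inverseI[of _ "(*v) (matrix_inv g)"]) (simp add: matrix_inv_mult_vector inv)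
  have sub: "subspace (fst F)" "subspace (snd F)" and
    invariant: "(*v) g ` fst F \<subseteq> fst F" "(*v) g ` snd F \<subseteq> snd F"
    using B by (auto simp: dynamical_splitting_def)
  show imA: "(*v) g ` fst F = fst F" and imC: "(*v) g ` snd F = snd F"
    by (rule linear_inj_on_subspace_image[OF lin(1) _ _ inj]; fact)+
  have norms: "op_norm_on N (fst F) ((*v) g) \<le> s"
    "op_norm_on N (snd F) (inv_into (snd F) ((*v) g)) \<le> s"
    using assms(3) by (simp_all add: contraction_strength_def)
  have A: "g *v a \<in> fst F \<and> N (g *v a) \<le> s\<^sup>2 * N a" if "a \<in> fst F" for a
    using invariant(1) that N.op_norm_on_bound[OF lin(1) _ norms(1) _ that] s by auto
  have C: "g *v c \<in> snd F \<and> N c \<le> s\<^sup>2 * N (g *v c)" if c: "c \<in> snd F" for c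
  proof -
    have inv_eq: "inv_into (snd F) ((*v) g) x = matrix_inv g *v x" if x: "x \<in> snd F" for x
    proof -
      obtain y where "y \<in> snd F" "x = g *v y"
        using x imC by blast
      then show ?thesis
        using inv_into_f_f[OF inj, of y "snd F"] by (simp add: matrix_inv_mult_vector inv)
    qed
    have "g *v c \<in> snd F"
      using invariant(2) c by blast
    then have "N (inv_into (snd F) ((*v) g) (g *v c)) \<le> s\<^sup>2 * N (g *v c)"
      using N.op_norm_on_bound[OF lin(2) inv_eq norms(2)] s by simp
    then show ?thesis
      using \<open>g *v c \<in> snd F\<close> by (simp add: inv_into_f_f[OF inj c])
  qed
  show "a \<in> fst F \<Longrightarrow> g *v a \<in> fst F \<and> N (g *v a) \<le> s\<^sup>2 * N a"
    and "c \<in> snd F \<Longrightarrow> g *v c \<in> snd F \<and> N c \<le> s\<^sup>2 * N (g *v c)"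
    using A C by blast+
  have "s\<^sup>2 < 1"
    using s by (simp add: power_less_one_iff)
  have fixed_trivial: "v = 0" if "v \<in> fst F \<or> v \<in> snd F" "g *v v = v" for v
  proof (rule ccontr)
    assume "v \<noteq> 0"
    then have "s\<^sup>2 * N v < 1 * N v"
      using \<open>s\<^sup>2 < 1\<close> N.form_pos by (intro mult_strict_right_mono) auto
    then show False
      using A[of v] C[of v] that by auto
  qed
  \<comment> \<open>As 1 is not an eigenvalue on \<open>V\<close>, every vector of \<open>V\<close>
    has the form \<open>w - g *v w\<close>, and \<open>b\<close> pairs equally with \<open>w\<close>
    and \<open>g *v w\<close>.\<close>
  have B_orthogonal: "polar Q b v = 0" if b: "b \<in> B" and V: "V = fst F \<or> V = snd F" and v: "v \<in> V" for b v V
  proof -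
    have subV: "subspace V" and invV: "(*v) g ` V \<subseteq> V"
      using V sub invariant by auto
    let ?h = "\<lambda>v. v - g *v v"
    have lin_h: "linear ?h"
      by (intro linear_compose_sub linear_ident lin)
    have "?h ` V \<subseteq> V"
      using subV invV by (auto intro!: subspace_diff)
    moreover have "inj_on ?h V"
      unfolding linear_injective_on_subspace_0[OF lin_h subV] using fixed_trivial V by force
    ultimately have "?h ` V = V"
      by (rule linear_inj_on_subspace_image[OF lin_h subV])
    then obtain w where "v = w - g *v w"
      using v by blast
    moreover have "polar Q b (g *v w) = polar Q b w"
      using O_group_polar[OF O, of b w] B_fixed[OF b] by simp
    ultimately show ?thesis
      by (simp add: polar_simps)
  qed
  have B_mid: "B \<subseteq> frame_mid Q F"
    using B_orthogonal by (auto simp: frame_mid_def perp_def)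
  show "g *v b = b" if "b \<in> frame_mid Q F"
  proof -
    interpret splitting "fst F" "frame_mid Q F" "snd F"
      by (rule frame_splitting[OF F])
    have "b \<in> (\<lambda>(a, b, c). a + b + c) ` (fst F \<times> B \<times> snd F)"
      using B by (simp add: dynamical_splitting_def bij_betw_def)
    then obtain a b' c where dec: "a \<in> fst F" "b' \<in> B" "c \<in> snd F" "b = a + b' + c"
      by auto
    have "b' - b \<in> frame_mid Q F"
      using dec(2) B_mid that subspaces(2) by (auto intro: subspace_diff)
    then have "a = 0 \<and> b' - b = 0 \<and> c = 0"
      using dec by (intro direct) simp_all
    then show ?thesis
      using B_fixed[OF dec(2)] by simp
  qed
qed

text \<open>The cone contraction runs with the angle \<theta>, which is at most the radius
  \<open>r\<close>. A point outside the cone of radius \<open>r\<close> is outside that of radius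
  \<theta>, and the image lands in the smaller cone.\<close>

lemma generator_dynamics:
  assumes F: "is_frame Q F" and g: "pseudohyperbolic Q g F"
    and strength: "contraction_strength Q S g F \<le> s" and s: "0 < s" "s < (sin \<theta>)\<^sup>2"
    and \<theta>: "0 < \<theta>" "\<theta> \<le> pi / 2" "\<theta> \<le> r" and "0 < \<epsilon>"
    and sep: "\<And>x y. x \<in> wing (fst F) \<Longrightarrow> y \<in> wing (snd F) \<Longrightarrow> x \<noteq> 0 \<Longrightarrow> y \<noteq> 0 \<Longrightarrow> \<epsilon> \<le> angle N x y"
    and \<sigma>: "\<sigma> \<in> {- 1, 1}"
  shows "x \<noteq> 0 \<Longrightarrow> ray x \<notin> H_S Q S oV oP F r (- \<sigma>) \<Longrightarrow>
      ray (signed_power g \<sigma> *v x) \<in> H_S Q S oV oP F r \<sigma>" (is "_ \<Longrightarrow> _ \<Longrightarrow> ?maps x")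
    and "x \<noteq> 0 \<Longrightarrow> ray x \<notin> H_S Q S oV oP F r (- \<sigma>) \<Longrightarrow> ray (- x) \<notin> H_S Q S oV oP F r (- \<sigma>) \<Longrightarrow>
      (sin \<theta>)\<^sup>2 * frame_form Q S F x \<le> s\<^sup>2 * frame_form Q S F (signed_power g \<sigma> *v x)"
proof -
  let ?M = "frame_form Q S F"
  interpret pos_splitting "fst F" "frame_mid Q F" "snd F" N
    by (rule frame_pos_splitting[OF F])
  have M_eq: "?M = M"
    by (rule frame_form_eq[OF F])
  note \<theta>r = \<theta>(3)
  have s1: "s < 1"
    using s(2) abs_square_le_1[of "sin \<theta>"] by simp
  note contraction = pseudohyperbolic_contraction[OF F g strength s(1) s1]
  obtain e where e: "\<forall>b\<in>frame_mid Q F. \<exists>\<beta>. b = \<beta> *\<^sub>R e"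
    "wing (fst F) = {a + x *\<^sub>R e |a x. a \<in> fst F \<and> 0 \<le> x}"
    "wing (snd F) = {c + x *\<^sub>R (- e) |c x. c \<in> snd F \<and> 0 \<le> x}"
    by (rule opposite_wings[OF F \<open>0 < \<epsilon>\<close> sep])
  have fwd: "cone_contraction M (fst F) (frame_mid Q F) (snd F) e ((*v) g) s \<theta>"
  proof unfold_locales
    show "\<exists>a\<in>fst F. \<exists>b\<in>frame_mid Q F. \<exists>c\<in>snd F. x = a + b + c" for x
      by (rule exists_parts)
    show "\<exists>\<beta>. b = \<beta> *\<^sub>R e" if "b \<in> frame_mid Q F" for b
      using e(1) that by blast
    show "g *v a \<in> fst F \<and> M (g *v a) \<le> s\<^sup>2 * M a" if "a \<in> fst F" for a
      using contraction(2)[OF that] that by (simp add: M_on)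
    show "g *v c \<in> snd F \<and> M c \<le> s\<^sup>2 * M (g *v c)" if "c \<in> snd F" for c
      using contraction(3)[OF that] that by (simp add: M_on)
    show "g *v b = b" if "b \<in> frame_mid Q F" for b
      using contraction(6)[OF that] .
  qed (use subspaces M_orthogonal s \<theta> in \<open>auto simp: subspace_neg linear_add[OF matrix_vector_mul_linear] linear_scale[OF matrix_vector_mul_linear]\<close>)
  have bwd: "cone_contraction M (snd F) (frame_mid Q F) (fst F) (- e) ((*v) (matrix_inv g)) s \<theta>"
  proof unfold_locales
    show "\<exists>a\<in>snd F. \<exists>b\<in>frame_mid Q F. \<exists>c\<in>fst F. x = a + b + c" for x
      by (rule exists_parts_reverse)
    show "\<exists>\<beta>. b = \<beta> *\<^sub>R (- e)" if b: "b \<in> frame_mid Q F" for b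
    proof -
      obtain \<beta> where "b = \<beta> *\<^sub>R e"
        using e(1) b by blast
      then have "b = (- \<beta>) *\<^sub>R (- e)"
        by simp
      then show ?thesis
        by blast
    qed
    show "matrix_inv g *v c \<in> snd F \<and> M (matrix_inv g *v c) \<le> s\<^sup>2 * M c" if c: "c \<in> snd F" for c
    proof -
      obtain c' where "c' \<in> snd F" "c = g *v c'"
        using c contraction(5) by blast
      then show ?thesis
        using contraction(3)[of c'] by (simp add: matrix_inv_mult_vector contraction(1) M_on)
    qed
    show "matrix_inv g *v a \<in> fst F \<and> M a \<le> s\<^sup>2 * M (matrix_inv g *v a)" if a: "a \<in> fst F" for a
    proof -
      obtain a' where "a' \<in> fst F" "a = g *v a'"
        using a contraction(4) by blast
      then show ?thesis
        using contraction(2)[of a'] by (simp add: matrix_inv_mult_vector contraction(1) M_on)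
    qed
    show "matrix_inv g *v b = b" if "b \<in> frame_mid Q F" for b
      using contraction(6)[OF that] matrix_inv_mult_vector(1)[OF contraction(1), of b] by simp
    show "orthogonal_wrt M (snd F) (frame_mid Q F)" "orthogonal_wrt M (snd F) (fst F)"
      "orthogonal_wrt M (frame_mid Q F) (fst F)"
      using M_orthogonal unfolding orthogonal_wrt_def by (metis polar_commute)+
  qed (use subspaces s \<theta> in \<open>auto simp: subspace_neg linear_add[OF matrix_vector_mul_linear] linear_scale[OF matrix_vector_mul_linear]\<close>)
  have in_H: "ray x \<in> H_S Q S oV oP F r \<tau> \<longleftrightarrow> (\<exists>y\<in>wing (frame_side F \<tau>) - {0}. angle M x y < r)"
    if "x \<noteq> 0" for x \<tau>
    unfolding H_S_def M_eq by (rule M.ray_in_ball_S_iff[OF that])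
  have far: "\<theta> \<le> angle M x y"
    if "x \<noteq> 0" "ray x \<notin> H_S Q S oV oP F r \<tau>" "y \<in> wing (frame_side F \<tau>)" "y \<noteq> 0" for x y \<tau>
  proof (rule ccontr)
    assume "\<not> \<theta> \<le> angle M x y"
    then have "angle M x y < r"
      using \<theta>(3) by simp
    then show False
      using that in_H[OF that(1)] by blast
  qed
  show "?maps x" if x: "x \<noteq> 0" "ray x \<notin> H_S Q S oV oP F r (- \<sigma>)"
  proof (cases "\<sigma> < 0")
    case True
    interpret cone_contraction M "snd F" "frame_mid Q F" "fst F" "- e" "(*v) (matrix_inv g)" s \<theta>
      by (rule bwd)
    have "wing (frame_side F (- \<sigma>)) = repelling_wing" "wing (frame_side F \<sigma>) = attracting_wing"
      using True e by (simp_all add: frame_side_def repelling_wing_def attracting_wing_def)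
    moreover have "matrix_inv g *v x \<noteq> 0"
      using x(1) matrix_inv_mult_vector(2)[OF contraction(1), of x] by auto
    moreover obtain y where y: "y \<in> attracting_wing - {0}" "angle M (matrix_inv g *v x) y < \<theta>"
      using maps_to_attracting_cone[OF x(1)] far[OF x] calculation(1) by blast
    moreover have "angle M (matrix_inv g *v x) y < r"
      using y(2) \<theta>r by simp
    ultimately have "ray (matrix_inv g *v x) \<in> H_S Q S oV oP F r \<sigma>"
      using in_H[of "matrix_inv g *v x" \<sigma>] by blast
    then show ?thesis
      using True by (simp add: signed_power_def)
  next
    case False
    interpret cone_contraction M "fst F" "frame_mid Q F" "snd F" e "(*v) g" s \<theta>
      by (rule fwd)
    have "wing (frame_side F (- \<sigma>)) = repelling_wing" "wing (frame_side F \<sigma>) = attracting_wing"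
      using False \<sigma> e by (auto simp: frame_side_def repelling_wing_def attracting_wing_def)
    moreover have "g *v x \<noteq> 0"
      using x(1) matrix_inv_mult_vector(1)[OF contraction(1), of x] by auto
    moreover obtain y where y: "y \<in> attracting_wing - {0}" "angle M (g *v x) y < \<theta>"
      using maps_to_attracting_cone[OF x(1)] far[OF x] calculation(1) by blast
    moreover have "angle M (g *v x) y < r"
      using y(2) \<theta>r by simp
    ultimately have "ray (g *v x) \<in> H_S Q S oV oP F r \<sigma>"
      using in_H[of "g *v x" \<sigma>] by blast
    then show ?thesis
      using False by (simp add: signed_power_def)
  qed
  show "(sin \<theta>)\<^sup>2 * frame_form Q S F x \<le> s\<^sup>2 * frame_form Q S F (signed_power g \<sigma> *v x)"
    if x: "x \<noteq> 0" "ray x \<notin> H_S Q S oV oP F r (- \<sigma>)" "ray (- x) \<notin> H_S Q S oV oP F r (- \<sigma>)"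
  proof (cases "\<sigma> < 0")
    case True
    interpret cone_contraction M "snd F" "frame_mid Q F" "fst F" "- e" "(*v) (matrix_inv g)" s \<theta>
      by (rule bwd)
    have "wing (frame_side F (- \<sigma>)) = repelling_wing"
      using True e by (simp add: frame_side_def repelling_wing_def)
    then show ?thesis
      using expands_away_from_repelling_cone[of x] far[OF x(1,2)] far[OF _ x(3)] x(1) True
      by (simp add: signed_power_def M_eq)
  next
    case False
    interpret cone_contraction M "fst F" "frame_mid Q F" "snd F" e "(*v) g" s \<theta>
      by (rule fwd)
    have "wing (frame_side F (- \<sigma>)) = repelling_wing"
      using False \<sigma> e by (auto simp: frame_side_def repelling_wing_def)
    then show ?thesis
      using expands_away_from_repelling_cone[of x] far[OF x(1,2)] far[OF _ x(3)] x(1) False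
      by (simp add: signed_power_def M_eq)
  qed
qed

end

section \<open>Ping-pong\<close>

text \<open>Near a point of \<open>A w\<close> the other finitely many closed sets are
  absent.\<close>

lemma interior_finite_disjoint_Union:
  assumes "finite L" and "\<And>w. w \<in> L \<Longrightarrow> closed (A w)"
    and "\<And>v w. v \<in> L \<Longrightarrow> w \<in> L \<Longrightarrow> v \<noteq> w \<Longrightarrow> A v \<inter> A w = {}"
    and "x \<in> interior (\<Union>w\<in>L. A w)"
  obtains w where "w \<in> L" and "x \<in> interior (A w)"
proof -
  obtain w where w: "w \<in> L" "x \<in> A w"
    using assms(4) interior_subset by blast
  let ?U = "interior (\<Union>w\<in>L. A w) - (\<Union>v\<in>L - {w}. A v)"
  have "open ?U"
    using assms(1,2) by (intro open_Diff closed_UN) auto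
  moreover have "x \<in> ?U"
    using w assms(3,4) by blast
  moreover have "?U \<subseteq> A w"
    using interior_subset by blast
  ultimately have "x \<in> interior (A w)"
    by (rule interiorI)
  with w(1) show thesis
    by (rule that)
qed

text \<open>The regions are closed, so \<open>act_maps\<close> leaves open what happens to points
  inside \<open>A (bar w)\<close>. The assumption \<open>act_interior\<close> settles enough of it
  to exclude backtracking in the infinite words below.\<close>

locale ping_pong =
  fixes L :: "'l set" and bar :: "'l \<Rightarrow> 'l"
    and act :: "'l \<Rightarrow> 'a::t2_space \<Rightarrow> 'a" and A :: "'l \<Rightarrow> 'a set"
  assumes finite_letters: "finite L"
    and bar_letter: "w \<in> L \<Longrightarrow> bar w \<in> L"
    and bar_bar: "w \<in> L \<Longrightarrow> bar (bar w) = w"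
    and act_bar: "w \<in> L \<Longrightarrow> act w (act (bar w) x) = x"
    and continuous_act: "w \<in> L \<Longrightarrow> continuous_on UNIV (act w)"
    and closed_region: "w \<in> L \<Longrightarrow> closed (A w)"
    and disjoint_regions: "v \<in> L \<Longrightarrow> w \<in> L \<Longrightarrow> v \<noteq> w \<Longrightarrow> A v \<inter> A w = {}"
    and act_maps: "w \<in> L \<Longrightarrow> x \<notin> A (bar w) \<Longrightarrow> act w x \<in> A w"
    and act_interior: "w \<in> L \<Longrightarrow> x \<in> interior (A (bar w)) \<Longrightarrow> act w x \<notin> interior (A w)"
begin

definition domain :: "'a set" where
  "domain = UNIV - (\<Union>w\<in>L. A w)"

text \<open>The first argument records the outermost letter, the only one that matters for extending
  or cancelling. The empty word is left out.\<close>

inductive reduced :: "'l \<Rightarrow> ('a \<Rightarrow> 'a) \<Rightarrow> bool" where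
  letter: "w \<in> L \<Longrightarrow> reduced w (act w)"
| step: "reduced v f \<Longrightarrow> w \<in> L \<Longrightarrow> v \<noteq> bar w \<Longrightarrow> reduced w (act w \<circ> f)"

lemma reduced_letter: "reduced w f \<Longrightarrow> w \<in> L"
  by (induction rule: reduced.induct) auto

lemma reduced_image: "reduced w f \<Longrightarrow> f ` domain \<subseteq> A w"
proof (induction rule: reduced.induct)
  case (letter w)
  then show ?case
    using act_maps bar_letter by (auto simp: domain_def)
next
  case (step v f w)
  then have "A v \<inter> A (bar w) = {}"
    using reduced_letter bar_letter by (intro disjoint_regions) auto
  then show ?case
    using step act_maps by fastforce
qed

definition words :: "('a \<Rightarrow> 'a) set" where
  "words = {f. f = id \<or> (\<exists>w. reduced w f)}"

lemma act_comp_words: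
  assumes "w \<in> L" and "f \<in> words"
  shows "act w \<circ> f \<in> words"
proof -
  have cancel: "act w \<circ> act (bar w) = id"
    using act_bar[OF assms(1)] by (simp add: fun_eq_iff)
  consider "f = id" | v where "reduced v f"
    using assms(2) by (auto simp: words_def)
  then show ?thesis
  proof cases
    case 1
    then show ?thesis
      using assms(1) letter by (auto simp: words_def)
  next
    case 2
    show ?thesis
    proof (cases "v = bar w")
      case True
      from 2 show ?thesis
      proof cases
        case letter
        then show ?thesis
          using cancel True by (simp add: words_def)
      next
        case (step v' f')
        then have "act w \<circ> f = f'"
          using cancel True by (simp add: comp_assoc[symmetric])
        then show ?thesis
          using step by (auto simp: words_def)
      qed
    next
      case False
      then show ?thesis
        using reduced.step[OF 2 assms(1)] by (auto simp: words_def)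
    qed
  qed
qed

lemma words_comp:
  assumes "f \<in> words" and "h \<in> words"
  shows "f \<circ> h \<in> words"
proof -
  have "reduced w f \<Longrightarrow> f \<circ> h \<in> words" for w
    by (induction rule: reduced.induct) (simp_all only: comp_assoc act_comp_words assms(2))
  then show ?thesis
    using assms by (auto simp: words_def)
qed

end

section \<open>The group generated by the letters\<close>

locale ping_pong_group = ping_pong L bar act A
  for L :: "'l set" and bar and act :: "'l \<Rightarrow> 'a::t2_space \<Rightarrow> 'a" and A +
  fixes X :: "'l set"
  assumes letters: "L = X \<union> bar ` X"
begin

definition \<Gamma> :: "('a \<Rightarrow> 'a) set" where
  "\<Gamma> = generate (BijGroup UNIV) (act ` X)"

lemma act_bij: "w \<in> L \<Longrightarrow> bij (act w)"
  using act_bar[of w] act_bar[of "bar w"] bar_letter bar_bar by (intro o_bij[of "act (bar w)"]) (auto simp: fun_eq_iff)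

lemma act_carrier: "act ` X \<subseteq> carrier (BijGroup UNIV)"
  using act_bij letters by (auto simp: BijGroup_def Bij_def)

lemma inv_act:
  assumes "w \<in> L"
  shows "inv\<^bsub>BijGroup UNIV\<^esub> (act w) = act (bar w)"
proof -
  have "inv_into UNIV (act w) = act (bar w)"
    using assms act_bar[of w] act_bar[of "bar w"] bar_letter bar_bar by (intro inv_unique_comp) (auto simp: fun_eq_iff)
  moreover have "act w \<in> Bij UNIV"
    using act_bij[OF assms] by (simp add: Bij_def)
  ultimately show ?thesis
    by (simp add: inv_BijGroup restrict_UNIV)
qed

lemma \<Gamma>_carrier: "\<Gamma> \<subseteq> Bij UNIV"
  using group.generate_incl[OF group_BijGroup act_carrier] by (simp add: \<Gamma>_def BijGroup_def)

lemma BijGroup_mult: "f \<in> Bij UNIV \<Longrightarrow> h \<in> Bij UNIV \<Longrightarrow> f \<otimes>\<^bsub>BijGroup UNIV\<^esub> h = f \<circ> h"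
  by (auto simp: BijGroup_def compose_def)

lemma BijGroup_one: "\<one>\<^bsub>BijGroup UNIV\<^esub> = id"
  by (simp add: BijGroup_def restrict_UNIV id_def)

lemma \<Gamma>_id: "id \<in> \<Gamma>"
  using generate.one[of "BijGroup UNIV" "act ` X"] by (simp add: \<Gamma>_def BijGroup_one)

lemma \<Gamma>_comp:
  assumes "f \<in> \<Gamma>" and "h \<in> \<Gamma>"
  shows "f \<circ> h \<in> \<Gamma>"
proof -
  have "f \<otimes>\<^bsub>BijGroup UNIV\<^esub> h = f \<circ> h"
    using assms \<Gamma>_carrier by (intro BijGroup_mult) auto
  then show ?thesis
    using generate.eng[of f "BijGroup UNIV" "act ` X" h] assms by (simp add: \<Gamma>_def)
qed

lemma act_\<Gamma>:
  assumes "w \<in> L"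
  shows "act w \<in> \<Gamma>"
proof -
  consider "w \<in> X" | v where "v \<in> X" "w = bar v"
    using assms letters by blast
  then show ?thesis
  proof cases
    case 1
    then show ?thesis
      by (auto simp: \<Gamma>_def intro: generate.incl)
  next
    case 2
    then show ?thesis
      using generate.inv[of "act v" "act ` X" "BijGroup UNIV"] inv_act[of v] letters by (simp add: \<Gamma>_def)
  qed
qed

lemma \<Gamma>_words: "f \<in> \<Gamma> \<Longrightarrow> f \<in> words"
  unfolding \<Gamma>_def
proof (induction rule: generate.induct)
  case one
  then show ?case
    unfolding BijGroup_one words_def by blast
next
  case (incl h)
  then obtain w where "w \<in> L" "h = act w"
    using letters by auto
  then show ?case
    using reduced.letter unfolding words_def by blast
next
  case (inv h)
  then obtain w where "w \<in> L" "h = act w"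
    using letters by auto
  then show ?case
    using inv_act reduced.letter[OF bar_letter] by (auto simp: words_def)
next
  case (eng f h)
  then have mem: "f \<in> Bij UNIV" "h \<in> Bij UNIV"
    using \<Gamma>_carrier by (auto simp: \<Gamma>_def)
  show ?case
    unfolding BijGroup_mult[OF mem] using eng by (intro words_comp)
qed

lemma \<Gamma>_inverse:
  assumes "f \<in> \<Gamma>"
  obtains h where "h \<in> \<Gamma>" and "h \<circ> f = id" and "f \<circ> h = id"
proof -
  have carrier: "f \<in> carrier (BijGroup UNIV)"
    using assms \<Gamma>_carrier by (auto simp: BijGroup_def)
  have mem: "inv\<^bsub>BijGroup UNIV\<^esub> f \<in> \<Gamma>"
    using group.generate_m_inv_closed[OF group_BijGroup act_carrier] assms by (simp add: \<Gamma>_def)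
  have "f \<in> Bij UNIV" "inv\<^bsub>BijGroup UNIV\<^esub> f \<in> Bij UNIV"
    using assms mem \<Gamma>_carrier by auto
  then have "inv\<^bsub>BijGroup UNIV\<^esub> f \<circ> f = id" "f \<circ> inv\<^bsub>BijGroup UNIV\<^esub> f = id"
    using group.l_inv[OF group_BijGroup carrier] group.r_inv[OF group_BijGroup carrier]
    by (simp_all add: BijGroup_mult BijGroup_one)
  with mem show thesis
    by (rule that)
qed

text \<open>The quotient of two distinct elements is a nonempty reduced word, which maps the domain
  into a region and so off itself.\<close>

lemma disjoint_images:
  assumes "f \<in> \<Gamma>" and "f' \<in> \<Gamma>" and "f \<noteq> f'"
  shows "f ` domain \<inter> f' ` domain = {}"
proof (rule ccontr)
  assume "f ` domain \<inter> f' ` domain \<noteq> {}"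
  then obtain x y where xy: "x \<in> domain" "y \<in> domain" "f x = f' y"
    by blast
  obtain h where h: "h \<in> \<Gamma>" "h \<circ> f = id" "f \<circ> h = id"
    by (rule \<Gamma>_inverse[OF assms(1)])
  have "h \<circ> f' \<in> words"
    by (intro \<Gamma>_words \<Gamma>_comp h assms)
  moreover have "h \<circ> f' \<noteq> id"
  proof
    assume "h \<circ> f' = id"
    then have "f \<circ> (h \<circ> f') = f"
      by simp
    then show False
      using h(3) assms(3) by (simp add: comp_assoc[symmetric])
  qed
  ultimately obtain w where "reduced w (h \<circ> f')"
    by (auto simp: words_def)
  then have "(h \<circ> f') y \<in> A w" "w \<in> L"
    using reduced_image xy(2) reduced_letter by blast+
  moreover have "(h \<circ> f') y = x"
    using h(2) xy(3) by (metis comp_apply id_apply)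
  ultimately show False
    using xy(1) by (auto simp: domain_def)
qed

text \<open>An uncovered point, pulled back by any element, stays off the closure of the domain. So
  it is interior to the union of the regions and hence to exactly one of them; the inverse letter is
  applied and the process repeats.\<close>

lemma infinite_word:
  assumes "x \<notin> (\<Union>f\<in>\<Gamma>. closure (f ` domain))"
  obtains w :: "nat \<Rightarrow> 'l" and y :: "nat \<Rightarrow> 'a" where "y 0 = x" and "\<And>k. w k \<in> L"
    and "\<And>k. w (Suc k) \<noteq> bar (w k)" and "\<And>k. y k \<in> A (w k)"
    and "\<And>k. y (Suc k) = act (bar (w k)) (y k)"
proof -
  define pick where "pick p = (SOME w. w \<in> L \<and> p \<in> interior (A w))" for p
  define y where "y = rec_nat x (\<lambda>_ p. act (bar (pick p)) p)"
  have y0: "y 0 = x" and ySuc: "y (Suc k) = act (bar (pick (y k))) (y k)" for k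
    by (simp_all add: y_def)
  have pick: "pick p \<in> L \<and> p \<in> interior (A (pick p))"
    if f: "f \<in> \<Gamma>" "continuous_on UNIV f" "f p = x" for f p
  proof -
    have "p \<notin> closure domain"
    proof
      assume "p \<in> closure domain"
      then have "f p \<in> closure (f ` domain)"
        using continuous_image_closure_subset[OF f(2), of domain] by blast
      then show False
        using assms f by blast
    qed
    then have "p \<in> interior (\<Union>w\<in>L. A w)"
      by (simp only: domain_def closure_complement Compl_eq_Diff_UNIV[symmetric] Compl_iff not_not)
    then obtain w where "w \<in> L" "p \<in> interior (A w)"
      using interior_finite_disjoint_Union[of L A p] finite_letters closed_region disjoint_regions by blast
    then show ?thesis
      unfolding pick_def by (intro someI[of "\<lambda>w. w \<in> L \<and> p \<in> interior (A w)"] conjI)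
  qed
  have orbit: "\<exists>f\<in>\<Gamma>. continuous_on UNIV f \<and> f (y k) = x" for k
  proof (induction k)
    case 0
    show ?case
      using \<Gamma>_id y0 by (intro bexI[of _ id]) (auto simp: continuous_on_id)
  next
    case (Suc k)
    then obtain f where f: "f \<in> \<Gamma>" "continuous_on UNIV f" "f (y k) = x"
      by blast
    then have w: "pick (y k) \<in> L"
      using pick by blast
    show ?case
    proof (intro bexI[of _ "f \<circ> act (pick (y k))"] conjI)
      show "f \<circ> act (pick (y k)) \<in> \<Gamma>"
        by (intro \<Gamma>_comp f act_\<Gamma> w)
      show "continuous_on UNIV (f \<circ> act (pick (y k)))"
        by (intro continuous_on_compose continuous_act w continuous_on_subset[OF f(2)]) simp
      show "(f \<circ> act (pick (y k))) (y (Suc k)) = x"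
        using f(3) by (simp add: ySuc act_bar[OF w])
    qed
  qed
  have w: "pick (y k) \<in> L" "y k \<in> interior (A (pick (y k)))" for k
    using orbit[of k] pick by blast+
  show thesis
  proof (rule that[of y "\<lambda>k. pick (y k)"])
    show "y 0 = x" "\<And>k. pick (y k) \<in> L" "\<And>k. y (Suc k) = act (bar (pick (y k))) (y k)"
      using y0 w ySuc by simp_all
    show "y k \<in> A (pick (y k))" for k
      using w(2) interior_subset by blast
    \<comment> \<open>Interiority is used here: by \<open>act_interior\<close> the inverse letter
      cannot move a point interior to its own region into the interior of the opposite one.\<close>
    show "pick (y (Suc k)) \<noteq> bar (pick (y k))" for k
    proof
      assume "pick (y (Suc k)) = bar (pick (y k))"
      then have "act (bar (pick (y k))) (y k) \<in> interior (A (bar (pick (y k))))"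
        using w(2)[of "Suc k"] by (simp add: ySuc)
      then show False
        using act_interior[of "bar (pick (y k))" "y k"] w[of k] bar_letter bar_bar by simp
    qed
  qed
qed

end

text \<open>
  Along a ray in the direction \<open>z 0\<close>, the exit parameters of the nested images of the regions are
  at least \<open>c / (2 * C)\<close> apart: consecutive images are separated by the image of a gap of width
  \<open>c\<close>, and \<open>z k\<close> is the direction pulled back to the standard position of the \<open>k\<close>-th gap.
\<close>

lemma gap_estimate:
  fixes act :: "'l \<Rightarrow> 'a::real_normed_vector \<Rightarrow> 'a"
  assumes "ping_pong L bar act A"
    and w: "\<And>k. w k \<in> L" "\<And>k. w (Suc k) \<noteq> bar (w k)"
    and y: "\<And>k. y k \<in> A (w k)" "\<And>k. y (Suc k) = act (bar (w k)) (y k)"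
    and z: "\<And>k l. k < K \<Longrightarrow> act (bar (w k)) (y k + l *\<^sub>R z k) = y (Suc k) + l *\<^sub>R z (Suc k)"
    and bound: "\<And>k. k \<le> K \<Longrightarrow> norm (z k) \<le> C" and "0 < C"
    and gap: "\<And>u v p q. u \<in> L \<Longrightarrow> v \<in> L \<Longrightarrow> u \<noteq> v \<Longrightarrow> p \<in> A u \<Longrightarrow> q \<in> A v \<Longrightarrow> c \<le> dist p q"
    and "0 < c" and "0 \<le> l" and exit: "y 0 + l *\<^sub>R z 0 \<notin> A (w 0)"
  shows "real K * (c / (2 * C)) \<le> l"
proof -
  interpret ping_pong L bar act A
    by fact
  \<comment> \<open>Halving makes the product of \<eta> with \<open>C\<close> strictly smaller than
    the gap.\<close>
  define \<eta> where "\<eta> = c / (2 * C)"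
  have \<eta>: "0 < \<eta>" "\<eta> * C < c"
    using \<open>0 < c\<close> \<open>0 < C\<close> by (simp_all add: \<eta>_def)
  \<comment> \<open>Invariant: at the parameter \<open>l - real k * \<eta>\<close> the half-line has
    already left the region of \<open>w k\<close>, although it starts inside.\<close>
  have "k \<le> K \<Longrightarrow> real k * \<eta> \<le> l \<and> y k + (l - real k * \<eta>) *\<^sub>R z k \<notin> A (w k)" for k
  proof (induction k)
    case 0
    then show ?case
      using \<open>0 \<le> l\<close> exit by simp
  next
    case (Suc k)
    define m where "m = l - real k * \<eta>"
    have m: "0 \<le> m" "y k + m *\<^sub>R z k \<notin> A (w k)"
      using Suc by (simp_all add: m_def)
    have "act (bar (w k)) (y k + m *\<^sub>R z k) \<in> A (bar (w k))"
      using act_maps[OF bar_letter[OF w(1)]] m(2) bar_bar[OF w(1)] by simp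
    then have inside: "y (Suc k) + m *\<^sub>R z (Suc k) \<in> A (bar (w k))"
      using z[of k m] Suc.prems by simp
    \<comment> \<open>At parameter \<open>m\<close> the transported half-line is in the region of
      \<open>bar (w k)\<close>. Within \<eta> of \<open>m\<close> it cannot cross the gap to the
      region of \<open>w (Suc k)\<close>. The choice \<open>m' = 0\<close> shows that
      \<open>m\<close> is at least \<eta>, since the starting point is in that region; the choice
      \<open>m' = m - \<eta>\<close> continues the induction.\<close>
    have away: "y (Suc k) + m' *\<^sub>R z (Suc k) \<notin> A (w (Suc k))" if "\<bar>m - m'\<bar> \<le> \<eta>" for m'
    proof
      assume "y (Suc k) + m' *\<^sub>R z (Suc k) \<in> A (w (Suc k))"
      then have "c \<le> dist (y (Suc k) + m *\<^sub>R z (Suc k)) (y (Suc k) + m' *\<^sub>R z (Suc k))"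
        by (rule gap[OF bar_letter[OF w(1)] w(1) w(2)[symmetric] inside])
      also have "dist (y (Suc k) + m *\<^sub>R z (Suc k)) (y (Suc k) + m' *\<^sub>R z (Suc k)) =
          \<bar>m - m'\<bar> * norm (z (Suc k))"
        by (simp add: dist_norm scaleR_left_diff_distrib[symmetric])
      also have "\<dots> \<le> \<eta> * C"
        using that bound[OF Suc.prems] by (intro mult_mono) auto
      finally show False
        using \<eta>(2) by simp
    qed
    have "\<eta> \<le> m"
    proof (rule ccontr)
      assume "\<not> \<eta> \<le> m"
      then show False
        using away[of 0] m(1) y(1)[of "Suc k"] by simp
    qed
    moreover have "l - real (Suc k) * \<eta> = m - \<eta>"
      by (simp add: m_def algebra_simps)
    ultimately show ?case
      using away[of "m - \<eta>"] \<eta>(1) by simp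
  qed
  then show ?thesis
    by (simp add: \<eta>_def)
qed

section \<open>The fundamental domain\<close>

text \<open>Disjoint closed sets may still be at distance 0 at infinity. The angular gap forbids
  this: after translation, distances still grow linearly with the norm up to additive constants, so
  pairs closer than 1 stay in a bounded set, where compactness applies.\<close>

lemma closed_cones_translates_gap:
  fixes K K' :: "'a::euclidean_space set"
  assumes "0 < m" and gap: "\<And>p q. p \<in> K \<Longrightarrow> q \<in> K' \<Longrightarrow> m * norm p \<le> norm (p - q)"
    and disjoint: "closure ((\<lambda>x. x + a) ` K) \<inter> closure ((\<lambda>x. x + b) ` K') = {}"
  obtains c where "0 < c"
    and "\<And>x y. x \<in> closure ((\<lambda>x. x + a) ` K) \<Longrightarrow> y \<in> closure ((\<lambda>x. x + b) ` K') \<Longrightarrow> c \<le> dist x y"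
proof -
  let ?X = "closure ((\<lambda>x. x + a) ` K)" and ?Y = "closure ((\<lambda>x. x + b) ` K')"
  \<comment> \<open>A closed condition that holds on the translated cones and therefore passes to
    their closures.\<close>
  let ?E = "{(x, y). m * (norm x - norm a) \<le> norm (x - y) + norm (a - b)}"
  have "?X \<times> ?Y = closure ((\<lambda>x. x + a) ` K \<times> (\<lambda>x. x + b) ` K')"
    by (simp add: closure_Times)
  also have "\<dots> \<subseteq> ?E"
  proof (rule closure_minimal)
    show "(\<lambda>x. x + a) ` K \<times> (\<lambda>x. x + b) ` K' \<subseteq> ?E"
    proof clarify
      fix p q
      assume "p \<in> K" "q \<in> K'"
      have "m * (norm (p + a) - norm a) \<le> m * norm p"
        using \<open>0 < m\<close> norm_triangle_ineq[of p a] by simp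
      also have "\<dots> \<le> norm (p - q)"
        by (rule gap) fact+
      also have "p - q = (p + a - (q + b)) - (a - b)"
        by simp
      also have "norm \<dots> \<le> norm (p + a - (q + b)) + norm (a - b)"
        by (rule norm_triangle_ineq4)
      finally show "m * (norm (p + a) - norm a) \<le> norm (p + a - (q + b)) + norm (a - b)" .
    qed
    show "closed ?E"
      unfolding case_prod_beta by (intro closed_Collect_le continuous_intros)
  qed
  finally have E: "m * (norm x - norm a) \<le> norm (x - y) + norm (a - b)" if "x \<in> ?X" "y \<in> ?Y" for x y
    using that by blast
  define R where "R = (1 + norm (a - b)) / m + norm a"
  have "compact (?X \<inter> cball 0 R)"
    by (intro closed_Int_compact) auto
  moreover have "(?X \<inter> cball 0 R) \<inter> ?Y = {}"
    using disjoint by blast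
  ultimately obtain c where c: "0 < c" "\<And>x y. x \<in> ?X \<inter> cball 0 R \<Longrightarrow> y \<in> ?Y \<Longrightarrow> c \<le> dist x y"
    using separate_compact_closed[of "?X \<inter> cball 0 R" ?Y] by blast
  show thesis
  proof (rule that)
    show "0 < min 1 c"
      using c(1) by simp
    fix x y
    assume xy: "x \<in> ?X" "y \<in> ?Y"
    show "min 1 c \<le> dist x y"
    proof (cases "dist x y < 1")
      case True
      then have "(norm x - norm a) * m \<le> 1 + norm (a - b)"
        using E[OF xy] by (simp add: dist_norm mult.commute)
      then have "norm x - norm a \<le> (1 + norm (a - b)) / m"
        using \<open>0 < m\<close> by (simp add: pos_le_divide_eq)
      then have "x \<in> ?X \<inter> cball 0 R"
        using xy(1) by (simp add: R_def)
      then show ?thesis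
        using c(2)[OF _ xy(2)] by (simp add: min.coboundedI2)
    qed simp
  qed
qed

lemma finite_uniform_positive:
  assumes "finite A" and "\<And>a. a \<in> A \<Longrightarrow> \<exists>c>0. \<forall>x. P a x \<longrightarrow> c \<le> f x"
  shows "\<exists>c>0::real. \<forall>a\<in>A. \<forall>x. P a x \<longrightarrow> c \<le> f x"
  using assms
proof (induction A rule: finite_induct)
  case empty
  then show ?case
    by (auto intro: exI[of _ 1])
next
  case (insert a A)
  then obtain c c' where c: "0 < c" "\<forall>a\<in>A. \<forall>x. P a x \<longrightarrow> c \<le> f x" "0 < c'" "\<forall>x. P a x \<longrightarrow> c' \<le> f x"
    by (metis insertCI)
  show ?case
  proof (intro exI[of _ "min c c'"] conjI ballI allI impI)
    show "0 < min c c'"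
      using c by simp
    fix b x
    assume "b \<in> insert a A" "P b x"
    then show "min c c' \<le> f x"
      using c by (auto simp: min_le_iff_disj)
  qed
qed

context wing_geometry
begin

lemma separated_angle:
  assumes "separated Q S oV oP \<epsilon> n W" and "i \<in> {1..n}" "j \<in> {1..n}"
    and "\<sigma> \<in> {- 1, 1}" "\<tau> \<in> {- 1, 1}" "(i, \<sigma>) \<noteq> (j, \<tau>)"
    and "x \<in> wing (frame_side (W i) \<sigma>)" "x \<noteq> 0" "y \<in> wing (frame_side (W j) \<tau>)" "y \<noteq> 0"
  shows "\<epsilon> \<le> angle N x y"
proof (rule N.alpha_dist_rays_ge)
  show "ereal \<epsilon> \<le> alpha_dist N (rays (wing (frame_side (W i) \<sigma>))) (rays (wing (frame_side (W j) \<tau>)))"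
    using assms(1-6) unfolding separated_def by blast
qed (use assms in auto)

lemma separated_frame:
  assumes "frameset Q n W" and "separated Q S oV oP \<epsilon> n W" and "i \<in> {1..n}"
    and "x \<in> fst (W i)" "y \<in> snd (W i)" "x \<noteq> 0" "y \<noteq> 0"
  shows "\<epsilon> \<le> angle N x y"
proof (rule separated_angle[OF assms(2,3,3), of "- 1" 1])
  have "is_frame Q (W i)"
    using assms(1,3) by (simp add: frameset_def)
  then show "x \<in> wing (frame_side (W i) (- 1))" "y \<in> wing (frame_side (W i) 1)"
    using MTIS_le_wing assms(4,5) by (auto simp: is_frame_def frame_side_def)
qed (use assms in auto)

text \<open>A nonempty frameset cannot be separated by more than the diameter of the sphere. This
  later allows \<epsilon> to be truncated at \<open>pi\<close>.\<close>

lemma separated_le_pi: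
  assumes "frameset Q n W" and "separated Q S oV oP \<epsilon> n W" and "i \<in> {1..n}"
  shows "\<epsilon> \<le> pi"
proof -
  have "MTIS Q (fst (W i))" "MTIS Q (snd (W i))"
    using assms(1,3) by (auto simp: frameset_def is_frame_def)
  then obtain x y where "x \<in> fst (W i)" "y \<in> snd (W i)" "x \<noteq> 0" "y \<noteq> 0"
    using MTIS_nontrivial by metis
  then have "\<epsilon> \<le> angle N x y"
    by (rule separated_frame[OF assms])
  then show ?thesis
    using N.angle_le_pi[of x y] by linarith
qed

end

text \<open>The angle \<theta> is a common lower bound for the radii, so the conditions on
  \<open>s\<close> involve only \<theta> and \<epsilon>. The bound
  \<open>s < (sin \<theta>)\<^sup>2\<close> gives the cone contraction, the last one the uniform
  expansion in \<open>N\<close>.\<close>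

locale contracting_data = wing_geometry Q S oV oP
  for Q :: "real ^ 'n \<Rightarrow> real" and S :: "(real ^ 'n) set"
    and oV :: "(real ^ 'n) set \<Rightarrow> (real ^ 'n ^ 'd::finite) set"
    and oP :: "(real ^ 'n) set \<Rightarrow> (real ^ 'n ^ 'd option) set" +
  fixes \<epsilon> \<theta> s :: real and n :: nat and W :: "nat \<Rightarrow> 'n frame" and g :: "nat \<Rightarrow> real ^ 'n ^ 'n"
    and r :: "nat \<Rightarrow> real" and t :: "nat \<Rightarrow> real ^ 'n"
  assumes \<epsilon>: "0 < \<epsilon>" "\<epsilon> \<le> pi"
    and \<theta>: "0 < \<theta>" "\<theta> \<le> pi / 2"
    and s: "0 < s" "s < (sin \<theta>)\<^sup>2" "12 * \<kappa> \<epsilon> * s\<^sup>2 \<le> (sin \<theta>)\<^sup>2"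
    and frames: "frameset Q n W"
    and separated: "separated Q S oV oP \<epsilon> n W"
    and generators: "contracting_generators Q S s n W g"
    and radii: "\<And>i. i \<in> {1..n} \<Longrightarrow> \<theta> \<le> r i \<and> admissible_radius Q S \<epsilon> (W i) (r i)"
    and t_mem: "t \<in> T_set Q S oV oP n W r g"
begin

section \<open>Letters, their cones and their regions\<close>

definition letters :: "(nat \<times> real) set" where
  "letters = {1..n} \<times> {- 1, 1}"

definition bar :: "nat \<times> real \<Rightarrow> nat \<times> real" where
  "bar w = (fst w, - snd w)"

definition side :: "nat \<times> real \<Rightarrow> (real ^ 'n) set" where
  "side w = frame_side (W (fst w)) (snd w)"

definition cone :: "nat \<times> real \<Rightarrow> (real ^ 'n) set" where
  "cone w = {x. x \<noteq> 0 \<and> ray x \<in> H_S Q S oV oP (W (fst w)) (r (fst w)) (snd w)}"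

definition lin :: "nat \<times> real \<Rightarrow> real ^ 'n ^ 'n" where
  "lin w = signed_power (g (fst w)) (snd w)"

definition shift :: "nat \<times> real \<Rightarrow> real ^ 'n" where
  "shift w = snd w *\<^sub>R half_translation (g (fst w)) (t (fst w))"

definition region :: "nat \<times> real \<Rightarrow> (real ^ 'n) set" where
  "region w = closure (H_tilde Q S oV oP (W (fst w)) (r (fst w)) (g (fst w)) (t (fst w)) (snd w))"

definition act :: "nat \<times> real \<Rightarrow> real ^ 'n \<Rightarrow> real ^ 'n" where
  "act w x = (if snd w < 0 then matrix_inv (g (fst w)) *v (x - t (fst w))
    else affine_map (g (fst w)) (t (fst w)) x)"

lemma letters_cases:
  assumes "w \<in> letters"
  shows "fst w \<in> {1..n}" and "snd w \<in> {- 1, 1}"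
  using assms by (auto simp: letters_def)

lemma bar_letter: "w \<in> letters \<Longrightarrow> bar w \<in> letters"
  and bar_bar: "bar (bar w) = w"
  by (auto simp: letters_def bar_def)

lemma frame_letter: "i \<in> {1..n} \<Longrightarrow> is_frame Q (W i)"
  using frames by (simp add: frameset_def)

lemma generator:
  assumes "i \<in> {1..n}"
  shows "pseudohyperbolic Q (g i) (W i)" and "contraction_strength Q S (g i) (W i) \<le> s"
  using generators assms by (simp_all add: contracting_generators_def)

lemma generator_O: "i \<in> {1..n} \<Longrightarrow> g i \<in> O_group Q"
  using generator(1) by (auto simp: pseudohyperbolic_def)

lemma generator_invertible: "i \<in> {1..n} \<Longrightarrow> invertible (g i)"
  using generator_O by (auto simp: O_group_def)

lemma s_less_1: "s < 1"
  using s(2) abs_square_le_1[of "sin \<theta>"] by simp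

lemma side_MTIS: "w \<in> letters \<Longrightarrow> MTIS Q (side w)"
  using frame_letter[of "fst w"] letters_cases[of w] by (auto simp: side_def frame_side_def is_frame_def)

lemma wings_separated:
  assumes "v \<in> letters" "w \<in> letters" "v \<noteq> w"
    and "x \<in> wing (side v)" "x \<noteq> 0" "y \<in> wing (side w)" "y \<noteq> 0"
  shows "\<epsilon> \<le> angle N x y"
proof (rule separated_angle[OF separated letters_cases(1)[OF assms(1)] letters_cases(1)[OF assms(2)]
      letters_cases(2)[OF assms(1)] letters_cases(2)[OF assms(2)]])
  show "(fst v, snd v) \<noteq> (fst w, snd w)"
    using assms(3) by simp
qed (use assms in \<open>simp_all add: side_def\<close>)

lemma frame_wings_separated:
  assumes "i \<in> {1..n}" and "x \<in> wing (fst (W i))" "y \<in> wing (snd (W i))" "x \<noteq> 0" "y \<noteq> 0"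
  shows "\<epsilon> \<le> angle N x y"
  using wings_separated[of "(i, - 1)" "(i, 1)" x y] assms
  by (auto simp: letters_def side_def frame_side_def)

lemma mem_cone_iff:
  assumes "w \<in> letters"
  shows "x \<in> cone w \<longleftrightarrow> x \<noteq> 0 \<and>
    (\<exists>y\<in>wing (side w) - {0}. angle (frame_form Q S (W (fst w))) x y < r (fst w))"
proof -
  interpret M: pos_form "frame_form Q S (W (fst w))"
    by (intro frame_form_pos frame_letter letters_cases assms)
  show ?thesis
    using M.ray_in_ball_S_iff[of x] by (auto simp: cone_def H_S_def side_def)
qed

lemma cone_near_wing:
  assumes "w \<in> letters" and "x \<in> cone w"
  obtains y where "y \<in> wing (side w)" and "y \<noteq> 0" and "angle N x y < \<epsilon> / 3"
proof -
  obtain y where y: "y \<in> wing (side w)" "y \<noteq> 0" "x \<noteq> 0"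
    "angle (frame_form Q S (W (fst w))) x y < r (fst w)"
    using assms mem_cone_iff by blast
  have "fst w \<in> {1..n}"
    using letters_cases assms(1) by blast
  then have "angle N x y < \<epsilon> / 3"
    using admissible_radius_angle[OF frame_letter] radii y by blast
  with y show thesis
    using that by blast
qed

lemma side_subset_cone:
  assumes "w \<in> letters" and "x \<in> side w" "x \<noteq> 0"
  shows "x \<in> cone w"
proof -
  interpret M: pos_form "frame_form Q S (W (fst w))"
    by (intro frame_form_pos frame_letter letters_cases assms)
  have "0 < r (fst w)"
    using radii[of "fst w"] \<theta> letters_cases(1)[OF assms(1)] by force
  then have "angle (frame_form Q S (W (fst w))) x x < r (fst w)"
    using assms(3) by (simp add: M.angle_self)
  moreover have "x \<in> wing (side w) - {0}"
    using MTIS_le_wing[OF side_MTIS[OF assms(1)]] assms(2,3) by blast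
  ultimately show ?thesis
    unfolding mem_cone_iff[OF assms(1)] using assms(3) by blast
qed

lemma cone_scale:
  assumes "w \<in> letters" and "x \<in> cone w" and "0 < c"
  shows "c *\<^sub>R x \<in> cone w"
proof -
  interpret M: pos_form "frame_form Q S (W (fst w))"
    by (intro frame_form_pos frame_letter letters_cases assms)
  show ?thesis
    using assms(2,3) by (auto simp: mem_cone_iff[OF assms(1)] M.angle_scale_left)
qed

text \<open>Of the angle \<epsilon> between two wings each cone uses up at most \<epsilon> / 3, so
  \<epsilon> / 3 remains between \<open>x\<close> and \<open>y\<close>. The left side is then at
  most the distance from \<open>x\<close> to the ray of \<open>y\<close>.\<close>

lemma cone_gap:
  assumes "v \<in> letters" "w \<in> letters" "v \<noteq> w" and "x \<in> cone v" "y \<in> cone w"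
  shows "sin (\<epsilon> / 3) * sqrt (N x) \<le> sqrt (N (x - y))"
proof -
  have ne: "x \<noteq> 0" "y \<noteq> 0"
    using assms(4,5) by (simp_all add: cone_def)
  obtain x' where x': "x' \<in> wing (side v)" "x' \<noteq> 0" "angle N x x' < \<epsilon> / 3"
    by (rule cone_near_wing[OF assms(1,4)])
  obtain y' where y': "y' \<in> wing (side w)" "y' \<noteq> 0" "angle N y y' < \<epsilon> / 3"
    by (rule cone_near_wing[OF assms(2,5)])
  have "\<epsilon> \<le> angle N x' y'"
    by (rule wings_separated[OF assms(1-3) x'(1,2) y'(1,2)])
  also have "\<dots> \<le> angle N x' x + (angle N x y + angle N y y')"
    using N.angle_triangle[OF x'(2) ne(1) y'(2)] N.angle_triangle[OF ne y'(2)] by linarith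
  finally have "\<epsilon> / 3 \<le> angle N x y"
    using x'(3) y'(3) by (simp add: N.angle_commute[of x' x])
  then have polar: "polar N x y \<le> cos (\<epsilon> / 3) * (sqrt (N x) * sqrt (N y))"
    using N.angle_less_iff[OF ne, of "\<epsilon> / 3"] \<epsilon> by simp
  \<comment> \<open>Completing the square in the length of \<open>y\<close>.\<close>
  have "(sin (\<epsilon> / 3) * sqrt (N x))\<^sup>2 \<le>
      (sin (\<epsilon> / 3) * sqrt (N x))\<^sup>2 + (sqrt (N y) - cos (\<epsilon> / 3) * sqrt (N x))\<^sup>2"
    by simp
  also have "\<dots> = N x + N y - 2 * (cos (\<epsilon> / 3) * (sqrt (N x) * sqrt (N y)))"
    by (simp add: power_mult_distrib power2_diff sin_squared_eq algebra_simps)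
  also have "\<dots> \<le> N (x - y)"
    using polar by (simp add: N.form_diff)
  finally show ?thesis
    by (intro real_le_rsqrt)
qed

lemma cones_disjoint:
  assumes "v \<in> letters" "w \<in> letters" "v \<noteq> w" and "x \<in> cone v"
  shows "x \<notin> cone w"
proof
  assume "x \<in> cone w"
  then have "sin (\<epsilon> / 3) * sqrt (N x) \<le> 0"
    using cone_gap[OF assms] by fastforce
  moreover have "0 < sin (\<epsilon> / 3)"
    using \<epsilon> by (intro sin_gt_zero) auto
  moreover have "0 < sqrt (N x)"
    using assms(4) by (simp add: cone_def N.form_pos)
  ultimately show False
    by (meson mult_pos_pos not_le)
qed

lemma lin_bar:
  assumes "w \<in> letters"
  shows "lin w *v (lin (bar w) *v x) = x" and "lin (bar w) *v (lin w *v x) = x"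
  using signed_power_inverse[OF generator_invertible, of "fst w" "snd w" x]
    signed_power_inverse[OF generator_invertible, of "fst w" "- snd w" x] letters_cases[OF assms]
  by (auto simp: lin_def bar_def)

lemma lin_polar:
  assumes "w \<in> letters"
  shows "polar Q (lin w *v x) (lin w *v y) = polar Q x y"
  unfolding lin_def by (intro O_group_signed_power_polar generator_O letters_cases assms)

lemma lin_form:
  assumes "w \<in> letters"
  shows "Q (lin w *v x) = Q x"
  using lin_polar[OF assms, of x x] by simp

lemma lin_neq_0: "w \<in> letters \<Longrightarrow> x \<noteq> 0 \<Longrightarrow> lin w *v x \<noteq> 0"
  using lin_bar(2)[of w x] by auto

lemma lin_maps_cone:
  assumes "w \<in> letters" and "x \<noteq> 0" and "x \<notin> cone (bar w)"
  shows "lin w *v x \<in> cone w"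
proof -
  have i: "fst w \<in> {1..n}" "snd w \<in> {- 1, 1}"
    using letters_cases[OF assms(1)] by auto
  have "ray x \<notin> H_S Q S oV oP (W (fst w)) (r (fst w)) (- snd w)"
    using assms(2,3) by (simp add: cone_def bar_def)
  then have "ray (lin w *v x) \<in> H_S Q S oV oP (W (fst w)) (r (fst w)) (snd w)"
    unfolding lin_def
    using generator_dynamics(1)[OF frame_letter[OF i(1)] generator[OF i(1)] s(1,2) \<theta> _ \<epsilon>(1)
        frame_wings_separated[OF i(1)] i(2) assms(2)] radii[OF i(1)] by blast
  then show ?thesis
    using lin_neq_0[OF assms(1,2)] by (simp add: cone_def)
qed

text \<open>The frame form gives expansion by \<open>sin \<theta> / s\<close>. Comparing it with
  \<open>N\<close> costs 3 on one side and \<open>\<kappa> \<epsilon>\<close> on the other, and the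
  factor 4 for the squared length completes the 12 in the condition on \<open>s\<close>.\<close>

lemma lin_expands:
  assumes "w \<in> letters" and "x \<notin> cone (bar w)" and "- x \<notin> cone (bar w)"
  shows "sqrt (N x) \<le> 1 / 2 * sqrt (N (lin w *v x))"
proof (cases "x = 0")
  case False
  have i: "fst w \<in> {1..n}" "snd w \<in> {- 1, 1}"
    using letters_cases[OF assms(1)] by auto
  let ?M = "frame_form Q S (W (fst w))" and ?y = "lin w *v x"
  have "ray x \<notin> H_S Q S oV oP (W (fst w)) (r (fst w)) (- snd w)"
    "ray (- x) \<notin> H_S Q S oV oP (W (fst w)) (r (fst w)) (- snd w)"
    using assms(2,3) False by (simp_all add: cone_def bar_def)
  then have M: "(sin \<theta>)\<^sup>2 * ?M x \<le> s\<^sup>2 * ?M ?y"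
    unfolding lin_def
    using generator_dynamics(2)[OF frame_letter[OF i(1)] generator[OF i(1)] s(1,2) \<theta> _ \<epsilon>(1)
        frame_wings_separated[OF i(1)] i(2) False] radii[OF i(1)] by blast
  note comparison = frame_form_comparison[OF frame_letter[OF i(1)] \<epsilon> separated_frame[OF frames separated i(1)]]
  have "(sin \<theta>)\<^sup>2 * N x \<le> (sin \<theta>)\<^sup>2 * (3 * ?M x)"
    by (intro mult_left_mono comparison) auto
  also have "\<dots> \<le> 3 * (s\<^sup>2 * ?M ?y)"
    using M by simp
  also have "\<dots> \<le> 3 * (s\<^sup>2 * (\<kappa> \<epsilon> * N ?y))"
    by (intro mult_left_mono comparison) auto
  finally have "4 * ((sin \<theta>)\<^sup>2 * N x) \<le> (12 * \<kappa> \<epsilon> * s\<^sup>2) * N ?y"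
    by (simp add: algebra_simps)
  also have "\<dots> \<le> (sin \<theta>)\<^sup>2 * N ?y"
    by (intro mult_right_mono s(3)) simp
  finally have "(sin \<theta>)\<^sup>2 * (4 * N x) \<le> (sin \<theta>)\<^sup>2 * N ?y"
    by simp
  moreover have "0 < (sin \<theta>)\<^sup>2"
    using \<theta> sin_gt_zero[of \<theta>] by simp
  ultimately have "4 * N x \<le> N ?y"
    by (simp only: mult_le_cancel_left_pos)
  then have "sqrt (4 * N x) \<le> sqrt (N ?y)"
    by (rule real_sqrt_le_mono)
  then show ?thesis
    by (simp add: real_sqrt_mult)
qed simp

text \<open>The eigenvalue -1 is excluded on each summand of the frame: strict contraction or
  expansion forbids it on the sides, and on the middle line \<open>g i\<close> is the
  identity.\<close>

lemma half_translation_eq: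
  assumes i: "i \<in> {1..n}"
  shows "half_translation (g i) (t i) + g i *v half_translation (g i) (t i) = t i"
proof -
  note contraction = pseudohyperbolic_contraction[OF frame_letter[OF i] generator[OF i] s(1) s_less_1]
  interpret splitting "fst (W i)" "frame_mid Q (W i)" "snd (W i)"
    by (rule frame_splitting[OF frame_letter[OF i]])
  let ?h = "\<lambda>u. u + g i *v u"
  have lin_h: "linear ?h"
    by (intro linear_compose_add linear_ident matrix_vector_mul_linear)
  have "s\<^sup>2 < 1"
    using s(1) s_less_1 by (simp add: power_less_one_iff)
  have trivial: "v = 0" if "g i *v v = - v" "v \<in> fst (W i) \<or> v \<in> snd (W i)" for v
  proof (rule ccontr)
    assume "v \<noteq> 0"
    then have "s\<^sup>2 * N v < 1 * N v"
      using \<open>s\<^sup>2 < 1\<close> N.form_pos by (intro mult_strict_right_mono) auto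
    then show False
      using contraction(2)[of v] contraction(3)[of v] that by auto
  qed
  have "u = 0" if h: "?h u = 0" for u
  proof -
    obtain a b c where u: "a \<in> fst (W i)" "b \<in> frame_mid Q (W i)" "c \<in> snd (W i)" "u = a + b + c"
      using exists_parts by blast
    have "(a + g i *v a) + (b + b) + (c + g i *v c) = 0"
      using h u(4) contraction(6)[OF u(2)] by (simp add: matrix_vector_right_distrib algebra_simps)
    then have "a + g i *v a = 0 \<and> b + b = 0 \<and> c + g i *v c = 0"
      using u contraction(2)[OF u(1)] contraction(3)[OF u(3)]
      by (intro direct subspace_add subspaces) auto
    then have "g i *v a = - a" "b = 0" "g i *v c = - c"
      by (simp_all add: add_eq_0_iff scaleR_2[symmetric])
    then show "u = 0"
      using trivial[of a] trivial[of c] u by simp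
  qed
  then have "inj ?h"
    using linear_injective_0[OF lin_h] by blast
  then have "surj ?h"
    using linear_injective_imp_surjective[OF lin_h] by simp
  then obtain u where u: "u + g i *v u = t i"
    by (metis surjD)
  have "\<exists>!u. u + g i *v u = t i"
  proof (rule ex1I[of _ u])
    show "u + g i *v u = t i"
      by (rule u)
    show "v = u" if "v + g i *v v = t i" for v
      by (rule injD[OF \<open>inj ?h\<close>]) (simp add: u that)
  qed
  then show ?thesis
    unfolding half_translation_def by (rule theI')
qed

lemma H_aff_eq:
  "H_aff Q S oV oP (W (fst w)) (r (fst w)) (g (fst w)) (t (fst w)) (snd w) = (\<lambda>x. x + shift w) ` cone w"
  by (simp add: H_aff_def cone_def shift_def)

lemma translated_cones_disjoint:
  assumes "v \<in> letters" "w \<in> letters" "v \<noteq> w"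
  shows "closure ((\<lambda>x. x + shift v) ` cone v) \<inter> closure ((\<lambda>x. x + shift w) ` cone w) = {}"
proof -
  have "(fst v, snd v) \<noteq> (fst w, snd w)"
    using assms(3) by simp
  then show ?thesis
    using t_mem letters_cases[OF assms(1)] letters_cases[OF assms(2)]
    unfolding T_set_def H_aff_eq[symmetric] by blast
qed

text \<open>A point off the closure of a cone is therefore nonzero, as \<open>lin_maps_cone\<close>
  requires.\<close>

lemma zero_in_closure_cone:
  assumes "w \<in> letters"
  shows "0 \<in> closure (cone w)"
proof -
  obtain v where v: "v \<in> side w" "v \<noteq> 0"
    by (rule MTIS_nontrivial[OF side_MTIS[OF assms]])
  have "v \<in> cone w"
    by (rule side_subset_cone[OF assms v])
  then have "inverse (real (Suc k)) *\<^sub>R v \<in> cone w" for k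
    by (intro cone_scale[OF assms]) auto
  moreover have "(\<lambda>k. inverse (real (Suc k)) *\<^sub>R v) \<longlonglongrightarrow> 0 *\<^sub>R v"
    by (intro tendsto_intros LIMSEQ_inverse_real_of_nat)
  ultimately show ?thesis
    unfolding closure_sequential
    by (intro exI[of _ "\<lambda>k. inverse (real (Suc k)) *\<^sub>R v"] conjI allI) (simp_all only: scaleR_zero_left)
qed

lemma translated_closure_cone:
  "x \<in> closure ((\<lambda>x. x + a) ` X) \<longleftrightarrow> x - a \<in> closure X" for x a :: "real ^ 'n"
proof -
  have "closure ((\<lambda>x. x + a) ` X) = (\<lambda>x. x + a) ` closure X"
    using closure_translation[of a X] by (simp add: add.commute)
  moreover have "x = (x - a) + a"
    by simp
  ultimately show ?thesis
    by (auto intro: rev_image_eqI)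
qed

lemma region_minus: "region (i, - 1) = closure ((\<lambda>x. x + shift (i, - 1)) ` cone (i, - 1))"
  using H_aff_eq[of "(i, - 1)"] by (simp add: region_def H_tilde_def)

lemma region_plus: "region (i, 1) = closure (affine_map (g i) (t i) ` (UNIV - region (i, - 1)))"
  by (simp add: region_def H_tilde_def)

text \<open>From \<open>t = u + g u\<close> it follows that \<open>g x + t = g (x + u) + u\<close>.
  So the affine generator, read in coordinates centred at \<open>- u\<close> before and at
  \<open>u\<close> after the map, is its linear part, and the contraction of cones carries
  over.\<close>

lemma region_subset:
  assumes "w \<in> letters"
  shows "region w \<subseteq> closure ((\<lambda>x. x + shift w) ` cone w)"
proof (cases "snd w < 0")
  case True
  then have "w = (fst w, - 1)"
    using letters_cases[OF assms] by (auto simp: prod_eq_iff)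
  then show ?thesis
    using region_minus[of "fst w"] by simp
next
  case False
  then obtain i where w: "w = (i, 1)" and i: "i \<in> {1..n}"
    using letters_cases[OF assms] by (cases w) auto
  have minus: "(i, - 1) \<in> letters"
    using i by (simp add: letters_def)
  define u where "u = half_translation (g i) (t i)"
  have u: "u + g i *v u = t i"
    unfolding u_def by (rule half_translation_eq[OF i])
  have "affine_map (g i) (t i) ` (UNIV - region (i, - 1)) \<subseteq> (\<lambda>x. x + shift w) ` cone w"
  proof clarify
    fix x
    assume x: "x \<notin> region (i, - 1)"
    have eq: "x + u = x - shift (i, - 1)"
      by (simp add: shift_def u_def)
    have notin: "x + u \<notin> closure (cone (i, - 1))"
      using x unfolding region_minus translated_closure_cone eq .
    then have "x + u \<noteq> 0" "x + u \<notin> cone (bar w)"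
      using zero_in_closure_cone[OF minus] closure_subset by (auto simp: w bar_def)
    then have "lin w *v (x + u) \<in> cone w"
      by (intro lin_maps_cone assms)
    moreover have "lin w *v (x + u) + shift w = affine_map (g i) (t i) x"
      using u by (simp add: w lin_def signed_power_def shift_def u_def[symmetric] affine_map_def
          matrix_vector_right_distrib algebra_simps)
    ultimately show "affine_map (g i) (t i) x \<in> (\<lambda>x. x + shift w) ` cone w"
      by (metis imageI)
  qed
  then show ?thesis
    unfolding w region_plus by (intro closure_mono)
qed

lemma regions_disjoint:
  assumes "v \<in> letters" "w \<in> letters" "v \<noteq> w"
  shows "region v \<inter> region w = {}"
  using region_subset assms translated_cones_disjoint[OF assms] by blast

lemma act_add:
  "act w (x + l *\<^sub>R z) = act w x + l *\<^sub>R (lin w *v z)"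
  by (simp add: act_def lin_def signed_power_def affine_map_def matrix_vector_right_distrib
      matrix_vector_mult_scaleR matrix_vector_mult_diff_distrib algebra_simps)

lemma act_bar:
  assumes "w \<in> letters"
  shows "act w (act (bar w) x) = x"
  using letters_cases[OF assms] generator_invertible[of "fst w"]
  by (auto simp: act_def bar_def affine_map_def matrix_inv_mult_vector)

lemma continuous_act: "continuous_on A (act w)"
proof -
  have "continuous_on A (\<lambda>x. matrix_inv (g (fst w)) *v (x - t (fst w)))"
    by (rule linear_continuous_on_compose[OF _ matrix_vector_mul_linear])
      (intro continuous_on_diff continuous_on_id continuous_on_const)
  moreover have "continuous_on A (\<lambda>x. g (fst w) *v x + t (fst w))"
    by (intro continuous_on_add continuous_on_const
        linear_continuous_on_compose[OF continuous_on_id matrix_vector_mul_linear])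
  ultimately show ?thesis
    by (cases "snd w < 0") (simp_all add: act_def[abs_def] affine_map_def)
qed

text \<open>For a positive letter this is the definition of the region; for a negative one it is the
  contrapositive.\<close>

lemma act_maps_region:
  assumes "w \<in> letters" and "x \<notin> region (bar w)"
  shows "act w x \<in> region w"
proof (cases "snd w < 0")
  case True
  then obtain i where w: "w = (i, - 1)"
    using letters_cases[OF assms(1)] by (cases w) auto
  have eq: "affine_map (g i) (t i) (act w x) = x"
    using act_bar[OF bar_letter[OF assms(1)], of x] by (simp add: w bar_bar) (simp add: act_def bar_def)
  have "act w x \<notin> UNIV - region (i, - 1)"
  proof
    assume "act w x \<in> UNIV - region (i, - 1)"
    then have "affine_map (g i) (t i) (act w x) \<in> region (i, 1)"
      unfolding region_plus by (intro closure_subset[THEN subsetD] imageI)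
    then show False
      using assms(2) eq by (simp add: w bar_def)
  qed
  then show ?thesis
    by (simp add: w)
next
  case False
  then obtain i where w: "w = (i, 1)"
    using letters_cases[OF assms(1)] by (cases w) auto
  have "act w x \<in> affine_map (g i) (t i) ` (UNIV - region (i, - 1))"
    using assms(2) by (simp add: w act_def bar_def)
  then show ?thesis
    unfolding w region_plus by (rule closure_subset[THEN subsetD])
qed

text \<open>The image of the interior of \<open>region (i, - 1)\<close> under the generator is open
  and misses the image of the complement of that region, hence also the closure of this image, which
  is \<open>region (i, 1)\<close>.\<close>

lemma act_interior_region:
  assumes "w \<in> letters" and "x \<in> interior (region (bar w))"
  shows "act w x \<notin> interior (region w)"
proof -
  have plus: "act (i, 1) p \<notin> region (i, 1)" if i: "(i, 1) \<in> letters" and p: "p \<in> interior (region (i, - 1))" for i p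
  proof -
    have bar: "bar (i, 1) = (i, - 1)" "bar (i, - 1) = (i, 1)"
      by (simp_all add: bar_def)
    let ?U = "act (i, - 1) -` interior (region (i, - 1))"
    have "open ?U"
      by (intro open_vimage open_interior continuous_act)
    moreover have "?U \<inter> affine_map (g i) (t i) ` (UNIV - region (i, - 1)) = {}"
    proof -
      have "act (i, - 1) (affine_map (g i) (t i) q) = q" for q
        using act_bar[OF bar_letter[OF i], of q] by (simp add: bar) (simp add: act_def)
      then show ?thesis
        using interior_subset by fastforce
    qed
    ultimately have "?U \<inter> region (i, 1) = {}"
      unfolding region_plus by (simp add: open_Int_closure_eq_empty)
    moreover have "act (i, 1) p \<in> ?U"
      using p act_bar[OF bar_letter[OF i], of p] by (simp add: bar)
    ultimately show ?thesis
      by blast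
  qed
  show ?thesis
  proof (cases "snd w < 0")
    case True
    then obtain i where w: "w = (i, - 1)"
      using letters_cases[OF assms(1)] by (cases w) auto
    have bar: "bar w = (i, 1)"
      by (simp add: w bar_def)
    have "act (i, 1) (act w x) = x"
      using act_bar[OF bar_letter[OF assms(1)], of x] by (simp add: w bar_def)
    moreover have "(i, 1) \<in> letters"
      using bar_letter[OF assms(1)] by (simp only: bar)
    moreover have "x \<in> region (i, 1)"
      using assms(2) interior_subset unfolding bar by blast
    ultimately show ?thesis
      using plus[of i "act w x"] unfolding w by auto
  next
    case False
    then obtain i where w: "w = (i, 1)"
      using letters_cases[OF assms(1)] by (cases w) auto
    then show ?thesis
      using plus[of i x] assms interior_subset[of "region (i, 1)"] by (auto simp: bar_def)
  qed
qed

section \<open>Identification with the abstract ping-pong setting\<close>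

sublocale ping_pong_group letters bar act region "{1..n} \<times> {1}"
proof
  show "finite letters"
    by (simp add: letters_def)
  show "letters = {1..n} \<times> {1} \<union> bar ` ({1..n} \<times> {1})"
    by (force simp: letters_def bar_def)
  show "closed (region w)" for w
    by (simp add: region_def)
  show "bar w \<in> letters" if "w \<in> letters" for w
    by (rule bar_letter[OF that])
  show "bar (bar w) = w" for w
    by (rule bar_bar)
  show "act w (act (bar w) x) = x" if "w \<in> letters" for w x
    by (rule act_bar[OF that])
  show "continuous_on UNIV (act w)" for w
    by (rule continuous_act)
  show "region v \<inter> region w = {}" if "v \<in> letters" "w \<in> letters" "v \<noteq> w" for v w
    by (rule regions_disjoint[OF that])
  show "act w x \<in> region w" if "w \<in> letters" "x \<notin> region (bar w)" for w x
    by (rule act_maps_region[OF that])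
  show "act w x \<notin> interior (region w)" if "w \<in> letters" "x \<in> interior (region (bar w))" for w x
    by (rule act_interior_region[OF that])
qed

lemma domain_eq: "domain = H_zero Q S oV oP n W r g t"
  unfolding domain_def H_zero_def by (auto simp: letters_def region_def)

lemma \<Gamma>_eq: "\<Gamma> = affine_group n g t"
proof -
  have plus: "act (i, 1) = affine_map (g i) (t i)" for i
    by (rule ext) (simp add: act_def)
  have "{1..n} \<times> {1 :: real} = (\<lambda>i. (i, 1)) ` {1..n}"
    by auto
  then have "act ` ({1..n} \<times> {1}) = (\<lambda>i. affine_map (g i) (t i)) ` {1..n}"
    by (simp only: image_image plus)
  then show ?thesis
    by (simp only: \<Gamma>_def affine_group_def)
qed

text \<open>The regions lie in closures of translated cones; these are disjoint by the choice of
  \<open>t\<close> and spread apart at infinity by \<open>cone_gap\<close>. Finitely many pairs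
  leave a common width.\<close>

lemma regions_gap: "\<exists>c>0. \<forall>v\<in>letters. \<forall>w\<in>letters. v \<noteq> w \<longrightarrow>
    (\<forall>p\<in>region v. \<forall>q\<in>region w. c \<le> dist p q)"
proof -
  obtain m M where mM: "0 < m" "0 < M" "\<And>x. m * norm x \<le> sqrt (N x)" "\<And>x. sqrt (N x) \<le> M * norm x"
    by (rule N.norm_equivalence) blast
  have sin: "0 < sin (\<epsilon> / 3)"
    using \<epsilon> by (intro sin_gt_zero) auto
  have pair: "\<exists>c>0. \<forall>x. fst x \<in> region v \<and> snd x \<in> region w \<longrightarrow> c \<le> dist (fst x) (snd x)"
    if vw: "v \<in> letters" "w \<in> letters" "v \<noteq> w" for v w
  proof -
    have "0 < sin (\<epsilon> / 3) * m / M"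
      using sin mM by simp
    moreover have "sin (\<epsilon> / 3) * m / M * norm p \<le> norm (p - q)" if "p \<in> cone v" "q \<in> cone w" for p q
    proof -
      have "sin (\<epsilon> / 3) * (m * norm p) \<le> sin (\<epsilon> / 3) * sqrt (N p)"
        using sin mM(3) by (intro mult_left_mono) auto
      also have "\<dots> \<le> M * norm (p - q)"
        using cone_gap[OF vw that] mM(4)[of "p - q"] by linarith
      finally show ?thesis
        using mM(2) by (simp add: pos_divide_le_eq mult_ac)
    qed
    ultimately obtain c where "0 < c" "\<And>x y. x \<in> closure ((\<lambda>x. x + shift v) ` cone v) \<Longrightarrow>
        y \<in> closure ((\<lambda>x. x + shift w) ` cone w) \<Longrightarrow> c \<le> dist x y"
      using closed_cones_translates_gap[OF _ _ translated_cones_disjoint[OF vw]] by blast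
    then show ?thesis
      using region_subset[OF vw(1)] region_subset[OF vw(2)] by (intro exI[of _ c]) auto
  qed
  let ?P = "\<lambda>a x. fst x \<in> region (fst a) \<and> snd x \<in> region (snd a)"
  have "\<exists>c>0. \<forall>a\<in>{(v, w). v \<in> letters \<and> w \<in> letters \<and> v \<noteq> w}. \<forall>x. ?P a x \<longrightarrow> c \<le> dist (fst x) (snd x)"
  proof (rule finite_uniform_positive)
    have "finite (letters \<times> letters)"
      by (simp add: letters_def)
    then show "finite {(v, w). v \<in> letters \<and> w \<in> letters \<and> v \<noteq> w}"
      by (rule rev_finite_subset) auto
    fix a
    assume "a \<in> {(v, w). v \<in> letters \<and> w \<in> letters \<and> v \<noteq> w}"
    then show "\<exists>c>0. \<forall>x. ?P a x \<longrightarrow> c \<le> dist (fst x) (snd x)"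
      using pair[of "fst a" "snd a"] by (simp add: case_prod_beta)
  qed
  then show ?thesis
    by fastforce
qed

section \<open>Directions that stay bounded along an infinite word\<close>

lemma lin_bounded: "\<exists>B\<ge>0. \<forall>w\<in>letters. \<forall>x. sqrt (N (lin w *v x)) \<le> B * sqrt (N x)"
proof -
  obtain m M where mM: "0 < m" "0 < M" "\<And>x. m * norm x \<le> sqrt (N x)" "\<And>x. sqrt (N x) \<le> M * norm x"
    by (rule N.norm_equivalence) blast
  define B where "B = (\<Sum>w\<in>letters. M * onorm ((*v) (lin w)) / m)"
  have lin_onorm: "bounded_linear ((*v) (lin w))" "0 \<le> onorm ((*v) (lin w))" for w
    by (simp_all add: onorm_pos_le matrix_vector_mul_bounded_linear)
  have nonneg: "0 \<le> M * onorm ((*v) (lin w)) / m" for w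
    using mM lin_onorm by simp
  have "sqrt (N (lin w *v x)) \<le> B * sqrt (N x)" if "w \<in> letters" for w x
  proof -
    have "sqrt (N (lin w *v x)) \<le> M * norm (lin w *v x)"
      by (rule mM)
    also have "\<dots> \<le> M * (onorm ((*v) (lin w)) * norm x)"
      using mM(2) onorm[OF lin_onorm(1)[of w], of x] by (intro mult_left_mono) auto
    also have "\<dots> = M * onorm ((*v) (lin w)) / m * (m * norm x)"
      using mM(1) by simp
    also have "\<dots> \<le> M * onorm ((*v) (lin w)) / m * sqrt (N x)"
      by (intro mult_left_mono mM nonneg)
    also have "\<dots> \<le> B * sqrt (N x)"
      unfolding B_def using that nonneg finite_letters
      by (intro mult_right_mono member_le_sum) auto
    finally show ?thesis .
  qed
  moreover have "0 \<le> B"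
    unfolding B_def by (intro sum_nonneg nonneg)
  ultimately show ?thesis
    by blast
qed

text \<open>The chain is built backwards from the side of the letter \<open>w K\<close>, by applying
  the preceding letters. The word is reduced, so \<open>U (Suc k)\<close> lies in a cone other than
  that of \<open>bar (w k)\<close>; hence \<open>lin (w k)\<close> maps it into the cone of
  \<open>w k\<close> and expands it. The induction shifts the word and prepends one
  subspace.\<close>

lemma isotropic_chain:
  assumes "\<And>k. w k \<in> letters" and "\<And>k. w (Suc k) \<noteq> bar (w k)"
  shows "\<exists>U. (\<forall>k\<le>K. totally_isotropic Q (U k) \<and> dim (U k) = CARD('d) \<and> U k - {0} \<subseteq> cone (w k)) \<and>
    (\<forall>k<K. U k = (*v) (lin (w k)) ` U (Suc k) \<and>
      (\<forall>x\<in>U (Suc k). sqrt (N x) \<le> 1 / 2 * sqrt (N (lin (w k) *v x))))"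
  using assms
proof (induction K arbitrary: w)
  case 0
  have "MTIS Q (side (w 0))"
    by (rule side_MTIS[OF 0(1)])
  then show ?case
    using MTIS_isotropic MTIS_dim side_subset_cone[OF 0(1)] by (intro exI[of _ "\<lambda>_. side (w 0)"]) auto
next
  case (Suc K)
  obtain U where U: "\<forall>k\<le>K. totally_isotropic Q (U k) \<and> dim (U k) = CARD('d) \<and> U k - {0} \<subseteq> cone (w (Suc k))"
    "\<forall>k<K. U k = (*v) (lin (w (Suc k))) ` U (Suc k) \<and>
      (\<forall>x\<in>U (Suc k). sqrt (N x) \<le> 1 / 2 * sqrt (N (lin (w (Suc k)) *v x)))"
    using Suc.IH[of "\<lambda>k. w (Suc k)", OF Suc.prems] by (elim exE conjE)
  let ?f = "(*v) (lin (w 0))"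
  have U0: "totally_isotropic Q (U 0)" "dim (U 0) = CARD('d)" "U 0 - {0} \<subseteq> cone (w 1)"
    using U(1)[rule_format, of 0] by simp_all
  have outside: "x \<notin> cone (bar (w 0))" if "x \<in> U 0" for x
  proof (cases "x = 0")
    case False
    then have "x \<in> cone (w (Suc 0))"
      using U0(3) that by auto
    then show ?thesis
      using Suc.prems bar_letter by (intro cones_disjoint[of "w (Suc 0)"]) auto
  qed (simp add: cone_def)
  have sub: "subspace (U 0)"
    using U0(1) by (simp add: totally_isotropic_def)
  have lin_f: "linear ?f"
    by (rule matrix_vector_mul_linear)
  have "inj_on ?f (U 0)"
    using lin_bar(2)[OF Suc.prems(1)] by (intro inj_on_inverseI)
  then have "dim (?f ` U 0) = CARD('d)"
    using dim_image_eq[OF lin_f, of "U 0"] U0(2) sub by (simp add: span_eq_iff[THEN iffD2])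
  moreover have "totally_isotropic Q (?f ` U 0)"
    using linear_subspace_image[OF lin_f sub] U0(1) lin_form[OF Suc.prems(1)]
    by (auto simp: totally_isotropic_def)
  moreover have "?f ` U 0 - {0} \<subseteq> cone (w 0)"
  proof
    fix y
    assume "y \<in> ?f ` U 0 - {0}"
    then obtain x where x: "x \<in> U 0" "y = lin (w 0) *v x" "y \<noteq> 0"
      by blast
    then have "x \<noteq> 0"
      by auto
    then show "y \<in> cone (w 0)"
      unfolding x(2) by (intro lin_maps_cone Suc.prems outside x)
  qed
  \<comment> \<open>Expansion requires both \<open>x\<close> and \<open>- x\<close> to avoid the
    repelling cone, which is why whole subspaces are carried along and not only vectors of a
    cone.\<close>
  moreover have "sqrt (N x) \<le> 1 / 2 * sqrt (N (lin (w 0) *v x))" if "x \<in> U 0" for x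
    using outside[OF that] outside[OF subspace_neg[OF sub that]] by (intro lin_expands Suc.prems)
  ultimately have first: "totally_isotropic Q (?f ` U 0) \<and> dim (?f ` U 0) = CARD('d) \<and> ?f ` U 0 - {0} \<subseteq> cone (w 0)"
    and expand: "\<forall>x\<in>U 0. sqrt (N x) \<le> 1 / 2 * sqrt (N (lin (w 0) *v x))"
    by blast+
  define V where "V = case_nat (?f ` U 0) U"
  have V: "V 0 = ?f ` U 0" "V (Suc k) = U k" for k
    by (simp_all add: V_def)
  show ?case
  proof (rule exI[of _ V], intro conjI[of "\<forall>k\<le>Suc K. _ k"] allI impI)
    fix k
    assume "k \<le> Suc K"
    then show "totally_isotropic Q (V k) \<and> dim (V k) = CARD('d) \<and> V k - {0} \<subseteq> cone (w k)"
      using first U(1) by (cases k) (simp_all only: V Suc_le_mono)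
  next
    fix k
    assume k: "k < Suc K"
    show "V k = (*v) (lin (w k)) ` V (Suc k) \<and>
        (\<forall>x\<in>V (Suc k). sqrt (N x) \<le> 1 / 2 * sqrt (N (lin (w k) *v x)))"
    proof (cases k)
      case 0
      show ?thesis
        unfolding 0 V using expand by blast
    next
      case (Suc j)
      then have "j < K"
        using k by simp
      then show ?thesis
        unfolding Suc V using U(2) by blast
    qed
  qed
qed

text \<open>
  The direction \<open>z 0\<close> is orthogonal, for \<open>Q\<close>, to an isotropic subspace that all inverse steps of the
  word contract, and, for \<open>N\<close>, to the side of the first letter.
\<close>

lemma bounded_directions:
  assumes w: "\<And>k. w k \<in> letters" "\<And>k. w (Suc k) \<noteq> bar (w k)"
    and B: "0 \<le> B" "\<And>v x. v \<in> letters \<Longrightarrow> sqrt (N (lin v *v x)) \<le> B * sqrt (N x)"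
  obtains z :: "nat \<Rightarrow> real ^ 'n" where "N (z 0) = 1" and "\<And>y. y \<in> wing (side (w 0)) \<Longrightarrow> polar N (z 0) y \<le> 0"
    and "\<And>k. z (Suc k) = lin (bar (w k)) *v z k" and "\<And>k. k \<le> K \<Longrightarrow> sqrt (N (z k)) \<le> 2 + 2 * B"
proof -
  obtain U where chain: "\<forall>k\<le>K. totally_isotropic Q (U k) \<and> dim (U k) = CARD('d) \<and> U k - {0} \<subseteq> cone (w k)"
    "\<forall>k<K. U k = (*v) (lin (w k)) ` U (Suc k) \<and>
      (\<forall>x\<in>U (Suc k). sqrt (N x) \<le> 1 / 2 * sqrt (N (lin (w k) *v x)))"
    using isotropic_chain[of w, OF w, of K] by (elim exE conjE)
  have U: "k \<le> K \<Longrightarrow> totally_isotropic Q (U k) \<and> dim (U k) = CARD('d)"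
    "k < K \<Longrightarrow> U k = (*v) (lin (w k)) ` U (Suc k) \<and>
      (\<forall>x\<in>U (Suc k). sqrt (N x) \<le> 1 / 2 * sqrt (N (lin (w k) *v x)))" for k
    using chain by simp_all
  have V: "MTIS Q (side (w 0))"
    by (rule side_MTIS[OF w(1)])
  \<comment> \<open>Twice \<open>d\<close> against \<open>2 * d + 1\<close>: exactly one dimension
    is left over.\<close>
  have "dim (U 0) + dim (side (w 0)) < DIM(real ^ 'n)"
    using U(1)[of 0] MTIS_dim[OF V] dim_space by simp
  then obtain z' where z': "z' \<noteq> 0" "\<And>x. x \<in> U 0 \<Longrightarrow> polar Q z' x = 0" "\<And>y. y \<in> side (w 0) \<Longrightarrow> polar N z' y = 0"
    using exists_orthogonal_to_two[OF bilinear_polar N.bilinear_polar] by blast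
  obtain e where e: "wing (side (w 0)) = {v + x *\<^sub>R e |v x. v \<in> side (w 0) \<and> 0 \<le> x}"
    by (rule wing_halfspace[OF V])
  \<comment> \<open>Normalizes \<open>z'\<close> and picks the sign for which it makes an obtuse or
    right angle with the direction \<open>e\<close> of the wing. On the side itself orthogonality
    already holds for both signs.\<close>
  define \<tau> :: real where "\<tau> = (if polar N z' e \<le> 0 then 1 else - 1) / sqrt (N z')"
  have \<tau>: "\<tau> * polar N z' e \<le> 0" "\<tau>\<^sup>2 * N z' = 1"
    using N.form_pos[OF z'(1)] by (auto simp: \<tau>_def power_divide divide_nonpos_pos)
  define z where "z = rec_nat (\<tau> *\<^sub>R z') (\<lambda>k x. lin (bar (w k)) *v x)"
  have z0: "z 0 = \<tau> *\<^sub>R z'" and zSuc: "z (Suc k) = lin (bar (w k)) *v z k" for k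
    by (simp_all add: z_def)
  have Nz0: "N (z 0) = 1"
    using \<tau>(2) by (simp add: z0 N.form_scale)
  have Qz: "Q (z k) = Q (z 0)" for k
    by (induction k) (simp_all add: zSuc lin_form bar_letter w)
  have perp: "k \<le> K \<Longrightarrow> z k \<in> perp Q (U k)" for k
  proof (induction k)
    case 0
    then show ?case
      using z'(2) by (simp add: z0 perp_def polar_simps)
  next
    case (Suc k)
    have "polar Q (z (Suc k)) u = 0" if "u \<in> U (Suc k)" for u
    proof -
      have "polar Q (z (Suc k)) u = polar Q (lin (w k) *v z (Suc k)) (lin (w k) *v u)"
        by (simp add: lin_polar w)
      also have "\<dots> = polar Q (z k) (lin (w k) *v u)"
        by (simp add: zSuc lin_bar w)
      also have "lin (w k) *v u \<in> U k"
        using U(2)[of k] Suc.prems that by auto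
      then have "polar Q (z k) (lin (w k) *v u) = 0"
        using Suc by (simp add: perp_def)
      finally show ?thesis .
    qed
    then show ?case
      by (simp add: perp_def)
  qed
  \<comment> \<open>The component in \<open>U k\<close> is at least halved, and the remainder has
    length at most 1 because \<open>Q\<close> is preserved. The recursion \<nu>' \<le> (\<nu> + 1) /
    2 + \<open>B\<close> keeps \<nu> below \<open>2 + 2 * B\<close>.\<close>
  have bound: "k \<le> K \<Longrightarrow> sqrt (N (z k)) \<le> 2 + 2 * B" for k
  proof (induction k)
    case 0
    then show ?case
      using Nz0 B(1) by simp
  next
    case (Suc k)
    then have k: "k \<le> K" "k < K"
      by auto
    obtain v b where vb: "v \<in> U k" "z k = v + b" "N b = Q (z k)"
      using perp_isotropic_decomposition[OF _ _ perp[OF k(1)]] U(1)[OF k(1)] by blast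
    have "N b \<le> 1"
      using vb(3) Qz[of k] abs_Q_le_N[of "z 0"] Nz0 by simp
    then have b: "sqrt (N b) \<le> 1"
      by simp
    obtain u where u: "u \<in> U (Suc k)" "v = lin (w k) *v u"
      using U(2)[OF k(2)] vb(1) by auto
    have "z (Suc k) = u + lin (bar (w k)) *v b"
      by (simp add: zSuc vb(2) u(2) matrix_vector_right_distrib lin_bar w)
    then have "sqrt (N (z (Suc k))) \<le> sqrt (N u) + sqrt (N (lin (bar (w k)) *v b))"
      using N.form_triangle by simp
    moreover have "sqrt (N (lin (bar (w k)) *v b)) \<le> B"
      using B(2)[OF bar_letter[OF w(1)], of k b] mult_left_mono[OF b B(1)] by simp
    moreover have "sqrt (N u) \<le> 1 / 2 * sqrt (N v)"
      using U(2)[OF k(2)] u by blast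
    moreover have "sqrt (N v) \<le> sqrt (N (z k)) + sqrt (N b)"
      using N.form_triangle_diff[of "z k" b] vb(2) by simp
    ultimately show ?case
      using Suc.IH[OF k(1)] b by linarith
  qed
  show thesis
  proof (rule that[OF Nz0 _ zSuc bound])
    show "polar N (z 0) y \<le> 0" if y: "y \<in> wing (side (w 0))" for y
    proof -
      obtain v x where vx: "y = v + x *\<^sub>R e" "v \<in> side (w 0)" "0 \<le> x"
        using y e by blast
      then have "polar N (z 0) y = x * (\<tau> * polar N z' e)"
        using z'(3) by (simp add: z0 N.polar_simps)
      then show ?thesis
        using \<tau>(1) vx(3) by (simp add: mult_nonneg_nonpos)
    qed
  qed
qed

text \<open>A point \<open>p'\<close> of the cone makes an angle below \<open>pi / 3\<close> with
  some wing vector \<open>y\<close>, so its product with \<open>y\<close> exceeds half the product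
  of the lengths. The summand \<open>l *\<^sub>R z\<close> contributes nothing positive to this
  product. With \<open>R\<close> the length of \<open>x - shift w\<close> and an error of at most 1
  for the closure, \<open>p'\<close> is shorter than \<open>2 * (1 + R)\<close>, whence
  \<open>l < 3 * R + 3\<close>.\<close>

lemma obtuse_direction_escapes:
  assumes w: "w \<in> letters" and z: "N z = 1" "\<And>y. y \<in> wing (side w) \<Longrightarrow> polar N z y \<le> 0"
    and l: "3 * sqrt (N (x - shift w)) + 3 < l"
  shows "x + l *\<^sub>R z \<notin> region w"
proof
  assume "x + l *\<^sub>R z \<in> region w"
  then have "x + l *\<^sub>R z \<in> closure ((\<lambda>x. x + shift w) ` cone w)"
    using region_subset[OF w] by blast
  define R where "R = sqrt (N (x - shift w))"
  define p where "p = x - shift w + l *\<^sub>R z"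
  have "0 \<le> R"
    by (simp add: R_def)
  have "p \<in> closure (cone w)"
    using \<open>x + l *\<^sub>R z \<in> closure _\<close> unfolding translated_closure_cone by (simp add: p_def algebra_simps)
  obtain m M where mM: "0 < m" "0 < M" "\<And>x. m * norm x \<le> sqrt (N x)" "\<And>x. sqrt (N x) \<le> M * norm x"
    by (rule N.norm_equivalence) blast
  obtain p' where p': "p' \<in> cone w" "dist p' p < 1 / M"
    using \<open>p \<in> closure (cone w)\<close> mM(2) by (meson closure_approachable divide_pos_pos zero_less_one)
  have "M * norm (p' - p) < 1"
    using p'(2) mM(2) by (simp add: dist_norm pos_less_divide_eq mult.commute)
  then have close: "sqrt (N (p' - p)) \<le> 1"
    using mM(4)[of "p' - p"] by linarith
  obtain y where y: "y \<in> wing (side w)" "y \<noteq> 0" "angle N p' y < \<epsilon> / 3"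
    by (rule cone_near_wing[OF w p'(1)])
  have "p' \<noteq> 0"
    using p'(1) by (simp add: cone_def)
  have "angle N p' y < pi / 3"
    using y(3) \<epsilon> by simp
  then have "1 / 2 * (sqrt (N p') * sqrt (N y)) < polar N p' y"
    using N.angle_less_iff[OF \<open>p' \<noteq> 0\<close> y(2), of "pi / 3"] by (simp add: cos_60)
  also have "polar N p' y = polar N (p' - p) y + polar N (x - shift w) y + l * polar N z y"
    by (simp add: p_def N.polar_simps)
  also have "\<dots> \<le> 1 * sqrt (N y) + R * sqrt (N y) + 0"
  proof (intro add_mono)
    have "polar N (p' - p) y \<le> sqrt (N (p' - p)) * sqrt (N y)"
      using N.Cauchy_Schwarz[of "p' - p" y] by linarith
    also have "\<dots> \<le> 1 * sqrt (N y)"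
      using close by (intro mult_right_mono) auto
    finally show "polar N (p' - p) y \<le> 1 * sqrt (N y)" .
    show "polar N (x - shift w) y \<le> R * sqrt (N y)"
      using N.Cauchy_Schwarz[of "x - shift w" y] by (simp add: R_def)
    have "0 \<le> l"
      using l \<open>0 \<le> R\<close> unfolding R_def by linarith
    then show "l * polar N z y \<le> 0"
      using z(2)[OF y(1)] by (rule mult_nonneg_nonpos)
  qed
  finally have "(1 / 2 * sqrt (N p')) * sqrt (N y) < (1 + R) * sqrt (N y)"
    by (simp add: algebra_simps)
  then have "1 / 2 * sqrt (N p') < 1 + R"
    by (rule mult_right_less_imp_less) simp
  moreover have "0 < l"
    using l \<open>0 \<le> R\<close> unfolding R_def by linarith
  then have "l = sqrt (N (l *\<^sub>R z))"
    by (simp add: N.sqrt_form_scale z(1))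
  moreover have "l *\<^sub>R z = p' - (p' - p) - (x - shift w)"
    by (simp add: p_def)
  then have "sqrt (N (l *\<^sub>R z)) \<le> sqrt (N p') + sqrt (N (p' - p)) + R"
    using N.form_triangle_diff[of "p' - (p' - p)" "x - shift w"] N.form_triangle_diff[of p' "p' - p"]
    unfolding R_def by simp
  ultimately show False
    using close l unfolding R_def by linarith
qed

lemma images_cover: "(\<Union>f\<in>\<Gamma>. closure (f ` domain)) = UNIV"
proof (rule ccontr)
  assume "(\<Union>f\<in>\<Gamma>. closure (f ` domain)) \<noteq> UNIV"
  then obtain x where x: "x \<notin> (\<Union>f\<in>\<Gamma>. closure (f ` domain))"
    by blast
  obtain w y where y0: "y 0 = x" and w: "\<And>k. w k \<in> letters" "\<And>k. w (Suc k) \<noteq> bar (w k)"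
    and y: "\<And>k. y k \<in> region (w k)" "\<And>k. y (Suc k) = act (bar (w k)) (y k)"
    by (rule infinite_word[OF x]) blast
  obtain m M where mM: "0 < m" "0 < M" "\<And>x. m * norm x \<le> sqrt (N x)" "\<And>x. sqrt (N x) \<le> M * norm x"
    by (rule N.norm_equivalence) blast
  obtain B where B: "0 \<le> B" "\<And>v x. v \<in> letters \<Longrightarrow> sqrt (N (lin v *v x)) \<le> B * sqrt (N x)"
    using lin_bounded by blast
  obtain c where c: "0 < c" "\<And>u v p q. u \<in> letters \<Longrightarrow> v \<in> letters \<Longrightarrow> u \<noteq> v \<Longrightarrow>
      p \<in> region u \<Longrightarrow> q \<in> region v \<Longrightarrow> c \<le> dist p q"
    using regions_gap by blast
  define C where "C = (2 + 2 * B) / m"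
  define l where "l = 3 * sqrt (N (x - shift (w 0))) + 4"
  have "0 < C"
    using B(1) mM(1) by (simp add: C_def)
  \<comment> \<open>Only the direction \<open>z\<close> depends on \<open>K\<close>;
    \<open>c\<close>, \<open>C\<close> and \<open>l\<close> are fixed beforehand, and this gives the
    contradiction.\<close>
  have "real K * (c / (2 * C)) \<le> l" for K
  proof -
    obtain z where z: "N (z 0) = 1" "\<And>y. y \<in> wing (side (w 0)) \<Longrightarrow> polar N (z 0) y \<le> 0"
      "\<And>k. z (Suc k) = lin (bar (w k)) *v z k" "\<And>k. k \<le> K \<Longrightarrow> sqrt (N (z k)) \<le> 2 + 2 * B"
      by (rule bounded_directions[of w B K, OF w B]) blast+
    show ?thesis
    proof (rule gap_estimate[of letters bar act region w y K z C c l, OF ping_pong_axioms w y])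
      show "act (bar (w k)) (y k + l *\<^sub>R z k) = y (Suc k) + l *\<^sub>R z (Suc k)" for k l
        by (simp add: act_add y(2) z(3))
      show "norm (z k) \<le> C" if "k \<le> K" for k
        using z(4)[OF that] mM(1) mM(3)[of "z k"] unfolding C_def by (simp add: pos_le_divide_eq mult.commute)
      show "y 0 + l *\<^sub>R z 0 \<notin> region (w 0)"
        using obtuse_direction_escapes[OF w(1) z(1,2)] by (simp add: y0 l_def)
      show "0 \<le> l"
        by (simp add: l_def)
    qed (use c \<open>0 < C\<close> in auto)
  qed
  moreover obtain K :: nat where "l < real K * (c / (2 * C))"
    using reals_Archimedean3[of "c / (2 * C)"] c(1) \<open>0 < C\<close> by auto
  ultimately show False
    using not_le by blast
qed

lemma fundamental_domain_H_zero:
  "fundamental_domain (affine_group n g t) (H_zero Q S oV oP n W r g t)"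
  unfolding fundamental_domain_def domain_eq[symmetric] \<Gamma>_eq[symmetric]
  using disjoint_images images_cover by blast

end

text \<open>The first clause provides a radius that is admissible for all \<epsilon>-separated
  framesets at once, so the lower bound in the second clause can be met. With that radius as
  \<delta>, the contraction constant is determined by \<epsilon> alone, for the fixed ambient
  data.\<close>

theorem proposition5p5:
  fixes Q :: "real ^ 'n \<Rightarrow> real"
    and S :: "(real ^ 'n) set"
    and oV :: "(real ^ 'n) set \<Rightarrow> (real ^ 'n ^ 'd) set"
    and oP :: "(real ^ 'n) set \<Rightarrow> (real ^ 'n ^ 'd option) set"
  assumes "odd CARD('d)"
    and "CARD('n) = 2 * CARD('d) + 1"
    and "quadratic_form Q"
    and "has_signature Q (CARD('d) + 1) CARD('d)"
    and "max_pos_def_subspace Q S"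
    and "compatible_orientations Q oV oP"
  shows "\<forall>\<epsilon>>0.
    (\<exists>\<delta>>0. \<forall>n W. frameset Q n W \<longrightarrow> separated Q S oV oP \<epsilon> n W \<longrightarrow>
       (\<forall>i\<in>{1..n}. admissible_radius Q S \<epsilon> (W i) \<delta>)) \<and>
    (\<forall>\<delta>>0. \<exists>s3>0. \<forall>n W g r t.
       frameset Q n W \<longrightarrow> separated Q S oV oP \<epsilon> n W \<longrightarrow>
       contracting_generators Q S s3 n W g \<longrightarrow>
       (\<forall>i\<in>{1..n}. \<delta> \<le> r i \<and> admissible_radius Q S \<epsilon> (W i) (r i)) \<longrightarrow>
       t \<in> T_set Q S oV oP n W r g \<longrightarrow>
       fundamental_domain (affine_group n g t) (H_zero Q S oV oP n W r g t))"
proof (intro allI impI conjI)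
  interpret wing_geometry Q S oV oP
    by unfold_locales (use assms in auto)
  fix \<epsilon>' :: real
  assume "0 < \<epsilon>'"
  \<comment> \<open>The estimates with cosines need \<epsilon> \<le> \<open>pi\<close>. The
    truncation changes nothing for a nonempty frameset, which cannot be separated by more, and for
    \<open>n = 0\<close> separation is vacuous.\<close>
  define \<epsilon> where "\<epsilon> = min \<epsilon>' pi"
  have \<epsilon>: "0 < \<epsilon>" "\<epsilon> \<le> pi"
    using \<open>0 < \<epsilon>'\<close> by (simp_all add: \<epsilon>_def)
  have \<epsilon>_eq: "\<epsilon>' = \<epsilon>" if "frameset Q n W" "separated Q S oV oP \<epsilon>' n W" "i \<in> {1..n}" for n W i
    using separated_le_pi[OF that] by (simp add: \<epsilon>_def)
  show "\<exists>\<delta>>0. \<forall>n W. frameset Q n W \<longrightarrow> separated Q S oV oP \<epsilon>' n W \<longrightarrow>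
      (\<forall>i\<in>{1..n}. admissible_radius Q S \<epsilon>' (W i) \<delta>)"
  proof -
    obtain \<delta> where \<delta>: "0 < \<delta>" "\<And>F. is_frame Q F \<Longrightarrow>
        (\<And>x y. x \<in> fst F \<Longrightarrow> y \<in> snd F \<Longrightarrow> x \<noteq> 0 \<Longrightarrow> y \<noteq> 0 \<Longrightarrow> \<epsilon> \<le> angle N x y) \<Longrightarrow>
        admissible_radius Q S \<epsilon> F \<delta>"
      by (rule uniform_admissible_radius[OF \<epsilon>]) blast
    show ?thesis
    proof (intro exI[of _ \<delta>] conjI allI impI ballI)
      fix n W i
      assume data: "frameset Q n W" "separated Q S oV oP \<epsilon>' n W" "i \<in> {1..n}"
      have "admissible_radius Q S \<epsilon> (W i) \<delta>"
      proof (rule \<delta>(2))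
        show "is_frame Q (W i)"
          using data by (simp add: frameset_def)
        show "\<epsilon> \<le> angle N x y" if "x \<in> fst (W i)" "y \<in> snd (W i)" "x \<noteq> 0" "y \<noteq> 0" for x y
          using separated_frame[OF data that] \<epsilon>_eq[OF data] by simp
      qed
      then show "admissible_radius Q S \<epsilon>' (W i) \<delta>"
        using \<epsilon>_eq[OF data] by simp
    qed (rule \<delta>(1))
  qed
  fix \<delta> :: real
  assume "0 < \<delta>"
  \<comment> \<open>Orthogonal components can be compared through squared cosines only up to a right
    angle.\<close>
  define \<theta> where "\<theta> = min \<delta> (pi / 2)"
  have \<theta>: "0 < \<theta>" "\<theta> \<le> pi / 2" "\<theta> \<le> \<delta>"
    using \<open>0 < \<delta>\<close> by (simp_all add: \<theta>_def)
  have sin: "0 < (sin \<theta>)\<^sup>2" "(sin \<theta>)\<^sup>2 \<le> 1"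
    using \<theta> sin_gt_zero[of \<theta>] by (simp_all add: abs_square_le_1)
  \<comment> \<open>The denominator makes \<open>s * (2 + 12 * \<kappa> \<epsilon>)\<close> equal to
    \<open>(sin \<theta>)\<^sup>2\<close>, so that both conditions on \<open>s\<close> follow from
    one identity.\<close>
  define s where "s = (sin \<theta>)\<^sup>2 / (2 + 12 * \<kappa> \<epsilon>)"
  have k: "0 < \<kappa> \<epsilon>"
    by (rule \<kappa>_pos[OF \<epsilon>])
  have prod: "s * (2 + 12 * \<kappa> \<epsilon>) = (sin \<theta>)\<^sup>2"
    using k by (simp add: s_def)
  have "0 < s"
    using sin k by (simp add: s_def)
  have "0 < s * (12 * \<kappa> \<epsilon>)"
    using \<open>0 < s\<close> k by simp
  then have s_less: "s < (sin \<theta>)\<^sup>2" and s_le: "12 * \<kappa> \<epsilon> * s \<le> (sin \<theta>)\<^sup>2"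
    using prod \<open>0 < s\<close> by (simp_all add: algebra_simps)
  have "12 * \<kappa> \<epsilon> * s\<^sup>2 = (12 * \<kappa> \<epsilon> * s) * s"
    by (simp add: power2_eq_square)
  also have "\<dots> \<le> (sin \<theta>)\<^sup>2 * 1"
    using s_le s_less sin \<open>0 < s\<close> by (intro mult_mono) auto
  finally have s_sq: "12 * \<kappa> \<epsilon> * s\<^sup>2 \<le> (sin \<theta>)\<^sup>2"
    by simp
  show "\<exists>s3>0. \<forall>n W g r t.
       frameset Q n W \<longrightarrow> separated Q S oV oP \<epsilon>' n W \<longrightarrow>
       contracting_generators Q S s3 n W g \<longrightarrow>
       (\<forall>i\<in>{1..n}. \<delta> \<le> r i \<and> admissible_radius Q S \<epsilon>' (W i) (r i)) \<longrightarrow>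
       t \<in> T_set Q S oV oP n W r g \<longrightarrow>
       fundamental_domain (affine_group n g t) (H_zero Q S oV oP n W r g t)"
  proof (intro exI[of _ s] conjI allI impI)
    fix n W g r t
    assume data: "frameset Q n W" "separated Q S oV oP \<epsilon>' n W" "contracting_generators Q S s n W g"
      "\<forall>i\<in>{1..n}. \<delta> \<le> r i \<and> admissible_radius Q S \<epsilon>' (W i) (r i)" "t \<in> T_set Q S oV oP n W r g"
    have "contracting_data Q S oV oP \<epsilon> \<theta> s n W g r t"
    proof unfold_locales
      show "separated Q S oV oP \<epsilon> n W"
        using data(2) \<epsilon>_eq[OF data(1,2)] by (cases "n = 0") (auto simp: separated_def)
      show "\<theta> \<le> r i \<and> admissible_radius Q S \<epsilon> (W i) (r i)" if "i \<in> {1..n}" for i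
        using data(4) \<epsilon>_eq[OF data(1,2) that] \<theta>(3) that by (metis order_trans)
    qed (use \<epsilon> \<theta> \<open>0 < s\<close> s_less s_sq data in auto)
    then show "fundamental_domain (affine_group n g t) (H_zero Q S oV oP n W r g t)"
      by (rule contracting_data.fundamental_domain_H_zero)
  qed (rule \<open>0 < s\<close>)
qed

end
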